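(* Consider the one-parameter exponential family in which, conditionally on $\mathbf x_i$, the independent responses $Y_i$ ($i=1,\dots,n$) satisfy $$\log f_{Y_i}(y_i\mid\mathbf x_i;\theta_i)=\theta_iT(y_i)-d(\theta_i)+b(y_i),\qquad \theta_i=g(\beta_0+\mathbf x_i^{\rm T}\boldsymbol\beta),\quad g=\mathrm{id}.$$ Let $\hat\beta_0=g^{-1}(\hat\theta^{\rm MLE})=\hat\theta^{\rm MLE}$ be the optimizer of the intercept when $\boldsymbol\beta=\mathbf 0$. Assume that $\hat\beta_0$ is consistent, that $\beta_0$ does not depend on $n$, that $d\in C^3$, and that $T(Y)$ has finite fourth moment. Assume further: (1) the vectors $\mathbf x_1,\dots,\mathbf x_n\in\mathbb R^p$ (the rows of $X$) are fixed, uniformly bounded, $|x_{ij}|\le B_n$, and standardized so that $\sum_{i=1}^n\mathbf x_i=\mathbf 0$ and $\sum_{i=1}^n x_{ij}^2=n$ for $j=1,\dots,p$; (2) the number of variables $p=p_n$ is allowed to tend to infinity in such a way that $B_n^4(\log(pn))^7=O(n^{1-c})$ for some $c>0$. Then PIC is asymptotically pivotal (as $n\to\infty$) for $(\phi,g)=(\mathrm{id},\mathrm{id})$ when considering the loss function $$l_n(\boldsymbol\theta,\mathcal D)=\frac1n\sum_{i=1}^n\int^{\theta_i}\frac{d'(s)-T(y_i)}{\sqrt{d''(s)}}\,\mathrm ds .$$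
   Context: $\mathcal D=(X,\mathbf y)$, $X=X^{(n)}\in\mathbb R^{n\times p_n}$, $\mathbf y$ a realization of $(Y_1,\dots,Y_n)$. $\hat\theta^{\rm MLE}$ is the maximum likelihood estimator of the common canonical parameter $\theta$ when $\theta_1=\dots=\theta_n=\theta$ (i.e. $\boldsymbol\beta=\mathbf 0$). The indefinite integrals $\int^{\theta}$ denote antiderivatives (the choice of constant is irrelevant). PIC (pivotal information criterion): $\phi\left(l_n(\boldsymbol\theta,\mathcal D)\right)+\lambda\,C(\boldsymbol\beta)$ with $\boldsymbol\theta=g(\beta_0\mathbf 1+X\boldsymbol\beta)$ ($g$ componentwise), where $C(\boldsymbol\beta)=\sum_{i=1}^p\rho(\beta_i)$ with $\rho:\mathbb R\to[0,\infty)$ even, nondecreasing on $\mathbb R^+$, and $\lim_{\epsilon\to0^+}C(\epsilon\boldsymbol\beta)/\epsilon=\|\boldsymbol\beta\|_1$. The zero-thresholding function of the composite loss $L(\boldsymbol\beta,\beta_0;\mathcal D)=\phi(l_n(g(\beta_0\mathbf 1+X\boldsymbol\beta),\mathcal D))$ is $\lambda_0(\phi\circ l_n\circ g,\mathcal D)=\|\nabla_{\boldsymbol\beta}L(\mathbf 0,\hat\beta_0;\mathcal D)\|_\infty$. For $\mathbf Y_0$ generated from the model with $\boldsymbol\beta=\mathbf 0$ and intercept $\beta_0$, put $\Lambda_n=\lambda_0(\phi\circ l_n\circ g,(X,\mathbf Y_0))$. Asymptotically pivotal: the asymptotic distribution of $\Lambda_n$ does not depend on the nuisance parameter $\beta_0$,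 i.e. there are distribution functions $G_n$ not depending on $\beta_0$ (they may depend on $X^{(n)}$) such that, for every $\beta_0$, $\sup_{t\in\mathbb R}|\mathbb P_{\beta_0}(\Lambda_n\le t)-G_n(t)|\to0$ as $n\to\infty$. *)

theory Defs
  imports "HOL-Probability.Probability" "HOL-Library.Landau_Symbols"
begin

text \<open>
  The design matrix with \<open>n\<close> rows and \<open>p\<close> columns is a function
  \<open>X :: nat \<Rightarrow> nat \<Rightarrow> real\<close> of which only the entries \<open>X i j\<close> with \<open>i < n\<close>, \<open>j < p\<close>
  matter. A response vector is an element of the space of a product measure over \<open>{..<n}\<close>.
\<close>

definition linpred :: "nat \<Rightarrow> (nat \<Rightarrow> nat \<Rightarrow> real) \<Rightarrow> real \<Rightarrow> (nat \<Rightarrow> real) \<Rightarrow> nat \<Rightarrow> real" where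
  "linpred p X \<beta>0 \<beta> i = \<beta>0 + (\<Sum>j<p. X i j * \<beta> j)"

definition C3_on :: "real set \<Rightarrow> (real \<Rightarrow> real) \<Rightarrow> bool" where
  "C3_on S f \<longleftrightarrow>
     (\<forall>k<3. \<forall>x\<in>S. (deriv ^^ k) f differentiable (at x)) \<and> continuous_on S ((deriv ^^ 3) f)"


subsection \<open>One-parameter exponential families\<close>

definition expfam_log_density ::
    "('y \<Rightarrow> real) \<Rightarrow> (real \<Rightarrow> real) \<Rightarrow> ('y \<Rightarrow> real) \<Rightarrow> real \<Rightarrow> 'y \<Rightarrow> real" where
  "expfam_log_density T d b \<theta> y = \<theta> * T y - d \<theta> + b y"

text \<open>
  The dominating measure \<open>\<mu>\<close> is arbitrary, e.g. Lebesgue or counting measure. The real-valued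
  \<open>b\<close> is no restriction: points where the density vanishes are removed from \<open>\<mu>\<close>.
\<close>

definition expfam_law ::
    "'y measure \<Rightarrow> ('y \<Rightarrow> real) \<Rightarrow> (real \<Rightarrow> real) \<Rightarrow> ('y \<Rightarrow> real) \<Rightarrow> real \<Rightarrow> 'y measure" where
  "expfam_law \<mu> T d b \<theta> = density \<mu> (\<lambda>y. ennreal (exp (expfam_log_density T d b \<theta> y)))"

definition exponential_family ::
    "'y measure \<Rightarrow> ('y \<Rightarrow> real) \<Rightarrow> (real \<Rightarrow> real) \<Rightarrow> ('y \<Rightarrow> real) \<Rightarrow> real set \<Rightarrow> bool" where
  "exponential_family \<mu> T d b \<Theta> \<longleftrightarrow>
     T \<in> borel_measurable \<mu> \<and> b \<in> borel_measurable \<mu> \<and>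
     open \<Theta> \<and> is_interval \<Theta> \<and> \<Theta> \<noteq> {} \<and>
     (\<forall>\<theta>\<in>\<Theta>. prob_space (expfam_law \<mu> T d b \<theta>))"

definition model_law ::
    "'y measure \<Rightarrow> ('y \<Rightarrow> real) \<Rightarrow> (real \<Rightarrow> real) \<Rightarrow> ('y \<Rightarrow> real) \<Rightarrow> (real \<Rightarrow> real) \<Rightarrow>
     nat \<Rightarrow> nat \<Rightarrow> (nat \<Rightarrow> nat \<Rightarrow> real) \<Rightarrow> real \<Rightarrow> (nat \<Rightarrow> real) \<Rightarrow> (nat \<Rightarrow> 'y) measure" where
  "model_law \<mu> T d b g n p X \<beta>0 \<beta> =
     PiM {..<n} (\<lambda>i. expfam_law \<mu> T d b (g (linpred p X \<beta>0 \<beta> i)))"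

text \<open>
  For some samples the likelihood need not attain its maximum on the open set \<open>\<Theta>\<close> (e.g. for
  Bernoulli responses that all coincide). There the estimator may take any value of \<open>\<Theta>\<close>.
\<close>

definition is_mle ::
    "'y measure \<Rightarrow> ('y \<Rightarrow> real) \<Rightarrow> (real \<Rightarrow> real) \<Rightarrow> ('y \<Rightarrow> real) \<Rightarrow> real set \<Rightarrow>
     nat \<Rightarrow> ((nat \<Rightarrow> 'y) \<Rightarrow> real) \<Rightarrow> bool" where
  "is_mle \<mu> T d b \<Theta> n est \<longleftrightarrow>
     est \<in> borel_measurable (PiM {..<n} (\<lambda>_. \<mu>)) \<and>
     (\<forall>y\<in>space (PiM {..<n} (\<lambda>_. \<mu>)).
        let loglik = (\<lambda>\<theta>. \<Sum>i<n. expfam_log_density T d b \<theta> (y i))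
        in est y \<in> \<Theta> \<and>
           ((\<exists>\<theta>. is_arg_max loglik (\<lambda>\<theta>. \<theta> \<in> \<Theta>) \<theta>) \<longrightarrow>
              is_arg_max loglik (\<lambda>\<theta>. \<theta> \<in> \<Theta>) (est y)))"


subsection \<open>Losses, zero-thresholding function, asymptotic pivotality\<close>

text \<open>
  \<open>A y\<close> is an antiderivative on \<open>\<Theta>\<close> of the integrand belonging to the observation \<open>y\<close>; its
  additive constant is unconstrained and may depend on \<open>y\<close>.
\<close>

definition pic_antiderivative ::
    "'y measure \<Rightarrow> ('y \<Rightarrow> real) \<Rightarrow> (real \<Rightarrow> real) \<Rightarrow> real set \<Rightarrow> ('y \<Rightarrow> real \<Rightarrow> real) \<Rightarrow> bool" where
  "pic_antiderivative \<mu> T d \<Theta> A \<longleftrightarrow>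
     (\<forall>y\<in>space \<mu>. \<forall>s\<in>\<Theta>.
        (A y has_real_derivative (deriv d s - T y) / sqrt (deriv (deriv d) s)) (at s))"

definition pic_loss :: "('y \<Rightarrow> real \<Rightarrow> real) \<Rightarrow> nat \<Rightarrow> (nat \<Rightarrow> real) \<Rightarrow> (nat \<Rightarrow> 'y) \<Rightarrow> real" where
  "pic_loss A n \<theta> y = (1 / real n) * (\<Sum>i<n. A (y i) (\<theta> i))"

definition composite_loss ::
    "(real \<Rightarrow> real) \<Rightarrow> (nat \<Rightarrow> (nat \<Rightarrow> real) \<Rightarrow> (nat \<Rightarrow> 'y) \<Rightarrow> real) \<Rightarrow> (real \<Rightarrow> real) \<Rightarrow>
     nat \<Rightarrow> nat \<Rightarrow> (nat \<Rightarrow> nat \<Rightarrow> real) \<Rightarrow> (nat \<Rightarrow> 'y) \<Rightarrow> (nat \<Rightarrow> real) \<Rightarrow> real \<Rightarrow> real" where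
  "composite_loss \<phi> l g n p X y \<beta> \<beta>0 = \<phi> (l n (\<lambda>i. g (linpred p X \<beta>0 \<beta> i)) y)"

text \<open>
  The sup-norm of the vector of partial derivatives in \<open>\<beta>\<close> at \<open>\<beta> = 0\<close>; meaningful for \<open>p > 0\<close>.
\<close>

definition zero_threshold ::
    "(real \<Rightarrow> real) \<Rightarrow> (nat \<Rightarrow> (nat \<Rightarrow> real) \<Rightarrow> (nat \<Rightarrow> 'y) \<Rightarrow> real) \<Rightarrow> (real \<Rightarrow> real) \<Rightarrow>
     nat \<Rightarrow> nat \<Rightarrow> (nat \<Rightarrow> nat \<Rightarrow> real) \<Rightarrow> (nat \<Rightarrow> 'y) \<Rightarrow> real \<Rightarrow> real" where
  "zero_threshold \<phi> l g n p X y \<beta>0 =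
     Max ((\<lambda>j. \<bar>deriv (\<lambda>h. composite_loss \<phi> l g n p X y ((\<lambda>_. 0)(j := h)) \<beta>0) 0\<bar>) ` {..<p})"

text \<open>
  \<open>law n \<beta>0\<close> is the law of the response vector of size \<open>n\<close> when \<open>\<beta> = 0\<close> and the intercept is
  \<open>\<beta>0\<close>; \<open>B\<close> is the set of admissible intercepts and \<open>\<beta>0_hat n\<close> the intercept estimator. The
  penalty of the criterion does not enter its zero-thresholding function. The measures \<open>\<nu> n\<close>,
  whose distribution functions approximate that of the zero-thresholding statistic, are the
  same for all intercepts.
\<close>

definition pic_asymptotically_pivotal ::
    "(nat \<Rightarrow> real \<Rightarrow> (nat \<Rightarrow> 'y) measure) \<Rightarrow> real set \<Rightarrow> (real \<Rightarrow> real) \<Rightarrow>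
     (nat \<Rightarrow> (nat \<Rightarrow> real) \<Rightarrow> (nat \<Rightarrow> 'y) \<Rightarrow> real) \<Rightarrow> (real \<Rightarrow> real) \<Rightarrow> (nat \<Rightarrow> nat) \<Rightarrow>
     (nat \<Rightarrow> nat \<Rightarrow> nat \<Rightarrow> real) \<Rightarrow> (nat \<Rightarrow> (nat \<Rightarrow> 'y) \<Rightarrow> real) \<Rightarrow> bool" where
  "pic_asymptotically_pivotal law B \<phi> l g p X \<beta>0_hat \<longleftrightarrow>
     (\<exists>\<nu> :: nat \<Rightarrow> real measure.
        (\<forall>n. real_distribution (\<nu> n)) \<and>
        (\<forall>\<beta>0\<in>B.
           (\<lambda>n. SUP t. \<bar>measure (law n \<beta>0)
                          {y \<in> space (law n \<beta>0).
                             zero_threshold \<phi> l g n (p n) (X n) y (\<beta>0_hat n y) \<le> t}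
                        - cdf (\<nu> n) t\<bar>) \<longlonglongrightarrow> 0))"

end

theory Submission
  imports Defs "HOL-Real_Asymp.Real_Asymp"
begin

text \<open>
  Since the columns of the design are centred, the statistic equals \<open>R / \<surd>n\<close> times the maximum \<open>M\<close>
  of \<open>\<bar>n powr (-1/2) * (\<Sum>i. X i j * \<xi> i)\<bar>\<close> over \<open>j\<close>, where \<open>\<xi> i\<close> is the standardized \<open>T (y i)\<close> and
  \<open>R = \<surd>(d'' \<theta> / d'' \<theta>\<^sub>n)\<close> with \<open>\<theta>\<^sub>n\<close> the maximum likelihood estimator. It is compared with the
  same maximum for Gaussian \<open>\<xi>\<close>, whose law does not involve \<open>\<theta>\<close>. If \<open>d''\<close> vanishes anywhere, \<open>T\<close>
  is constant almost everywhere and the statistic is \<open>0\<close>.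

  The comparison of maxima smooths the indicator of \<open>M \<le> t\<close> by a logistic function of a
  log-sum-exp and exchanges the \<open>\<xi> i\<close> for Gaussian variables one at a time. Along a row of the
  design the third derivative of the smoothed indicator is bounded by a softmax average of the
  squared entries, and softmax weights hardly change when one summand is replaced, so that the
  errors are controlled by \<open>\<Sum>i. (X i j)\<^sup>2 = n\<close> and a single factor \<open>B n\<close>. The smoothing is undone
  by an anti-concentration inequality for Gaussian maxima. Finally \<open>R - 1 = O(n powr (-1/4))\<close> in
  probability, by Chebyshev's inequality and the score equation \<open>d' \<theta>\<^sub>n = (\<Sum>i. T (y i)) / n\<close>; this
  beats the growth of \<open>M\<close>, which is of order \<open>\<surd>(ln (p n))\<close>.
\<close>

section \<open>Gaussian product measures\<close>

text \<open>Two smoothing scales are kept apart because of the exponent 7. Powers of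
  \<open>n\<close> aside, with \<open>l\<close> the logarithm of \<open>p * n\<close>, the
  log-sum-exp needs \<open>\<beta>\<close> of order \<open>l * sqrt l\<close>, whereas the logistic
  step needs \<open>1 / \<psi>\<close> of order only \<open>sqrt l\<close>. A third derivative then
  costs \<open>l\<close> to the power 7/2; one common scale would cost the power 9/2. The estimator
  causes no dependence problem: centring removes it from the numerator, so it survives only in the
  scalar \<open>R\<close>, which is controlled pointwise outside one exceptional event. Exponential
  moments of \<open>T\<close>, available because \<open>\<Theta>\<close> is open, pay for the change
  of the softmax weights: with entries bounded by \<open>b\<close>, a summand of size
  \<open>s\<close> changes them by a factor \<open>exp (2 * \<beta> * b * \<bar>s\<bar>)\<close>,
  and \<open>\<beta> * b\<close> tends to 0. No covariances need to be estimated, because both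
  maxima use the same design with independent coordinates of mean 0 and variance 1.\<close>

lemma borel_measurable_pred_le [measurable (raw)]:
  fixes f g :: "'a \<Rightarrow> real"
  shows "f \<in> borel_measurable M \<Longrightarrow> g \<in> borel_measurable M \<Longrightarrow> Measurable.pred M (\<lambda>w. f w \<le> g w)"
  unfolding Measurable.pred_def by (rule borel_measurable_le)

text \<open>This is the Cameron-Martin formula in dimension one: completing the square turns a
  translated Gaussian density into an exponential tilt of the original one.\<close>

lemma std_normal_shift:
  "distr std_normal_distribution borel (\<lambda>z. z + c) =
   density std_normal_distribution (\<lambda>z. ennreal (exp (c * z - c\<^sup>2 / 2)))"
proof (rule measure_eqI)
  fix A assume "A \<in> sets (distr std_normal_distribution borel (\<lambda>z. z + c))"
  then have A[measurable]: "A \<in> sets borel" by simp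
  have dens: "std_normal_density (z - c) = std_normal_density z * exp (c * z - c\<^sup>2 / 2)" for z
  proof -
    have "- (z - c)\<^sup>2 / 2 = - z\<^sup>2 / 2 + (c * z - c\<^sup>2 / 2)"
      by (simp add: power2_eq_square field_simps)
    then show ?thesis
      unfolding std_normal_density_def by (simp only: exp_add)
  qed
  have "emeasure (distr std_normal_distribution borel (\<lambda>z. z + c)) A =
      (\<integral>\<^sup>+z. ennreal (std_normal_density z) * indicator A (z + c) \<partial>lborel)"
    using measurable_sets[of "\<lambda>z. z + c" borel borel A] A
    by (subst emeasure_distr, simp, simp, subst emeasure_density)
       (auto intro!: nn_integral_cong split: split_indicator)
  also have "\<dots> = (\<integral>\<^sup>+z. ennreal (std_normal_density (z - c)) * indicator A z
      \<partial>distr lborel borel ((+) c))"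
    by (subst nn_integral_distr) (auto simp: add.commute)
  also have "\<dots> = (\<integral>\<^sup>+z. ennreal (std_normal_density z) *
      (ennreal (exp (c * z - c\<^sup>2 / 2)) * indicator A z) \<partial>lborel)"
    unfolding lborel_distr_plus dens
    by (intro nn_integral_cong) (auto simp: ennreal_mult mult.assoc)
  also have "\<dots> = emeasure (density std_normal_distribution
      (\<lambda>z. ennreal (exp (c * z - c\<^sup>2 / 2)))) A"
    by (subst emeasure_density, simp, simp, subst nn_integral_density) auto
  finally show "emeasure (distr std_normal_distribution borel (\<lambda>z. z + c)) A =
    emeasure (density std_normal_distribution (\<lambda>z. ennreal (exp (c * z - c\<^sup>2 / 2)))) A" .
qed simp

abbreviation std_gaussian :: "'i set \<Rightarrow> ('i \<Rightarrow> real) measure" where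
  "std_gaussian I \<equiv> PiM I (\<lambda>_. std_normal_distribution)"

lemma prob_space_std_normal: "prob_space std_normal_distribution"
  by (rule prob_space_normal_density) simp

lemma prob_space_std_gaussian: "prob_space (std_gaussian I)"
  by (intro prob_space_PiM prob_space_std_normal)

lemma sets_std_gaussian [measurable_cong]: "sets (std_gaussian I) = sets (PiM I (\<lambda>_. borel))"
  by (intro sets_PiM_cong) auto

lemma space_std_gaussian: "space (std_gaussian I) = (\<Pi>\<^sub>E i\<in>I. UNIV)"
  by (simp add: space_PiM)

lemma std_gaussian_shift:
  assumes I: "finite I"
  shows "distr (std_gaussian I) (PiM I (\<lambda>_. borel)) (\<lambda>v. \<lambda>i\<in>I. v i + c i) =
    density (std_gaussian I) (\<lambda>v. ennreal (exp ((\<Sum>i\<in>I. c i * v i) - (\<Sum>i\<in>I. (c i)\<^sup>2) / 2)))"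
    (is "?L = ?R")
proof -
  \<comment> \<open>Both sides are identified with the product of these tilted marginals, by
    comparing measures of rectangles; the exponential of a sum splits into one factor per
    coordinate.\<close>
  define D where "D i = density std_normal_distribution (\<lambda>z. ennreal (exp (c i * z - (c i)\<^sup>2 / 2)))"
    for i
  have D: "D i = distr std_normal_distribution borel (\<lambda>z. z + c i)" for i
    unfolding D_def std_normal_shift ..
  interpret N: product_prob_space "\<lambda>_::'a. std_normal_distribution"
    by (intro product_prob_spaceI prob_space_std_normal)
  interpret D: product_prob_space D
    unfolding D by (intro product_prob_spaceI prob_space.prob_space_distr prob_space_std_normal)
        simp
  have D_sets [simp]: "sets (D i) = sets borel" for i by (simp add: D)
  have L: "?L = PiM I D"
  proof (rule D.PiM_eqI[OF I])
    show "sets ?L = sets (PiM I D)" by (auto intro!: sets_PiM_cong)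
    fix A assume A: "\<And>i. i \<in> I \<Longrightarrow> A i \<in> sets (D i)"
    have "emeasure ?L (Pi\<^sub>E I A) = emeasure (std_gaussian I)
        ((\<lambda>v. \<lambda>i\<in>I. v i + c i) -` Pi\<^sub>E I A \<inter> space (std_gaussian I))"
      using A I by (intro emeasure_distr) (auto intro!: sets_PiM_I_finite)
    also have "(\<lambda>v. \<lambda>i\<in>I. v i + c i) -` Pi\<^sub>E I A \<inter> space (std_gaussian I) =
        (\<Pi>\<^sub>E i\<in>I. (\<lambda>z. z + c i) -` A i)"
      by (auto simp: space_std_gaussian PiE_iff extensional_def)
    also have "emeasure (std_gaussian I) \<dots> =
        (\<Prod>i\<in>I. emeasure std_normal_distribution ((\<lambda>z. z + c i) -` A i))"
    proof (rule N.emeasure_PiM[OF I])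
      fix i assume "i \<in> I"
      then have "A i \<in> sets borel" using A by simp
      then have "(\<lambda>z. z + c i) -` A i \<inter> space borel \<in> sets borel"
        by (intro measurable_sets[where A = borel]) auto
      then show "(\<lambda>z. z + c i) -` A i \<in> sets std_normal_distribution" by simp
    qed
    also have "\<dots> = (\<Prod>i\<in>I. emeasure (D i) (A i))"
      using A by (intro prod.cong refl) (simp add: D emeasure_distr)
    finally show "emeasure ?L (Pi\<^sub>E I A) = (\<Prod>i\<in>I. emeasure (D i) (A i))" .
  qed
  have R: "?R = PiM I D"
  proof (rule D.PiM_eqI[OF I])
    show "sets ?R = sets (PiM I D)" by (auto intro!: sets_PiM_cong)
    fix A assume A: "\<And>i. i \<in> I \<Longrightarrow> A i \<in> sets (D i)"
    have "emeasure ?R (Pi\<^sub>E I A) = (\<integral>\<^sup>+v. ennreal (exp ((\<Sum>i\<in>I. c i * v i) -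
        (\<Sum>i\<in>I. (c i)\<^sup>2) / 2)) * indicator (Pi\<^sub>E I A) v \<partial>std_gaussian I)"
      using A I by (intro emeasure_density) (auto intro!: sets_PiM_I_finite)
    also have "\<dots> = (\<integral>\<^sup>+v. (\<Prod>i\<in>I. ennreal (exp (c i * v i - (c i)\<^sup>2 / 2)) *
        indicator (A i) (v i)) \<partial>std_gaussian I)"
    proof (intro nn_integral_cong)
      fix v assume "v \<in> space (std_gaussian I)"
      then have v: "v \<in> extensional I" by (simp add: space_std_gaussian PiE_def)
      have "(indicator (Pi\<^sub>E I A) v :: ennreal) = (\<Prod>i\<in>I. indicator (A i) (v i))"
        using I v by (auto simp: indicator_def PiE_iff prod_zero_iff)
      moreover have "exp ((\<Sum>i\<in>I. c i * v i) - (\<Sum>i\<in>I. (c i)\<^sup>2) / 2) =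
          (\<Prod>i\<in>I. exp (c i * v i - (c i)\<^sup>2 / 2))"
        using I by (simp add: exp_sum[symmetric] sum_subtractf sum_divide_distrib)
      ultimately show "ennreal (exp ((\<Sum>i\<in>I. c i * v i) - (\<Sum>i\<in>I. (c i)\<^sup>2) / 2)) *
          indicator (Pi\<^sub>E I A) v =
          (\<Prod>i\<in>I. ennreal (exp (c i * v i - (c i)\<^sup>2 / 2)) * indicator (A i) (v i))"
        by (simp add: prod.distrib prod_ennreal)
    qed
    also have "\<dots> = (\<Prod>i\<in>I. \<integral>\<^sup>+z. ennreal (exp (c i * z - (c i)\<^sup>2 / 2)) *
        indicator (A i) z \<partial>std_normal_distribution)"
      using A I by (intro N.product_nn_integral_prod) auto
    also have "\<dots> = (\<Prod>i\<in>I. emeasure (D i) (A i))"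
      using A unfolding D_def by (intro prod.cong refl, subst emeasure_density) auto
    finally show "emeasure ?R (Pi\<^sub>E I A) = (\<Prod>i\<in>I. emeasure (D i) (A i))" .
  qed
  show ?thesis unfolding L R ..
qed

text \<open>The shifted measure has density \<open>exp (s * W - s\<^sup>2 / 2)\<close> with \<open>W = (\<Sum>i\<in>I. a i * v i)\<close>.\<close>

lemma std_gaussian_shift_le:
  assumes I: "finite I" and unit: "(\<Sum>i\<in>I. (a i)\<^sup>2) = 1"
    and A: "A \<in> sets (PiM I (\<lambda>_. borel))" and A': "A' \<in> sets (PiM I (\<lambda>_. borel))"
    and sub: "\<And>v. v \<in> A \<Longrightarrow> (\<lambda>i\<in>I. v i + s * a i) \<in> A'"
    and u: "\<And>v. v \<in> A' \<Longrightarrow> s * (\<Sum>i\<in>I. a i * v i) \<le> u"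
  shows "measure (std_gaussian I) A \<le> exp (u - s\<^sup>2 / 2) * measure (std_gaussian I) A'"
proof -
  interpret G: prob_space "std_gaussian I" by (rule prob_space_std_gaussian)
  note [measurable] = A A'
  have AG: "A \<in> sets (std_gaussian I)" and A'G: "A' \<in> sets (std_gaussian I)"
    using A A' by (simp_all add: sets_std_gaussian)
  have sq: "(\<Sum>i\<in>I. (s * a i)\<^sup>2) = s\<^sup>2"
    by (simp add: power_mult_distrib sum_distrib_left[symmetric] unit)
  have "emeasure (std_gaussian I) A \<le> emeasure (distr (std_gaussian I) (PiM I (\<lambda>_. borel))
      (\<lambda>v. \<lambda>i\<in>I. v i + s * a i)) A'"
    using sub sets.sets_into_space[OF AG]
    by (subst emeasure_distr) (auto intro!: emeasure_mono)
  also have "\<dots> = (\<integral>\<^sup>+v. ennreal (exp ((\<Sum>i\<in>I. s * a i * v i) - s\<^sup>2 / 2)) * indicator A' v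
      \<partial>std_gaussian I)"
    unfolding std_gaussian_shift[OF I] sq by (subst emeasure_density) auto
  also have "\<dots> \<le> (\<integral>\<^sup>+v. ennreal (exp (u - s\<^sup>2 / 2)) * indicator A' v \<partial>std_gaussian I)"
  proof (intro nn_integral_mono)
    fix v
    show "ennreal (exp ((\<Sum>i\<in>I. s * a i * v i) - s\<^sup>2 / 2)) * indicator A' v
        \<le> ennreal (exp (u - s\<^sup>2 / 2)) * indicator A' v"
      using u[of v] by (auto split: split_indicator intro!: ennreal_leI
          simp: sum_distrib_left mult.assoc)
  qed
  also have "\<dots> = ennreal (exp (u - s\<^sup>2 / 2)) * emeasure (std_gaussian I) A'"
    by (rule nn_integral_cmult_indicator) fact
  finally show ?thesis
    by (simp add: G.emeasure_eq_measure ennreal_mult[symmetric])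
qed

text \<open>Translation by \<open>- s\<close> along the unit vector \<open>a\<close> carries the
  half-space beyond \<open>s\<close> into the half-space beyond 0, where the density of the
  translated law is at most \<open>exp (- s\<^sup>2 / 2)\<close>. No tail integral has to be
  computed.\<close>

lemma std_gaussian_tail:
  assumes I: "finite I" and unit: "(\<Sum>i\<in>I. (a i)\<^sup>2) = 1" and s: "0 \<le> s"
  shows "measure (std_gaussian I) {v \<in> space (std_gaussian I). s < (\<Sum>i\<in>I. a i * v i)} \<le> exp (- s\<^sup>2
      / 2)"
proof -
  interpret G: prob_space "std_gaussian I" by (rule prob_space_std_gaussian)
  define A where "A t = {v \<in> space (std_gaussian I). t < (\<Sum>i\<in>I. a i * v i)}" for t
  have A: "A t \<in> sets (PiM I (\<lambda>_. borel))" for t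
    unfolding A_def sets_std_gaussian[symmetric] by measurable
  have "measure (std_gaussian I) (A s) \<le> exp (0 - (- s)\<^sup>2 / 2) * measure (std_gaussian I) (A 0)"
  proof (rule std_gaussian_shift_le[OF I unit A A])
    fix v assume "v \<in> A s"
    then have "s < (\<Sum>i\<in>I. a i * v i)" by (simp add: A_def)
    moreover have "(\<Sum>i\<in>I. a i * (v i + - s * a i)) = (\<Sum>i\<in>I. a i * v i) - s * (\<Sum>i\<in>I. (a i)\<^sup>2)"
      by (simp add: algebra_simps sum_subtractf sum_distrib_left power2_eq_square)
    ultimately show "(\<lambda>i\<in>I. v i + - s * a i) \<in> A 0"
      using unit by (simp add: A_def space_std_gaussian)
  next
    fix v assume "v \<in> A 0"
    then show "- s * (\<Sum>i\<in>I. a i * v i) \<le> 0" using s by (simp add: A_def)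
  qed
  also have "\<dots> \<le> exp (- s\<^sup>2 / 2) * 1" by (intro mult_mono) auto
  finally show ?thesis by (simp add: A_def)
qed

text \<open>
  Translation along \<open>a j\<close> keeps \<open>j\<close> a maximiser because the correlations are at most 1, so the
  mass of a strip \<open>x < max \<le> x + \<delta>\<close> reappears, up to a constant, in about \<open>1 / (\<delta> y)\<close> further
  disjoint strips. The order on the indices breaks ties between maximisers.
\<close>

lemma gaussian_max_anticoncentration:
  fixes a :: "'i \<Rightarrow> 'j::linorder \<Rightarrow> real"
  assumes I: "finite I" and J: "finite J"
    and unit: "\<And>j. j \<in> J \<Longrightarrow> (\<Sum>i\<in>I. (a i j)\<^sup>2) = 1"
    and \<delta>: "0 < \<delta>" and y: "1 \<le> y" "x + \<delta> \<le> y"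
  shows "measure (std_gaussian I) {v \<in> space (std_gaussian I). \<forall>j\<in>J. (\<Sum>i\<in>I. a i j * v i) \<le> x + \<delta>}
    \<le> measure (std_gaussian I) {v \<in> space (std_gaussian I). \<forall>j\<in>J. (\<Sum>i\<in>I. a i j * v i) \<le> x}
      + exp (3 / 2) * \<delta> * y"
proof -
  interpret G: prob_space "std_gaussian I" by (rule prob_space_std_gaussian)
  note J[simp]
  define W where "W j v = (\<Sum>i\<in>I. a i j * v i)" for j and v :: "'i \<Rightarrow> real"
  have W[measurable]: "W j \<in> borel_measurable (PiM I (\<lambda>_. borel))" for j
    unfolding W_def by measurable
  define S where "S j l = {v \<in> space (std_gaussian I). (\<forall>k\<in>J. W k v \<le> W j v \<and> (k < j \<longrightarrow> W k v < W j
      v))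
    \<and> x + real l * \<delta> < W j v \<and> W j v \<le> x + real (Suc l) * \<delta>}" for j l
  have S[measurable]: "S j l \<in> sets (std_gaussian I)" for j l
    unfolding S_def by measurable
  have uniq: "j = j' \<and> l = l'" if j: "j \<in> J" "j' \<in> J" and v: "v \<in> S j l" "v \<in> S j' l'" for j j' l
      l' v
  proof -
    have "W j v = W j' v" using v j by (auto simp: S_def intro: antisym)
    then have jj: "j = j'" using v j by (force simp: S_def neq_iff)
    moreover have "l = l'"
    proof (rule ccontr)
      assume "l \<noteq> l'"
      then have "real (Suc l) \<le> real l' \<or> real (Suc l') \<le> real l" by linarith
      then have "real (Suc l) * \<delta> \<le> real l' * \<delta> \<or> real (Suc l') * \<delta> \<le> real l * \<delta>"
        using \<delta> by (auto intro!: mult_right_mono simp del: of_nat_Suc)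
      then show False using v jj by (auto simp: S_def)
    qed
    ultimately show ?thesis by simp
  qed
  have disj: "disjoint_family_on (\<lambda>(j, l). S j l) (J \<times> UNIV)"
    unfolding disjoint_family_on_def using uniq by auto
  have step: "measure (std_gaussian I) (S j 0) \<le> exp (3 / 2) * measure (std_gaussian I) (S j l)"
    if j: "j \<in> J" and l: "real l * (\<delta> * y) \<le> 1" for j l
  proof -
    define s where "s = real l * \<delta>"
    have s0: "0 \<le> s" using \<delta> by (simp add: s_def)
    have sy: "s * y \<le> 1" using l by (simp add: s_def mult_ac)
    have s1: "s \<le> 1" using mult_left_mono[OF y(1) s0] sy by simp
    have "measure (std_gaussian I) (S j 0) \<le>
        exp (s * (x + \<delta> + s) - s\<^sup>2 / 2) * measure (std_gaussian I) (S j l)"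
    proof (rule std_gaussian_shift_le[OF I unit[OF j]])
      show "S j 0 \<in> sets (PiM I (\<lambda>_. borel))" "S j l \<in> sets (PiM I (\<lambda>_. borel))"
        using S by (simp_all only: sets_std_gaussian)
    next
      fix v assume v: "v \<in> S j 0"
      let ?v = "\<lambda>i\<in>I. v i + s * a i j"
      have Wk: "W k ?v = W k v + s * (\<Sum>i\<in>I. a i k * a i j)" for k
        by (simp add: W_def algebra_simps sum.distrib sum_distrib_left)
      have r: "(\<Sum>i\<in>I. a i k * a i j) \<le> 1" if "k \<in> J" for k
      proof -
        have "(\<Sum>i\<in>I. a i k * a i j) \<le> (\<Sum>i\<in>I. ((a i k)\<^sup>2 + (a i j)\<^sup>2) / 2)"
        proof (intro sum_mono)
          fix i
          show "a i k * a i j \<le> ((a i k)\<^sup>2 + (a i j)\<^sup>2) / 2"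
            using sum_squares_bound[of "a i k" "a i j"] by simp
        qed
        also have "\<dots> = 1" using unit[OF that] unit[OF j]
          by (simp add: sum.distrib sum_divide_distrib[symmetric])
        finally show ?thesis .
      qed
      have Wk_le: "W k ?v \<le> W k v + s" if "k \<in> J" for k
        unfolding Wk using mult_left_mono[OF r[OF that] s0] by simp
      have Wj: "W j ?v = W j v + s"
        using Wk[of j] unit[OF j] by (simp add: power2_eq_square)
      have "W k ?v \<le> W j ?v \<and> (k < j \<longrightarrow> W k ?v < W j ?v)" if "k \<in> J" for k
        using v Wk_le[OF that] that unfolding Wj S_def by fastforce
      moreover have "x + real l * \<delta> < W j ?v" "W j ?v \<le> x + real (Suc l) * \<delta>"
        using v unfolding Wj by (simp_all add: S_def s_def algebra_simps)
      ultimately show "?v \<in> S j l" by (simp add: S_def space_std_gaussian)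
    next
      fix v assume "v \<in> S j l"
      then have "W j v \<le> x + \<delta> + s" by (simp add: S_def s_def algebra_simps)
      then show "s * (\<Sum>i\<in>I. a i j * v i) \<le> s * (x + \<delta> + s)"
        using s0 by (auto simp: W_def intro: mult_left_mono)
    qed
    \<comment> \<open>On the target strip the linear form is at most
      \<open>x + \<delta> + s\<close>, so the exponent is
      \<open>s * (x + \<delta>) + s\<^sup>2 / 2\<close>. Its parts are at most 1 and 1/2, because
      \<open>s * y \<le> 1\<close> and \<open>1 \<le> y\<close>; this is the origin of 3/2.\<close>
    also have "s * (x + \<delta> + s) - s\<^sup>2 / 2 \<le> 3 / 2"
    proof -
      have "s * (x + \<delta>) \<le> s * y" using y s0 by (intro mult_left_mono) auto
      moreover have "s * s \<le> 1" using s0 s1 by (simp add: mult_le_one)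
      ultimately show ?thesis using sy by (simp add: algebra_simps power2_eq_square)
    qed
    finally show ?thesis by (simp add: mult_right_mono)
  qed
  \<comment> \<open>The strips 0 to \<open>K\<close> are those reachable under the condition
    \<open>s * y \<le> 1\<close> of \<open>step\<close>. They are disjoint, each carries at least
    the fraction \<open>exp (- 3 / 2)\<close> of the mass of strip 0, and there are at least
    \<open>1 / (\<delta> * y)\<close> of them.\<close>
  define K where "K = nat \<lfloor>1 / (\<delta> * y)\<rfloor>"
  have \<delta>y: "0 < \<delta> * y" using \<delta> y by simp
  have K: "real l * (\<delta> * y) \<le> 1" if "l \<le> K" for l
  proof -
    have "real l \<le> 1 / (\<delta> * y)" using that \<delta>y unfolding K_def
      by (metis divide_nonneg_pos floor_of_nat le_floor_iff le_nat_iff of_int_of_nat_eq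
          zero_le_floor zero_le_one)
    then show ?thesis using \<delta>y by (simp add: field_simps)
  qed
  have K1: "1 \<le> real (Suc K) * (\<delta> * y)"
  proof -
    have "1 / (\<delta> * y) \<le> real (Suc K)" unfolding K_def using \<delta>y by simp linarith
    then show ?thesis using \<delta>y by (simp add: field_simps)
  qed
  define s where "s l = (\<Sum>j\<in>J. measure (std_gaussian I) (S j l))" for l
  have s_le: "s 0 \<le> exp (3 / 2) * s l" if "l \<le> K" for l
    unfolding s_def sum_distrib_left by (intro sum_mono step K that)
  have tot: "(\<Sum>l\<le>K. s l) \<le> 1"
  proof -
    have "(\<Sum>l\<le>K. s l) = (\<Sum>(j, l)\<in>J \<times> {..K}. measure (std_gaussian I) (S j l))"
      unfolding s_def by (subst sum.swap) (simp add: sum.cartesian_product)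
    also have "\<dots> = measure (std_gaussian I) (\<Union>(j, l)\<in>J \<times> {..K}. S j l)"
    proof -
      have "disjoint_family_on (\<lambda>(j, l). S j l) (J \<times> {..K})"
        by (rule disjoint_family_on_mono[OF _ disj]) auto
      moreover have "(\<lambda>(j, l). S j l) ` (J \<times> {..K}) \<subseteq> G.events" by (auto simp: S)
      ultimately show ?thesis
        by (subst G.finite_measure_finite_Union) (auto simp: case_prod_beta)
    qed
    also have "\<dots> \<le> 1" by (rule G.prob_le_1)
    finally show ?thesis .
  qed
  have "s 0 \<le> exp (3 / 2) * \<delta> * y"
  proof -
    have s0: "0 \<le> s 0" unfolding s_def by (intro sum_nonneg) simp
    have "real (Suc K) * s 0 = (\<Sum>l\<le>K. s 0)" by simp
    also have "\<dots> \<le> (\<Sum>l\<le>K. exp (3 / 2) * s l)" by (intro sum_mono s_le) simp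
    also have "\<dots> \<le> exp (3 / 2)" using tot by (simp add: sum_distrib_left[symmetric])
    finally have *: "real (Suc K) * s 0 \<le> exp (3 / 2)" .
    have "s 0 \<le> real (Suc K) * (\<delta> * y) * s 0" using K1 s0 by (simp add: mult_le_cancel_right1 del:
        of_nat_Suc)
    also have "\<dots> = (\<delta> * y) * (real (Suc K) * s 0)" by simp
    also have "\<dots> \<le> (\<delta> * y) * exp (3 / 2)" using * \<delta>y by (intro mult_left_mono) auto
    finally show ?thesis by (simp add: mult_ac)
  qed
  moreover have "measure (std_gaussian I) {v \<in> space (std_gaussian I). \<forall>j\<in>J. W j v \<le> x + \<delta>}
    \<le> measure (std_gaussian I) {v \<in> space (std_gaussian I). \<forall>j\<in>J. W j v \<le> x} + s 0"
  proof -
    have U: "(\<Union>j\<in>J. S j 0) \<in> sets (std_gaussian I)"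
      by (intro sets.finite_UN J S)
    have B: "{v \<in> space (std_gaussian I). \<forall>j\<in>J. W j v \<le> x} \<in> sets (std_gaussian I)"
      by measurable
    have "measure (std_gaussian I) {v \<in> space (std_gaussian I). \<forall>j\<in>J. W j v \<le> x + \<delta>} \<le>
      measure (std_gaussian I) ({v \<in> space (std_gaussian I). \<forall>j\<in>J. W j v \<le> x} \<union> (\<Union>j\<in>J. S j 0))"
    proof (rule G.finite_measure_mono)
      show "{v \<in> space (std_gaussian I). \<forall>j\<in>J. W j v \<le> x} \<union> (\<Union>j\<in>J. S j 0) \<in> sets (std_gaussian I)"
        by (intro sets.Un U B)
      show "{v \<in> space (std_gaussian I). \<forall>j\<in>J. W j v \<le> x + \<delta>} \<subseteq>
          {v \<in> space (std_gaussian I). \<forall>j\<in>J. W j v \<le> x} \<union> (\<Union>j\<in>J. S j 0)"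
      proof
        fix v assume v: "v \<in> {v \<in> space (std_gaussian I). \<forall>j\<in>J. W j v \<le> x + \<delta>}"
        show "v \<in> {v \<in> space (std_gaussian I). \<forall>j\<in>J. W j v \<le> x} \<union> (\<Union>j\<in>J. S j 0)"
        proof (cases "\<forall>j\<in>J. W j v \<le> x")
          case False
          \<comment> \<open>The maximum lies in the strip above \<open>x\<close>; the least index
            attaining it satisfies the strict inequalities that \<open>S\<close> demands of smaller
            indices.\<close>
          then have ne: "J \<noteq> {}" by auto
          define m where "m = Max ((\<lambda>j. W j v) ` J)"
          define j where "j = Min {j \<in> J. W j v = m}"
          have "m \<in> (\<lambda>j. W j v) ` J" unfolding m_def using J ne by (intro Max_in) auto
          then have "{j \<in> J. W j v = m} \<noteq> {}" by auto
          then have "j \<in> {j \<in> J. W j v = m}" unfolding j_def using J by (intro Min_in) auto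
          then have j: "j \<in> J" "W j v = m" by auto
          have le: "W k v \<le> m" if "k \<in> J" for k
            unfolding m_def using J that by (intro Max_ge) auto
          have lt: "W k v < m" if "k \<in> J" "k < j" for k
          proof (rule ccontr)
            assume "\<not> W k v < m"
            then have "k \<in> {j \<in> J. W j v = m}" using le[OF that(1)] that by auto
            then have "j \<le> k" unfolding j_def using J by (intro Min_le) auto
            then show False using that by simp
          qed
          have "x < m" using False le by (meson linorder_not_le order_less_le_trans)
          then have "v \<in> S j 0" using j le lt v by (auto simp: S_def)
          then show ?thesis using j by auto
        qed (use v in auto)
      qed
    qed
    also have "\<dots> \<le> measure (std_gaussian I) {v \<in> space (std_gaussian I). \<forall>j\<in>J. W j v \<le> x} +
        measure (std_gaussian I) (\<Union>j\<in>J. S j 0)"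
      by (intro measure_Un_le U B)
    also have "measure (std_gaussian I) (\<Union>j\<in>J. S j 0) \<le> s 0"
      unfolding s_def using J by (intro measure_UNION_le) auto
    finally show ?thesis by simp
  qed
  ultimately show ?thesis unfolding W_def by simp
qed

section \<open>Smoothing the maximum\<close>

definition softmax :: "real \<Rightarrow> 'j set \<Rightarrow> ('j \<Rightarrow> real) \<Rightarrow> 'j \<Rightarrow> real" where
  "softmax \<beta> J w j = exp (\<beta> * w j) / (\<Sum>k\<in>J. exp (\<beta> * w k))"

definition smooth_max :: "real \<Rightarrow> 'j set \<Rightarrow> ('j \<Rightarrow> real) \<Rightarrow> real" where
  "smooth_max \<beta> J w = ln (\<Sum>k\<in>J. exp (\<beta> * w k)) / \<beta>"

text \<open>For positive \<open>\<psi>\<close> this decreases in \<open>z\<close> from 1 to 0, with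
  transition at \<open>t\<close>, and so imitates the indicator of \<open>z \<le> t\<close>.\<close>

definition smooth_step :: "real \<Rightarrow> real \<Rightarrow> real \<Rightarrow> real" where
  "smooth_step \<psi> t z = 1 / (1 + exp ((z - t) / \<psi>))"

lemma smooth_step_bounds: "0 < smooth_step \<psi> t z" "smooth_step \<psi> t z < 1"
  by (auto simp: smooth_step_def add_pos_pos)

context
  fixes \<beta> :: real and J :: "'j set"
  assumes J: "finite J" "J \<noteq> {}" and \<beta>: "0 < \<beta>"
begin

lemma expsum_pos: "0 < (\<Sum>k\<in>J. exp (\<beta> * w k))"
  using J by (intro sum_pos) auto

lemma softmax_nonneg: "0 \<le> softmax \<beta> J w j"
  using expsum_pos[of w] by (simp add: softmax_def)

lemma sum_softmax: "(\<Sum>j\<in>J. softmax \<beta> J w j) = 1"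
  using expsum_pos[of w] by (simp add: softmax_def sum_divide_distrib[symmetric])

text \<open>Numerator and denominator of the weight each change by at most the factor
  \<open>exp (\<beta> * r)\<close>.\<close>

lemma softmax_stable:
  assumes "\<And>k. k \<in> J \<Longrightarrow> \<bar>w' k - w k\<bar> \<le> r" and j: "j \<in> J"
  shows "softmax \<beta> J w' j \<le> exp (2 * \<beta> * r) * softmax \<beta> J w j"
proof -
  have le: "\<beta> * w' k \<le> \<beta> * r + \<beta> * w k" "\<beta> * w k \<le> \<beta> * r + \<beta> * w' k" if "k \<in> J" for k
    using assms(1)[OF that] \<beta> by (auto simp: distrib_left[symmetric])
  have num: "exp (\<beta> * w' j) \<le> exp (\<beta> * r) * exp (\<beta> * w j)"
    using le(1)[OF j] by (simp add: exp_add[symmetric])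
  have "(\<Sum>k\<in>J. exp (\<beta> * w k)) \<le> (\<Sum>k\<in>J. exp (\<beta> * r) * exp (\<beta> * w' k))"
    using le(2) by (intro sum_mono) (simp add: exp_add[symmetric])
  then have den: "(\<Sum>k\<in>J. exp (\<beta> * w k)) \<le> exp (\<beta> * r) * (\<Sum>k\<in>J. exp (\<beta> * w' k))"
    by (simp add: sum_distrib_left)
  have "exp (\<beta> * w' j) * (\<Sum>k\<in>J. exp (\<beta> * w k)) \<le>
      (exp (\<beta> * r) * exp (\<beta> * w j)) * (exp (\<beta> * r) * (\<Sum>k\<in>J. exp (\<beta> * w' k)))"
    using expsum_pos[of w] by (intro mult_mono num den) auto
  also have "\<dots> = (exp (2 * \<beta> * r) * exp (\<beta> * w j)) * (\<Sum>k\<in>J. exp (\<beta> * w' k))"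
    by (simp add: mult_exp_exp algebra_simps)
  finally show ?thesis
    using expsum_pos[of w] expsum_pos[of w'] by (simp add: softmax_def field_simps)
qed

lemma smooth_max_ge: "j \<in> J \<Longrightarrow> w j \<le> smooth_max \<beta> J w"
proof -
  assume j: "j \<in> J"
  have "exp (\<beta> * w j) \<le> (\<Sum>k\<in>J. exp (\<beta> * w k))"
    using J j by (intro member_le_sum) auto
  then have "\<beta> * w j \<le> ln (\<Sum>k\<in>J. exp (\<beta> * w k))"
    using expsum_pos[of w] by (simp add: ln_ge_iff)
  then show ?thesis using \<beta> by (simp add: smooth_max_def field_simps)
qed

lemma smooth_max_le:
  assumes "\<And>j. j \<in> J \<Longrightarrow> w j \<le> t"
  shows "smooth_max \<beta> J w \<le> t + ln (card J) / \<beta>"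
proof -
  have "(\<Sum>k\<in>J. exp (\<beta> * w k)) \<le> (\<Sum>k\<in>J. exp (\<beta> * t))"
    using assms \<beta> by (intro sum_mono) auto
  then have "ln (\<Sum>k\<in>J. exp (\<beta> * w k)) \<le> ln (card J * exp (\<beta> * t))"
    using expsum_pos[of w] J by (subst ln_le_cancel_iff) (auto simp: card_gt_0_iff)
  also have "\<dots> = ln (card J) + \<beta> * t"
    using J by (subst ln_mult_pos) (auto simp: card_gt_0_iff)
  finally show ?thesis using \<beta> by (simp add: smooth_max_def field_simps)
qed

text \<open>Differentiating a softmax average of \<open>x j ^ k\<close> in \<open>s\<close> yields
  \<open>\<beta>\<close> times a covariance under the softmax weights, so the derivatives of the
  log-sum-exp along the row \<open>x\<close> are cumulants of \<open>x\<close>. In the third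
  derivative one factor is bounded by \<open>b\<close>, but a softmax average of squares is
  retained, since only such averages can later be summed over the rows. The Taylor coefficients stay
  anonymous: they cancel between two laws with equal first and second moments.\<close>

lemma smooth_max_taylor:
  fixes w x :: "'j \<Rightarrow> real"
  assumes \<psi>: "0 < \<psi>" "1 / \<psi> \<le> \<beta>" and b: "\<And>j. j \<in> J \<Longrightarrow> \<bar>x j\<bar> \<le> b"
  shows "\<exists>c1 c2. \<forall>s. \<bar>smooth_step \<psi> t (smooth_max \<beta> J (\<lambda>j. w j + s * x j))
      - (smooth_step \<psi> t (smooth_max \<beta> J w) + c1 * s + c2 * s\<^sup>2)\<bar>
    \<le> (2 * \<beta>\<^sup>2 / \<psi>) * b * (\<Sum>j\<in>J. softmax \<beta> J w j * (x j)\<^sup>2) * (\<bar>s\<bar> ^ 3 * exp (2 * \<beta> * b * \<bar>s\<bar>))"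
proof -
  define \<pi> where "\<pi> s j = softmax \<beta> J (\<lambda>j. w j + s * x j) j" for s j
  define A where "A k s = (\<Sum>j\<in>J. \<pi> s j * x j ^ k)" for k s
  define N where "N k s = (\<Sum>j\<in>J. exp (\<beta> * (w j + s * x j)) * x j ^ k)" for k s
  have N0: "0 < N 0 s" for s using expsum_pos by (simp add: N_def)
  have A_N: "A k s = N k s / N 0 s" for k s
    by (simp add: A_def \<pi>_def softmax_def N_def sum_divide_distrib)
  have \<pi>0: "0 \<le> \<pi> s j" and \<pi>1: "(\<Sum>j\<in>J. \<pi> s j) = 1" for s j
    unfolding \<pi>_def using softmax_nonneg sum_softmax by auto
  have dN: "(N k has_real_derivative \<beta> * N (Suc k) s) (at s)" for k s
    unfolding N_def
    by (auto intro!: derivative_eq_intros sum.cong simp: sum_distrib_left algebra_simps)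
  have dA: "(A k has_real_derivative \<beta> * (A (Suc k) s - A k s * A 1 s)) (at s)" for k s
  proof -
    have "((\<lambda>s. N k s / N 0 s) has_real_derivative
        (\<beta> * N (Suc k) s * N 0 s - N k s * (\<beta> * N (Suc 0) s)) / (N 0 s * N 0 s)) (at s)"
      by (rule DERIV_divide[OF dN dN]) (use N0[of s] in simp)
    moreover have "A k = (\<lambda>s. N k s / N 0 s)" by (simp add: A_N fun_eq_iff)
    ultimately show ?thesis using N0[of s] by (simp add: A_N field_simps)
  qed
  define u where "u s = smooth_max \<beta> J (\<lambda>j. w j + s * x j)" for s
  have du: "(u has_real_derivative A 1 s) (at s)" for s
  proof -
    have "((\<lambda>s. ln (N 0 s) / \<beta>) has_real_derivative (\<beta> * N (Suc 0) s) / N 0 s / \<beta>) (at s)"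
      using dN[of 0 s] N0[of s] by (auto intro!: derivative_eq_intros)
    moreover have "u = (\<lambda>s. ln (N 0 s) / \<beta>)" by (simp add: u_def smooth_max_def N_def fun_eq_iff)
    ultimately show ?thesis using \<beta> by (simp add: A_N)
  qed
  define g where "g s = smooth_step \<psi> t (u s)" for s
  \<comment> \<open>Up to the powers of \<open>\<beta>\<close> and the factor
    \<open>1 / \<psi>\<close>, the functions \<open>v\<close>, \<open>v1\<close>, \<open>v2\<close>
    are mean, variance and third cumulant of \<open>x\<close> under the softmax weights. The
    logistic equation, with derivative of \<open>g\<close> equal to
    \<open>(g\<^sup>2 - g) * v\<close>, expresses all derivatives of \<open>g\<close> through
    them.\<close>
  define v where "v s = A 1 s / \<psi>" for s
  define v1 where "v1 s = \<beta> * (A 2 s - A 1 s ^ 2) / \<psi>" for s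
  define v2 where "v2 s = \<beta>\<^sup>2 * (A 3 s - 3 * A 1 s * A 2 s + 2 * A 1 s ^ 3) / \<psi>" for s
  define g1 where "g1 s = ((g s)\<^sup>2 - g s) * v s" for s
  define g2 where "g2 s = (2 * g s - 1) * g1 s * v s + ((g s)\<^sup>2 - g s) * v1 s" for s
  define g3 where "g3 s = 2 * (g1 s)\<^sup>2 * v s + (2 * g s - 1) * g2 s * v s
    + 2 * ((2 * g s - 1) * g1 s * v1 s) + ((g s)\<^sup>2 - g s) * v2 s" for s
  have dA1: "(A 1 has_real_derivative \<beta> * (A 2 s - A 1 s * A 1 s)) (at s)"
    and dA2: "(A 2 has_real_derivative \<beta> * (A 3 s - A 2 s * A 1 s)) (at s)" for s
    using dA[of 1 s] dA[of 2 s] by (simp_all add: eval_nat_numeral)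
  have dv: "(v has_real_derivative v1 s) (at s)" for s
    using DERIV_cdivide[OF dA1, of \<psi>] by (simp add: v_def[abs_def] v1_def power2_eq_square)
  have dv1: "(v1 has_real_derivative v2 s) (at s)" for s
  proof -
    have "((\<lambda>s. \<beta> * (A 2 s - A 1 s * A 1 s) / \<psi>) has_real_derivative
        \<beta> * (\<beta> * (A 3 s - A 2 s * A 1 s) - (\<beta> * (A 2 s - A 1 s * A 1 s) * A 1 s
          + \<beta> * (A 2 s - A 1 s * A 1 s) * A 1 s)) / \<psi>) (at s)"
      by (intro DERIV_cdivide DERIV_cmult DERIV_diff DERIV_mult dA1 dA2)
    moreover have "\<beta> * (\<beta> * (A 3 s - A 2 s * A 1 s) - (\<beta> * (A 2 s - A 1 s * A 1 s) * A 1 s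
          + \<beta> * (A 2 s - A 1 s * A 1 s) * A 1 s)) = \<beta>\<^sup>2 * (A 3 s - 3 * A 1 s * A 2 s + 2 * A 1 s ^
              3)"
      by algebra
    ultimately show ?thesis unfolding v1_def[abs_def] v2_def by (simp only: power2_eq_square[of "A
        1 _"])
  qed
  have dg: "(g has_real_derivative g1 s) (at s)" for s
  proof -
    have e: "1 + exp ((u s - t) / \<psi>) > 0" by (simp add: add_pos_pos)
    have "((\<lambda>s. 1 / (1 + exp ((u s - t) / \<psi>))) has_real_derivative
       - (exp ((u s - t) / \<psi>) * (A 1 s / \<psi>)) / (1 + exp ((u s - t) / \<psi>))\<^sup>2) (at s)"
      using e \<psi> by (auto intro!: derivative_eq_intros du simp: power2_eq_square)
    moreover have "- (exp ((u s - t) / \<psi>) * (A 1 s / \<psi>)) / (1 + exp ((u s - t) / \<psi>))\<^sup>2 = g1 s"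
    proof -
      define E where "E = exp ((u s - t) / \<psi>)"
      have "(1 / D)\<^sup>2 - 1 / D = (1 - D) / D\<^sup>2" if "D > 0" for D :: real
        using that by (simp add: field_simps power2_eq_square)
      from this[OF e] have "(1 / (1 + E))\<^sup>2 - 1 / (1 + E) = - E / (1 + E)\<^sup>2"
        by (simp add: E_def)
      then show ?thesis by (simp add: g1_def g_def v_def smooth_step_def E_def)
    qed
    moreover have "g = (\<lambda>s. 1 / (1 + exp ((u s - t) / \<psi>)))"
      by (simp add: g_def smooth_step_def fun_eq_iff)
    ultimately show ?thesis by simp
  qed
  have dq: "((\<lambda>s. (g s)\<^sup>2 - g s) has_real_derivative (2 * g s - 1) * g1 s) (at s)" for s
    using DERIV_diff[OF DERIV_mult[OF dg dg] dg, of s] by (simp add: power2_eq_square algebra_simps)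
  have dg1: "(g1 has_real_derivative g2 s) (at s)" for s
    using DERIV_mult[OF dq dv, of s] unfolding g1_def[abs_def] g2_def
    by (simp add: mult_ac add.commute)
  have dg2: "(g2 has_real_derivative g3 s) (at s)" for s
  proof -
    have d: "((\<lambda>s. 2 * g s - 1) has_real_derivative 2 * g1 s) (at s)"
      using DERIV_diff[OF DERIV_cmult[OF dg, of 2] DERIV_const, of 1 s] by simp
    have "((\<lambda>s. (2 * g s - 1) * g1 s * v s + ((g s)\<^sup>2 - g s) * v1 s) has_real_derivative ((2 * g1
        s * g1 s + g2 s * (2 * g s - 1)) * v s + v1 s * ((2 * g s - 1) * g1 s))
        + ((2 * g s - 1) * g1 s * v1 s + v2 s * ((g s)\<^sup>2 - g s))) (at s)"
      by (intro DERIV_add DERIV_mult d dg1 dv dv1 dq)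
    moreover have "((2 * g1 s * g1 s + g2 s * (2 * g s - 1)) * v s + v1 s * ((2 * g s - 1) * g1 s))
        + ((2 * g s - 1) * g1 s * v1 s + v2 s * ((g s)\<^sup>2 - g s)) = g3 s"
      unfolding g3_def by algebra
    moreover have "g2 = (\<lambda>s. (2 * g s - 1) * g1 s * v s + ((g s)\<^sup>2 - g s) * v1 s)"
      by (rule ext) (rule g2_def)
    ultimately show ?thesis by (simp only:)
  qed
  have b0: "0 \<le> b" using J b by (meson abs_ge_zero ex_in_conv order_trans)
  have A2_0: "0 \<le> A 2 s" for s unfolding A_def by (intro sum_nonneg mult_nonneg_nonneg \<pi>0) simp
  have A1_b: "\<bar>A 1 s\<bar> \<le> b" for s
  proof -
    have "\<bar>A 1 s\<bar> \<le> (\<Sum>j\<in>J. \<bar>\<pi> s j * x j ^ 1\<bar>)" unfolding A_def by (rule sum_abs)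
    also have "\<dots> \<le> (\<Sum>j\<in>J. \<pi> s j * b)"
      using b \<pi>0 by (intro sum_mono) (auto simp: abs_mult intro!: mult_left_mono)
    also have "\<dots> = b" using \<pi>1[of s] by (simp add: sum_distrib_right[symmetric])
    finally show ?thesis .
  qed
  have A3_b: "\<bar>A 3 s\<bar> \<le> b * A 2 s" for s
  proof -
    have "\<bar>A 3 s\<bar> \<le> (\<Sum>j\<in>J. \<bar>\<pi> s j * x j ^ 3\<bar>)" unfolding A_def by (rule sum_abs)
    also have "\<dots> \<le> (\<Sum>j\<in>J. b * (\<pi> s j * x j ^ 2))"
    proof (intro sum_mono)
      fix j assume j: "j \<in> J"
      have "\<bar>\<pi> s j * x j ^ 3\<bar> = \<bar>x j\<bar> * (\<pi> s j * x j ^ 2)"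
        using \<pi>0[of s j] by (simp add: abs_mult power3_eq_cube power2_eq_square)
      also have "\<dots> \<le> b * (\<pi> s j * x j ^ 2)"
        using b[OF j] \<pi>0[of s j] by (intro mult_right_mono) auto
      finally show "\<bar>\<pi> s j * x j ^ 3\<bar> \<le> b * (\<pi> s j * x j ^ 2)" .
    qed
    also have "\<dots> = b * A 2 s" by (simp add: A_def sum_distrib_left)
    finally show ?thesis .
  qed
  have A1_sq: "(A 1 s)\<^sup>2 \<le> A 2 s" for s
  proof -
    have "0 \<le> (\<Sum>j\<in>J. \<pi> s j * (x j - A 1 s)\<^sup>2)" by (intro sum_nonneg mult_nonneg_nonneg \<pi>0) simp
    also have "\<dots> = A 2 s - 2 * A 1 s * A 1 s + (A 1 s)\<^sup>2 * (\<Sum>j\<in>J. \<pi> s j)"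
      unfolding A_def[of 2] A_def[of 1] power2_diff
      by (simp add: algebra_simps sum.distrib sum_subtractf sum_distrib_left sum_distrib_right)
    finally show ?thesis using \<pi>1[of s] by (simp add: power2_eq_square)
  qed
  \<comment> \<open>The constant 12 is 3 + 3 + 6 from \<open>3 * \<bar>v\<bar> ^ 3 + 3 *
    \<bar>v\<bar> * \<bar>v1\<bar> + \<bar>v2\<bar>\<close>, the 6 being 1 + 3 + 2 from the third
    cumulant. Every \<open>1 / \<psi>\<close> beyond the first is traded for
    \<open>\<beta>\<close>.\<close>
  have g3_le: "\<bar>g3 s\<bar> \<le> 12 * \<beta>\<^sup>2 / \<psi> * b * A 2 s" for s
  proof -
    have g01: "0 \<le> g s" "g s \<le> 1" using smooth_step_bounds[of \<psi> t "u s"] by (auto simp: g_def)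
    have q: "\<bar>(g s)\<^sup>2 - g s\<bar> \<le> 1"
    proof -
      have "(g s)\<^sup>2 \<le> 1" "0 \<le> (g s)\<^sup>2" using g01 by (auto intro: power_le_one)
      then show ?thesis using g01 by linarith
    qed
    have r: "\<bar>2 * g s - 1\<bar> \<le> 1" using g01 by auto
    have h1: "\<bar>g1 s\<bar> \<le> \<bar>v s\<bar>"
      unfolding g1_def abs_mult using mult_right_mono[OF q, of "\<bar>v s\<bar>"] by simp
    have h2: "\<bar>g2 s\<bar> \<le> \<bar>v s\<bar> * \<bar>v s\<bar> + \<bar>v1 s\<bar>"
    proof -
      have "\<bar>g2 s\<bar> \<le> \<bar>2 * g s - 1\<bar> * \<bar>g1 s\<bar> * \<bar>v s\<bar> + \<bar>(g s)\<^sup>2 - g s\<bar> * \<bar>v1 s\<bar>"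
        unfolding g2_def by (rule order_trans[OF abs_triangle_ineq]) (simp add: abs_mult)
      also have "\<dots> \<le> 1 * \<bar>v s\<bar> * \<bar>v s\<bar> + 1 * \<bar>v1 s\<bar>"
        by (intro add_mono mult_mono r h1 q) auto
      finally show ?thesis by simp
    qed
    have "\<bar>g3 s\<bar> \<le> 2 * (\<bar>g1 s\<bar> * \<bar>g1 s\<bar>) * \<bar>v s\<bar> + \<bar>2 * g s - 1\<bar> * \<bar>g2 s\<bar> * \<bar>v s\<bar>
        + 2 * (\<bar>2 * g s - 1\<bar> * \<bar>g1 s\<bar> * \<bar>v1 s\<bar>) + \<bar>(g s)\<^sup>2 - g s\<bar> * \<bar>v2 s\<bar>"
      unfolding g3_def
      by (intro order_trans[OF abs_triangle_ineq] add_mono)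
         (simp_all add: abs_mult power2_eq_square)
    also have "\<dots> \<le> 2 * (\<bar>v s\<bar> * \<bar>v s\<bar>) * \<bar>v s\<bar> + 1 * (\<bar>v s\<bar> * \<bar>v s\<bar> + \<bar>v1 s\<bar>) * \<bar>v s\<bar>
        + 2 * (1 * \<bar>v s\<bar> * \<bar>v1 s\<bar>) + 1 * \<bar>v2 s\<bar>"
      by (intro add_mono mult_mono r h1 h2 q order_refl) auto
    also have "\<dots> = 3 * \<bar>v s\<bar> * (\<bar>v s\<bar> * \<bar>v s\<bar>) + 3 * \<bar>v s\<bar> * \<bar>v1 s\<bar> + \<bar>v2 s\<bar>"
      by (simp add: algebra_simps)
    also have "\<dots> \<le> 3 * (b * \<beta>) * (\<beta> * (A 2 s / \<psi>)) + 3 * (b * \<beta>) * (\<beta> * (A 2 s / \<psi>))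
        + \<beta>\<^sup>2 * (6 * (b * A 2 s)) / \<psi>"
    proof -
      have "\<bar>v s\<bar> = \<bar>A 1 s\<bar> * (1 / \<psi>)" using \<psi> by (simp add: v_def)
      also have "\<dots> \<le> b * \<beta>" using A1_b \<psi> b0 by (intro mult_mono) auto
      finally have v: "\<bar>v s\<bar> \<le> b * \<beta>" .
      have "\<bar>v s\<bar> * \<bar>v s\<bar> = (1 / \<psi>) * ((A 1 s)\<^sup>2 / \<psi>)" using \<psi> by (simp add: v_def power2_eq_square)
      also have "\<dots> \<le> \<beta> * (A 2 s / \<psi>)"
        using A1_sq \<psi> \<beta> by (intro mult_mono divide_right_mono) auto
      finally have vv: "\<bar>v s\<bar> * \<bar>v s\<bar> \<le> \<beta> * (A 2 s / \<psi>)" .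
      have "\<bar>A 2 s - (A 1 s)\<^sup>2\<bar> \<le> A 2 s" using A1_sq[of s] by auto
      then have v1: "\<bar>v1 s\<bar> \<le> \<beta> * (A 2 s / \<psi>)"
        using \<psi> \<beta> by (auto simp: v1_def abs_mult intro!: divide_right_mono mult_left_mono)
      have "\<bar>A 1 s\<bar> * A 2 s \<le> b * A 2 s" by (intro mult_right_mono A1_b A2_0)
      moreover have "\<bar>A 1 s\<bar> ^ 3 \<le> b * A 2 s"
      proof -
        have "\<bar>A 1 s\<bar> ^ 3 = \<bar>A 1 s\<bar> * (A 1 s)\<^sup>2" by (simp add: power3_eq_cube power2_eq_square)
        also have "\<dots> \<le> b * A 2 s" using b0 by (intro mult_mono A1_b A1_sq) auto
        finally show ?thesis .
      qed
      moreover have "\<bar>A 3 s - 3 * A 1 s * A 2 s + 2 * A 1 s ^ 3\<bar> \<le>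
          \<bar>A 3 s\<bar> + 3 * (\<bar>A 1 s\<bar> * A 2 s) + 2 * \<bar>A 1 s\<bar> ^ 3"
      proof -
        have "\<bar>A 1 s * A 2 s\<bar> = \<bar>A 1 s\<bar> * A 2 s" "\<bar>A 1 s ^ 3\<bar> = \<bar>A 1 s\<bar> ^ 3"
          using A2_0[of s] by (auto simp: abs_mult power_abs)
        then show ?thesis by linarith
      qed
      ultimately have "\<bar>A 3 s - 3 * A 1 s * A 2 s + 2 * A 1 s ^ 3\<bar> \<le> 6 * (b * A 2 s)"
        using A3_b[of s] by linarith
      then have v2: "\<bar>v2 s\<bar> \<le> \<beta>\<^sup>2 * (6 * (b * A 2 s)) / \<psi>"
        using \<psi> by (auto simp: v2_def abs_mult intro!: divide_right_mono mult_left_mono)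
      have "\<bar>v s\<bar> * (\<bar>v s\<bar> * \<bar>v s\<bar>) \<le> (b * \<beta>) * (\<beta> * (A 2 s / \<psi>))"
        "\<bar>v s\<bar> * \<bar>v1 s\<bar> \<le> (b * \<beta>) * (\<beta> * (A 2 s / \<psi>))"
        by (rule mult_mono[OF v vv] mult_mono[OF v v1]; use b0 \<beta> in simp)+
      then show ?thesis using v2 by linarith
    qed
    also have "\<dots> = 12 * \<beta>\<^sup>2 / \<psi> * b * A 2 s" by (simp add: power2_eq_square algebra_simps)
    finally show ?thesis .
  qed
  define S where "S = (\<Sum>j\<in>J. softmax \<beta> J w j * (x j)\<^sup>2)"
  \<comment> \<open>The average at the intermediate Taylor point is moved back to
    \<open>s = 0\<close>, where the weights no longer depend on the coordinate being
    exchanged.\<close>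
  have A2_le: "A 2 s \<le> exp (2 * \<beta> * b * \<bar>s\<bar>) * S" for s
    unfolding A_def S_def sum_distrib_left
  proof (intro sum_mono)
    fix j assume j: "j \<in> J"
    have "\<pi> s j \<le> exp (2 * \<beta> * (\<bar>s\<bar> * b)) * softmax \<beta> J w j"
      unfolding \<pi>_def using b
      by (intro softmax_stable[OF _ j]) (simp add: abs_mult mult_left_mono)
    then have "\<pi> s j * (x j)\<^sup>2 \<le> exp (2 * \<beta> * (\<bar>s\<bar> * b)) * softmax \<beta> J w j * (x j)\<^sup>2"
      by (intro mult_right_mono) auto
    then show "\<pi> s j * (x j)\<^sup>2 \<le> exp (2 * \<beta> * b * \<bar>s\<bar>) * (softmax \<beta> J w j * (x j)\<^sup>2)"
      by (simp add: mult_ac)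
  qed
  have S0: "0 \<le> S" unfolding S_def by (intro sum_nonneg mult_nonneg_nonneg softmax_nonneg) simp
  have "\<bar>g s - (g 0 + g1 0 * s + g2 0 / 2 * s\<^sup>2)\<bar>
      \<le> (2 * \<beta>\<^sup>2 / \<psi>) * b * S * (\<bar>s\<bar> ^ 3 * exp (2 * \<beta> * b * \<bar>s\<bar>))" for s
  proof -
    define diff where "diff k = (if k = 0 then g else if k = 1 then g1 else if k = 2 then g2 else
        g3)"
      for k :: nat
    have "DERIV (diff k) r :> diff (Suc k) r" if "k < 3" for k r
      using that dg dg1 dg2 by (auto simp: diff_def less_Suc_eq numeral_3_eq_3 numeral_2_eq_2)
    then obtain r where r: "\<bar>r\<bar> \<le> \<bar>s\<bar>"
        "g s = (\<Sum>k<3. diff k 0 / fact k * s ^ k) + diff 3 r / fact 3 * s ^ 3"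
      using Maclaurin_bi_le[of diff g 3 s] by (auto simp: diff_def)
    have "g s - (g 0 + g1 0 * s + g2 0 / 2 * s\<^sup>2) = g3 r / 6 * s ^ 3"
      using r(2) by (simp add: diff_def eval_nat_numeral)
    then have "\<bar>g s - (g 0 + g1 0 * s + g2 0 / 2 * s\<^sup>2)\<bar> = \<bar>g3 r\<bar> / 6 * \<bar>s\<bar> ^ 3"
      by (simp only: abs_mult abs_divide power_abs abs_numeral)
    also have "\<dots> \<le> (12 * \<beta>\<^sup>2 / \<psi> * b * (exp (2 * \<beta> * b * \<bar>s\<bar>) * S)) / 6 * \<bar>s\<bar> ^ 3"
    proof (intro mult_right_mono divide_right_mono)
      have "\<bar>g3 r\<bar> \<le> 12 * \<beta>\<^sup>2 / \<psi> * b * A 2 r" by (rule g3_le)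
      also have "\<dots> \<le> 12 * \<beta>\<^sup>2 / \<psi> * b * (exp (2 * \<beta> * b * \<bar>r\<bar>) * S)"
        using \<psi> b0 by (intro mult_left_mono A2_le) auto
      also have "\<dots> \<le> 12 * \<beta>\<^sup>2 / \<psi> * b * (exp (2 * \<beta> * b * \<bar>s\<bar>) * S)"
        using \<psi> b0 \<beta> r(1) S0 by (intro mult_left_mono mult_right_mono) (auto intro!: mult_left_mono)
      finally show "\<bar>g3 r\<bar> \<le> 12 * \<beta>\<^sup>2 / \<psi> * b * (exp (2 * \<beta> * b * \<bar>s\<bar>) * S)" .
    qed auto
    also have "\<dots> = (2 * \<beta>\<^sup>2 / \<psi>) * b * S * (\<bar>s\<bar> ^ 3 * exp (2 * \<beta> * b * \<bar>s\<bar>))"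
      by (simp add: mult_ac)
    finally show ?thesis .
  qed
  then show ?thesis
    unfolding S_def by (intro exI[of _ "g1 0"] exI[of _ "g2 0 / 2"]) (simp add: g_def u_def)
qed

end

section \<open>Lindeberg replacement\<close>

text \<open>With \<open>k\<close> elements left, the cheapest costs at most the average
  \<open>c / k\<close>, and these averages add up to a harmonic number. The costs may change after
  every exchange, because only their total at each stage is bounded.\<close>

lemma greedy_swap:
  fixes f :: "'i set \<Rightarrow> real" and e :: "'i set \<Rightarrow> 'i \<Rightarrow> real"
  assumes I: "finite I"
    and step: "\<And>S i. S \<subseteq> I \<Longrightarrow> i \<in> I - S \<Longrightarrow> \<bar>f (insert i S) - f S\<bar> \<le> e S i"
    and e0: "\<And>S i. S \<subseteq> I \<Longrightarrow> i \<in> I \<Longrightarrow> 0 \<le> e S i"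
    and tot: "\<And>S. S \<subseteq> I \<Longrightarrow> (\<Sum>i\<in>I. e S i) \<le> c"
  shows "S \<subseteq> I \<Longrightarrow> \<bar>f I - f S\<bar> \<le> c * harm (card (I - S))"
proof (induction "card (I - S)" arbitrary: S)
  case 0
  then have "S = I" using I by auto
  then show ?case by (simp add: harm_def)
next
  case (Suc k)
  have ne: "I - S \<noteq> {}" using Suc.hyps(2) by (metis card.empty Zero_not_Suc)
  have "\<exists>i\<in>I - S. e S i \<le> c / real (Suc k)"
  proof (rule ccontr)
    assume "\<not> ?thesis"
    then have "(\<Sum>i\<in>I - S. c / real (Suc k)) < (\<Sum>i\<in>I - S. e S i)"
      using I ne by (intro sum_strict_mono) (auto simp: not_le)
    also have "\<dots> \<le> (\<Sum>i\<in>I. e S i)" using I e0[OF Suc.prems] by (intro sum_mono2) auto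
    also have "\<dots> \<le> c" by (rule tot[OF Suc.prems])
    finally show False by (simp add: Suc.hyps(2)[symmetric])
  qed
  then obtain i where i: "i \<in> I - S" "e S i \<le> c / real (Suc k)" by auto
  have D: "I - insert i S = (I - S) - {i}" by auto
  have k: "k = card (I - insert i S)" unfolding D using i(1) Suc.hyps(2) I by (simp add:
      card_Diff_singleton)
  have "\<bar>f I - f (insert i S)\<bar> \<le> c * harm (card (I - insert i S))"
    using i Suc.prems by (intro Suc.hyps(1)[OF k]) auto
  moreover have "\<bar>f (insert i S) - f S\<bar> \<le> c / real (Suc k)"
    using step[OF Suc.prems i(1)] i(2) by simp
  ultimately have "\<bar>f I - f S\<bar> \<le> c * harm k + c / real (Suc k)" using k by simp
  also have "\<dots> = c * harm (card (I - S))"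
    unfolding Suc.hyps(2)[symmetric] harm_Suc by (simp add: algebra_simps divide_inverse)
  finally show ?case .
qed

definition subexp_standard :: "real \<Rightarrow> real measure \<Rightarrow> bool" where
  "subexp_standard r P \<longleftrightarrow> real_distribution P \<and> integrable P (\<lambda>x. exp (r * \<bar>x\<bar>)) \<and>
     (LINT x|P. x) = 0 \<and> (LINT x|P. x\<^sup>2) = 1"

text \<open>The exponential weight comes from the Taylor remainder, where it accounts for the
  instability of the softmax weights.\<close>

definition tilted_moment3 :: "real \<Rightarrow> real measure \<Rightarrow> real" where
  "tilted_moment3 r P = (LINT x|P. \<bar>x\<bar> ^ 3 * exp (r * \<bar>x\<bar>))"

lemma power_le_fact_exp:
  fixes y :: real
  assumes "0 \<le> y"
  shows "y ^ k \<le> fact k * exp y"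
proof -
  have "(\<Sum>n\<in>{k}. y ^ n /\<^sub>R fact n) \<le> exp y"
    unfolding exp_def using assms by (intro sum_le_suminf summable_exp_generic) auto
  then show ?thesis by (simp add: field_simps)
qed

lemma power_mult_exp_le:
  fixes r s x :: real
  assumes "s < r"
  shows "\<bar>x\<bar> ^ k * exp (s * \<bar>x\<bar>) \<le> \<bar>fact k / (r - s) ^ k\<bar> * exp (r * \<bar>x\<bar>)"
proof -
  let ?q = "r - s"
  have q: "0 < ?q" using assms by simp
  have "(?q * \<bar>x\<bar>) ^ k \<le> fact k * exp (?q * \<bar>x\<bar>)"
    using q by (intro power_le_fact_exp) auto
  then have "\<bar>x\<bar> ^ k \<le> fact k * exp (?q * \<bar>x\<bar>) / ?q ^ k"
    unfolding power_mult_distrib using q by (subst pos_le_divide_eq) (auto simp: mult.commute)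
  then have "\<bar>x\<bar> ^ k * exp (s * \<bar>x\<bar>) \<le> fact k / ?q ^ k * exp (?q * \<bar>x\<bar>) * exp (s * \<bar>x\<bar>)"
    by (intro mult_right_mono) auto
  also have "\<dots> = fact k / ?q ^ k * exp (r * \<bar>x\<bar>)"
    by (simp add: mult.assoc mult_exp_exp algebra_simps)
  also have "fact k / ?q ^ k = \<bar>fact k / ?q ^ k\<bar>" using q by simp
  finally show ?thesis .
qed

context
  fixes r :: real and P :: "real measure"
  assumes r: "0 < r" and P: "subexp_standard r P"
begin

interpretation real_distribution P using P by (simp add: subexp_standard_def)

lemma subexp_integrable_tilted:
  assumes "s < r"
  shows "integrable P (\<lambda>x. \<bar>x\<bar> ^ k * exp (s * \<bar>x\<bar>))"
proof (rule Bochner_Integration.integrable_bound)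
  let ?q = "r - s"
  show "integrable P (\<lambda>x. (fact k / ?q ^ k) * exp (r * \<bar>x\<bar>))"
    using P by (simp add: subexp_standard_def)
  show "AE x in P. norm (\<bar>x\<bar> ^ k * exp (s * \<bar>x\<bar>)) \<le> norm ((fact k / ?q ^ k) * exp (r * \<bar>x\<bar>))"
    using power_mult_exp_le[OF assms] by (intro AE_I2) (simp add: abs_mult)
qed simp

lemma subexp_integrable_abs_power: "integrable P (\<lambda>x. \<bar>x\<bar> ^ k)"
  using subexp_integrable_tilted[of 0 k] r by simp

lemma subexp_integrable: "integrable P (\<lambda>x. x)" "integrable P (\<lambda>x. x\<^sup>2)"
  using subexp_integrable_abs_power[of 1] subexp_integrable_abs_power[of 2]
  by (simp_all add: integrable_abs_iff)

lemma subexp_abs_le: "(LINT x|P. \<bar>x\<bar>) \<le> 1"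
proof -
  have "(LINT x|P. \<bar>x\<bar>) \<le> (LINT x|P. (1 + x\<^sup>2) / 2)"
  proof (rule integral_mono)
    fix x :: real
    have "0 \<le> (\<bar>x\<bar> - 1)\<^sup>2" by simp
    then show "\<bar>x\<bar> \<le> (1 + x\<^sup>2) / 2" by (simp add: power2_diff)
  qed (use subexp_integrable in auto)
  also have "\<dots> = 1" using subexp_integrable P by (simp add: subexp_standard_def
      prob_space[unfolded space_eq_univ])
  finally show ?thesis .
qed

end

lemma tilted_moment3_nonneg: "0 \<le> tilted_moment3 r P"
  unfolding tilted_moment3_def by (intro integral_nonneg_AE) simp

context
  fixes \<beta> \<psi> b r :: real and J :: "'j set"
  assumes J: "finite J" "J \<noteq> {}" and \<beta>: "0 < \<beta>" and \<psi>: "0 < \<psi>" "1 / \<psi> \<le> \<beta>"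
    and r: "0 < r" and \<beta>b: "2 * \<beta> * b \<le> r / 2" "2 * \<beta> * b \<le> 1 / 2"
begin

text \<open>The quadratic Taylor polynomial has the same integral \<open>c0 + c2\<close> under every
  law with mean 0 and variance 1, so only the two remainders are left. Bounding
  \<open>2 * \<beta> * b\<close> by \<open>r / 2\<close> keeps their exponential factor at half the
  available rate, which leaves room to integrate the cube.\<close>

lemma swap_coordinate:
  assumes P: "subexp_standard r P" and Q: "subexp_standard r Q"
    and b: "\<And>j. j \<in> J \<Longrightarrow> \<bar>x j\<bar> \<le> b"
  shows "\<bar>(LINT s|P. smooth_step \<psi> t (smooth_max \<beta> J (\<lambda>j. w j + s * x j)))
      - (LINT s|Q. smooth_step \<psi> t (smooth_max \<beta> J (\<lambda>j. w j + s * x j)))\<bar>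
    \<le> (2 * \<beta>\<^sup>2 / \<psi>) * b * (\<Sum>j\<in>J. softmax \<beta> J w j * (x j)\<^sup>2)
      * (tilted_moment3 (r / 2) P + tilted_moment3 (r / 2) Q)"
proof -
  define g where "g s = smooth_step \<psi> t (smooth_max \<beta> J (\<lambda>j. w j + s * x j))" for s
  define C where "C = (2 * \<beta>\<^sup>2 / \<psi>) * b * (\<Sum>j\<in>J. softmax \<beta> J w j * (x j)\<^sup>2)"
  have "\<exists>c1 c2. \<forall>s. \<bar>g s - (smooth_step \<psi> t (smooth_max \<beta> J w) + c1 * s + c2 * s\<^sup>2)\<bar>
      \<le> C * (\<bar>s\<bar> ^ 3 * exp (2 * \<beta> * b * \<bar>s\<bar>))"
    unfolding g_def C_def by (rule smooth_max_taylor[OF J \<beta> \<psi> b])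
  then obtain c0 c1 c2 where c: "\<bar>g s - (c0 + c1 * s + c2 * s\<^sup>2)\<bar>
      \<le> C * (\<bar>s\<bar> ^ 3 * exp (2 * \<beta> * b * \<bar>s\<bar>))" for s by blast
  have b0: "0 \<le> b" using J b by (meson abs_ge_zero ex_in_conv order_trans)
  have C0: "0 \<le> C" unfolding C_def using b0 \<psi>
    by (intro mult_nonneg_nonneg sum_nonneg softmax_nonneg[OF J \<beta>]) auto
  have c': "\<bar>g s - (c0 + c1 * s + c2 * s\<^sup>2)\<bar> \<le> C * (\<bar>s\<bar> ^ 3 * exp (r / 2 * \<bar>s\<bar>))" for s
  proof -
    have "2 * \<beta> * b * \<bar>s\<bar> \<le> r / 2 * \<bar>s\<bar>" using \<beta>b(1) by (intro mult_right_mono) auto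
    then show ?thesis
      by (intro order_trans[OF c] mult_left_mono[OF _ C0] mult_left_mono) auto
  qed
  have g_meas: "g \<in> borel_measurable borel"
    unfolding g_def smooth_step_def smooth_max_def by measurable
  have key: "\<bar>(LINT s|P. g s) - (c0 + c2)\<bar> \<le> C * tilted_moment3 (r / 2) P"
    if P: "subexp_standard r P" for P
  proof -
    interpret P: real_distribution P using P by (simp add: subexp_standard_def)
    have g_int: "integrable P g"
      using smooth_step_bounds[of \<psi> t] g_meas
      by (intro P.integrable_const_bound[where B = 1]) (auto simp: g_def less_imp_le)
    note i = subexp_integrable[OF r P]
    have *: "(LINT s|P. g s - (c0 + c1 * s + c2 * s\<^sup>2)) = (LINT s|P. g s) - (c0 + c2)"
      using g_int i P by (simp add: P.prob_space[unfolded P.space_eq_univ] subexp_standard_def)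
    have "\<bar>LINT s|P. g s - (c0 + c1 * s + c2 * s\<^sup>2)\<bar>
        \<le> (LINT s|P. \<bar>g s - (c0 + c1 * s + c2 * s\<^sup>2)\<bar>)"
      by (rule integral_abs_bound)
    also have "\<dots> \<le> (LINT s|P. C * (\<bar>s\<bar> ^ 3 * exp (r / 2 * \<bar>s\<bar>)))"
      using g_int i subexp_integrable_tilted[OF r P, of "r / 2" 3] r
      by (intro integral_mono c') (auto simp del: power_abs)
    also have "\<dots> = C * tilted_moment3 (r / 2) P" by (simp add: tilted_moment3_def)
    finally show ?thesis unfolding * .
  qed
  show ?thesis
    using key[OF P] key[OF Q] unfolding g_def[symmetric] C_def[symmetric] distrib_left by linarith
qed

lemma softmax_le_1: "j \<in> J \<Longrightarrow> softmax \<beta> J w j \<le> 1"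
  using member_le_sum[of j J "softmax \<beta> J w"] J softmax_nonneg[OF J \<beta>] sum_softmax[OF J \<beta>, of w]
  by auto

lemma integrable_softmax:
  assumes "finite_measure N" and [measurable]: "\<And>k. (\<lambda>s. w s k) \<in> borel_measurable N" and "j \<in> J"
  shows "integrable N (\<lambda>s. softmax \<beta> J (w s) j)"
proof (rule finite_measure.integrable_const_bound[OF assms(1), where B = 1])
  show "AE s in N. norm (softmax \<beta> J (w s) j) \<le> 1"
    using softmax_nonneg[OF J \<beta>] softmax_le_1[OF assms(3)] by (intro AE_I2) simp
qed (simp add: softmax_def)

text \<open>The exchange error involves weights from which the exchanged coordinate is missing; it
  is restored here, so that the errors of different coordinates become integrals over one common
  law. The weight loses at most the factor \<open>1 - 2 * \<beta> * b * \<bar>s\<bar>\<close>, whose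
  mean is at least 1/2 because \<open>\<bar>s\<bar>\<close> has mean at most 1.\<close>

lemma softmax_le_integral:
  assumes P: "subexp_standard r P" and b: "\<And>j. j \<in> J \<Longrightarrow> \<bar>x j\<bar> \<le> b" and j: "j \<in> J"
  shows "softmax \<beta> J w j \<le> 2 * (LINT s|P. softmax \<beta> J (\<lambda>j. w j + s * x j) j)"
proof -
  interpret P: real_distribution P using P by (simp add: subexp_standard_def)
  let ?\<pi> = "\<lambda>s. softmax \<beta> J (\<lambda>j. w j + s * x j) j"
  have b0: "0 \<le> b" using J b by (meson abs_ge_zero ex_in_conv order_trans)
  have \<pi>0: "0 \<le> softmax \<beta> J w' j" for w' by (rule softmax_nonneg[OF J \<beta>])
  have ge: "softmax \<beta> J w j * (1 - 2 * \<beta> * b * \<bar>s\<bar>) \<le> ?\<pi> s" for s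
  proof -
    have "softmax \<beta> J w j \<le> exp (2 * \<beta> * (\<bar>s\<bar> * b)) * ?\<pi> s"
      using b by (intro softmax_stable[OF J \<beta> _ j]) (simp add: abs_mult mult_left_mono)
    then have "exp (- (2 * \<beta> * (\<bar>s\<bar> * b))) * softmax \<beta> J w j \<le> ?\<pi> s"
      by (simp add: exp_minus field_simps)
    moreover have "1 - 2 * \<beta> * b * \<bar>s\<bar> \<le> exp (- (2 * \<beta> * (\<bar>s\<bar> * b)))"
      using exp_ge_add_one_self[of "- (2 * \<beta> * (\<bar>s\<bar> * b))"] by (simp add: mult_ac)
    ultimately show ?thesis
      using mult_right_mono[OF _ \<pi>0, of _ _ w] by (subst mult.commute) (rule order_trans)
  qed
  have abs_int: "integrable P (\<lambda>s. \<bar>s\<bar>)" using subexp_integrable[OF r P] by simp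
  have \<pi>_int: "integrable P ?\<pi>"
    by (intro integrable_softmax P.finite_measure_axioms j) simp
  have "2 * \<beta> * b * (LINT s|P. \<bar>s\<bar>) \<le> 1 / 2 * 1"
    using b0 \<beta> \<beta>b subexp_abs_le[OF r P] by (intro mult_mono) auto
  then have "softmax \<beta> J w j * (1 / 2) \<le> softmax \<beta> J w j * (1 - 2 * \<beta> * b * (LINT s|P. \<bar>s\<bar>))"
    using \<pi>0 by (intro mult_left_mono) auto
  also have "\<dots> = (LINT s|P. softmax \<beta> J w j * (1 - 2 * \<beta> * b * \<bar>s\<bar>))"
    using abs_int by (simp add: P.prob_space[unfolded P.space_eq_univ])
  also have "\<dots> \<le> (LINT s|P. ?\<pi> s)"
    using abs_int \<pi>_int by (intro integral_mono ge) auto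
  finally show ?thesis by simp
qed

text \<open>
  In a fixed order the errors could only be bounded by the sum of \<open>max\<^sub>j (a i j)\<^sup>2\<close> over \<open>i\<close>,
  which may be as large as \<open>card I * b\<^sup>2\<close>. Always exchanging the coordinate with the least error
  bound makes the error of each step at most an average over the remaining coordinates, so only
  the column sums of squares enter, at the price of a harmonic number.
\<close>

lemma lindeberg_smooth_max:
  fixes a :: "'i \<Rightarrow> 'j \<Rightarrow> real"
  assumes P: "subexp_standard r P" and Q: "subexp_standard r Q" and I: "finite I"
    and unit: "\<And>j. j \<in> J \<Longrightarrow> (\<Sum>i\<in>I. (a i j)\<^sup>2) = 1"
    and b: "\<And>i j. i \<in> I \<Longrightarrow> j \<in> J \<Longrightarrow> \<bar>a i j\<bar> \<le> b"
  shows "\<bar>(LINT v|PiM I (\<lambda>_. P). smooth_step \<psi> t (smooth_max \<beta> J (\<lambda>j. \<Sum>i\<in>I. a i j * v i)))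
      - (LINT v|PiM I (\<lambda>_. Q). smooth_step \<psi> t (smooth_max \<beta> J (\<lambda>j. \<Sum>i\<in>I. a i j * v i)))\<bar>
    \<le> (4 * \<beta>\<^sup>2 / \<psi>) * b * (tilted_moment3 (r / 2) P + tilted_moment3 (r / 2) Q) * harm (card I)"
proof -
  interpret P': real_distribution P using P by (simp add: subexp_standard_def)
  interpret Q': real_distribution Q using Q by (simp add: subexp_standard_def)
  \<comment> \<open>Hybrid law: the coordinates in \<open>S\<close> already follow \<open>P\<close>,
    the others still follow \<open>Q\<close>.\<close>
  define M where "M S i = (if i \<in> S then P else Q)" for S and i :: 'i
  have M: "subexp_standard r (M S i)" for S i using P Q by (simp add: M_def)
  have M_prob: "prob_space (M S i)" for S i
    unfolding M_def using P'.prob_space_axioms Q'.prob_space_axioms by simp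
  have [simp]: "sets (M S i) = sets borel" for S i by (simp add: M_def)
  have PM: "prob_space (PiM I' (M S))" for S I' by (intro prob_space_PiM M_prob)
  have sets_PM [measurable_cong]: "sets (PiM I' (M S)) = sets (PiM I' (\<lambda>_. borel))" for S I'
    by (intro sets_PiM_cong) auto
  define W where "W I' v j = (\<Sum>i\<in>I'. a i j * v i)" for I' and v :: "'i \<Rightarrow> real" and j
  define F where "F w = smooth_step \<psi> t (smooth_max \<beta> J w)" for w
  define E where "E i w = (\<Sum>j\<in>J. softmax \<beta> J w j * (a i j)\<^sup>2)" for i w
  define D where "D = (2 * \<beta>\<^sup>2 / \<psi>) * b * (tilted_moment3 (r / 2) P + tilted_moment3 (r / 2) Q)"
  define f where "f S = (LINT v|PiM I (M S). F (W I v))" for S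
  \<comment> \<open>The price of exchanging \<open>i\<close> under the current hybrid law; the
    factor 2 is the loss in \<open>softmax_le_integral\<close>.\<close>
  define e where "e S i = 2 * D * (LINT v|PiM I (M S). E i (W I v))" for S i
  have F_meas: "(\<lambda>v. F (W I' v)) \<in> borel_measurable (PiM I' (\<lambda>_. borel))" for I'
    unfolding F_def W_def smooth_step_def smooth_max_def by measurable
  have E_meas: "(\<lambda>v. E i (W I' v)) \<in> borel_measurable (PiM I' (\<lambda>_. borel))" for I' i
    unfolding E_def W_def softmax_def by measurable
  have F_bd: "\<bar>F w\<bar> \<le> 1" for w
    using smooth_step_bounds[of \<psi> t "smooth_max \<beta> J w"] by (simp add: F_def)
  have E0: "0 \<le> E i w" for i w
    unfolding E_def by (intro sum_nonneg mult_nonneg_nonneg softmax_nonneg[OF J \<beta>]) auto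
  have E_bd: "E i w \<le> b\<^sup>2" if "i \<in> I" for i w
  proof -
    have "E i w \<le> (\<Sum>j\<in>J. softmax \<beta> J w j * b\<^sup>2)"
      unfolding E_def using power_mono[OF b[OF that] abs_ge_zero, of _ 2] softmax_nonneg[OF J \<beta>]
      by (intro sum_mono mult_left_mono) auto
    then show ?thesis by (simp add: sum_distrib_right[symmetric] sum_softmax[OF J \<beta>])
  qed
  have F_int: "integrable (PiM I (M S)) (\<lambda>v. F (W I v))" for S
  proof -
    interpret prob_space "PiM I (M S)" by (rule PM)
    show ?thesis using F_bd F_meas[of I]
      by (intro integrable_const_bound[where B = 1]) (auto simp: measurable_cong_sets[OF sets_PM
          refl])
  qed
  have E_int: "integrable (PiM I (M S)) (\<lambda>v. E i (W I v))" if "i \<in> I" for S i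
  proof -
    interpret prob_space "PiM I (M S)" by (rule PM)
    show ?thesis using E_bd[OF that] E0 E_meas[of i I]
      by (intro integrable_const_bound[where B = "b\<^sup>2"]) (auto simp: measurable_cong_sets[OF
          sets_PM refl])
  qed
  have D0: "0 \<le> D" if "I \<noteq> {}"
  proof -
    have "0 \<le> b" using J b that by (meson abs_ge_zero ex_in_conv order_trans)
    then show ?thesis unfolding D_def using \<psi> tilted_moment3_nonneg
      by (intro mult_nonneg_nonneg add_nonneg_nonneg) auto
  qed
  have "\<bar>f I - f {}\<bar> \<le> 2 * D * harm (card (I - {}))"
  proof (rule greedy_swap[where e = e, OF I])
    fix S i assume S: "S \<subseteq> I" and i: "i \<in> I - S"
    let ?I = "I - {i}"
    have II: "I = insert i ?I" "finite ?I" "i \<notin> ?I" using i I by auto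
    have W_upd: "W I (v(i := s)) = (\<lambda>j. W ?I v j + s * a i j)" for v s
    proof
      fix j
      have "W I (v(i := s)) j = a i j * s + (\<Sum>k\<in>?I. a k j * (v(i := s)) k)"
        unfolding W_def using i I by (subst sum.remove[of I i]) auto
      also have "(\<Sum>k\<in>?I. a k j * (v(i := s)) k) = W ?I v j"
        unfolding W_def by (intro sum.cong) auto
      finally show "W I (v(i := s)) j = W ?I v j + s * a i j" by (simp only: mult.commute
          add.commute)
    qed
    have fubini: "integral\<^sup>L (PiM I (M S')) (\<lambda>v. h (W I v)) =
        (LINT v|PiM ?I (M S'). (LINT s|M S' i. h (\<lambda>j. W ?I v j + s * a i j)))"
      if "integrable (PiM I (M S')) (\<lambda>v. h (W I v))" for S' and h :: "('j \<Rightarrow> real) \<Rightarrow> real"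
    proof -
      interpret product_prob_space "M S'" by (intro product_prob_spaceI M_prob)
      show ?thesis
        using product_integral_insert[OF II(2,3), of "\<lambda>v. h (W I v)"] that II(1) W_upd by simp
    qed
    let ?N = "PiM ?I (M S)"
    interpret N: prob_space ?N by (rule PM)
    \<comment> \<open>Away from coordinate \<open>i\<close> the two hybrid laws coincide, so by
      Fubini only the inner integrals over \<open>i\<close> have to be compared.\<close>
    have N': "PiM ?I (M (insert i S)) = ?N"
      by (intro PiM_cong) (auto simp: M_def)
    have inner_bd: "\<bar>LINT s|M S' i. F (\<lambda>j. W ?I v j + s * a i j)\<bar> \<le> 1" for S' v
    proof -
      interpret prob_space "M S' i" by (rule M_prob)
      have "\<bar>LINT s|M S' i. F (\<lambda>j. W ?I v j + s * a i j)\<bar> \<le> (LINT s|M S' i. \<bar>F (\<lambda>j. W ?I v j + s *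
          a i j)\<bar>)"
        by (rule integral_abs_bound)
      also have "\<dots> \<le> (LINT s|M S' i. 1)"
        by (rule integral_mono_AE') (use F_bd in auto)
      finally show ?thesis by (simp add: prob_space)
    qed
    have W_meas2: "(\<lambda>x. W ?I (fst x) j + snd x * a i j) \<in> borel_measurable (?N \<Otimes>\<^sub>M M S' i)" for S' j
    proof -
      have [measurable_cong]: "sets (M S' i) = sets borel" by simp
      show ?thesis unfolding W_def by measurable
    qed
    have inner_int: "integrable ?N (\<lambda>v. LINT s|M S' i. F (\<lambda>j. W ?I v j + s * a i j))" for S'
    proof -
      interpret Mi: prob_space "M S' i" by (rule M_prob)
      note W_meas2[measurable]
      have "(\<lambda>v. LINT s|M S' i. F (\<lambda>j. W ?I v j + s * a i j)) \<in> borel_measurable ?N"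
        unfolding F_def smooth_step_def smooth_max_def
        by (rule Mi.borel_measurable_lebesgue_integral) (use W_meas2[of _ S'] in \<open>simp add:
            case_prod_beta\<close>)
      then show ?thesis using inner_bd by (intro N.integrable_const_bound[where B = 1]) auto
    qed
    have E_inner_int: "integrable ?N (\<lambda>v. LINT s|M S i. E i (\<lambda>j. W ?I v j + s * a i j))"
    proof -
      interpret Mi: prob_space "M S i" by (rule M_prob)
      have bd: "\<bar>LINT s|M S i. E i (\<lambda>j. W ?I v j + s * a i j)\<bar> \<le> b\<^sup>2" for v
      proof -
        have "\<bar>LINT s|M S i. E i (\<lambda>j. W ?I v j + s * a i j)\<bar> \<le> (LINT s|M S i. \<bar>E i (\<lambda>j. W ?I v j +
            s * a i j)\<bar>)"
          by (rule integral_abs_bound)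
        also have "\<dots> \<le> (LINT s|M S i. b\<^sup>2)"
          by (rule integral_mono_AE') (use E_bd E0 i in auto)
        finally show ?thesis by (simp add: Mi.prob_space)
      qed
      note W_meas2[measurable]
      have "(\<lambda>v. LINT s|M S i. E i (\<lambda>j. W ?I v j + s * a i j)) \<in> borel_measurable ?N"
        unfolding E_def softmax_def
        by (rule Mi.borel_measurable_lebesgue_integral) (use W_meas2[of _ S] in \<open>simp add:
            case_prod_beta\<close>)
      then show ?thesis using bd by (intro N.integrable_const_bound[where B = "b\<^sup>2"]) auto
    qed
    have bi: "\<bar>a i j\<bar> \<le> b" if "j \<in> J" for j using b that i by auto
    have pt: "\<bar>(LINT s|M (insert i S) i. F (\<lambda>j. W ?I v j + s * a i j)) - (LINT s|M S i. F (\<lambda>j. W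
        ?I v j + s * a i j))\<bar>
        \<le> 2 * D * (LINT s|M S i. E i (\<lambda>j. W ?I v j + s * a i j))" for v
    proof -
      interpret Mi: prob_space "M S i" by (rule M_prob)
      have swap: "\<bar>(LINT s|M (insert i S) i. F (\<lambda>j. W ?I v j + s * a i j)) - (LINT s|M S i. F (\<lambda>j.
          W ?I v j + s * a i j))\<bar>
          \<le> D * E i (W ?I v)"
        using swap_coordinate[OF P Q bi, where t = t and w = "W ?I v"] i by (simp add: M_def F_def
            D_def E_def mult_ac)
      have "E i (W ?I v) \<le> (\<Sum>j\<in>J. 2 * (LINT s|M S i. softmax \<beta> J (\<lambda>j. W ?I v j + s * a i j) j) *
          (a i j)\<^sup>2)"
        unfolding E_def by (intro sum_mono mult_right_mono softmax_le_integral[OF M bi]) auto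
      also have "\<dots> = 2 * (LINT s|M S i. E i (\<lambda>j. W ?I v j + s * a i j))"
      proof -
        have "integrable (M S i) (\<lambda>s. softmax \<beta> J (\<lambda>j. W ?I v j + s * a i j) j)" if "j \<in> J" for j
          using that by (intro integrable_softmax Mi.finite_measure_axioms) (simp_all add:
              measurable_cong_sets[of "M S i" borel])
        then show ?thesis
          unfolding E_def by (subst Bochner_Integration.integral_sum) (auto simp: sum_distrib_left
              mult_ac)
      qed
      finally have "D * E i (W ?I v) \<le> D * (2 * (LINT s|M S i. E i (\<lambda>j. W ?I v j + s * a i j)))"
        using D0 i by (intro mult_left_mono) auto
      with swap show ?thesis by (simp only: mult_ac)
    qed
    have "\<bar>f (insert i S) - f S\<bar> = \<bar>LINT v|?N. ((LINT s|M (insert i S) i. F (\<lambda>j. W ?I v j + s * a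
        i j))
        - (LINT s|M S i. F (\<lambda>j. W ?I v j + s * a i j)))\<bar>"
      unfolding f_def fubini[OF F_int] N'
      by (subst Bochner_Integration.integral_diff) (use inner_int in auto)
    also have "\<dots> \<le> (LINT v|?N. \<bar>(LINT s|M (insert i S) i. F (\<lambda>j. W ?I v j + s * a i j))
        - (LINT s|M S i. F (\<lambda>j. W ?I v j + s * a i j))\<bar>)"
      by (rule integral_abs_bound)
    also have "\<dots> \<le> (LINT v|?N. 2 * D * (LINT s|M S i. E i (\<lambda>j. W ?I v j + s * a i j)))"
      using inner_int E_inner_int by (intro integral_mono pt) auto
    also have "\<dots> = e S i"
      unfolding e_def using fubini[OF E_int] i by simp
    finally show "\<bar>f (insert i S) - f S\<bar> \<le> e S i" .
  next
    fix S i assume "i \<in> I"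
    then show "0 \<le> e S i" unfolding e_def using D0
      by (intro mult_nonneg_nonneg integral_nonneg_AE) (auto simp: E0)
  next
    fix S
    interpret prob_space "PiM I (M S)" by (rule PM)
    \<comment> \<open>Summing over the rows brings the column sums of squares inside the softmax
      average. The total is 1 at every point, hence under every hybrid law.\<close>
    have one: "(\<Sum>i\<in>I. E i w) = 1" for w
    proof -
      have "(\<Sum>i\<in>I. E i w) = (\<Sum>j\<in>J. softmax \<beta> J w j * (\<Sum>i\<in>I. (a i j)\<^sup>2))"
        unfolding E_def by (subst sum.swap) (simp add: sum_distrib_left)
      also have "\<dots> = 1" using unit sum_softmax[OF J \<beta>] by simp
      finally show ?thesis .
    qed
    have "(\<Sum>i\<in>I. e S i) = 2 * D * (LINT v|PiM I (M S). (\<Sum>i\<in>I. E i (W I v)))"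
      unfolding e_def using E_int by (subst Bochner_Integration.integral_sum) (auto simp:
          sum_distrib_left)
    also have "\<dots> = 2 * D" by (simp add: one prob_space)
    finally show "(\<Sum>i\<in>I. e S i) \<le> 2 * D" by simp
  qed simp
  moreover have "f I = (LINT v|PiM I (\<lambda>_. P). F (W I v))"
    unfolding f_def by (intro arg_cong2[where f = "integral\<^sup>L"] PiM_cong refl) (simp add: M_def)
  moreover have "f {} = (LINT v|PiM I (\<lambda>_. Q). F (W I v))"
    unfolding f_def M_def by simp
  moreover have "2 * D * harm (card I) =
      (4 * \<beta>\<^sup>2 / \<psi>) * b * (tilted_moment3 (r / 2) P + tilted_moment3 (r / 2) Q) * harm (card I)"
    by (simp add: D_def)
  ultimately show ?thesis unfolding F_def W_def[abs_def] by simp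
qed

end

section \<open>Comparison of maxima\<close>

definition max_cdf :: "real measure \<Rightarrow> 'i set \<Rightarrow> 'j set \<Rightarrow> ('i \<Rightarrow> 'j \<Rightarrow> real) \<Rightarrow> real \<Rightarrow> real" where
  "max_cdf P I J a t = measure (PiM I (\<lambda>_. P))
     {v \<in> space (PiM I (\<lambda>_. P)). \<forall>j\<in>J. (\<Sum>i\<in>I. a i j * v i) \<le> t}"

lemma measurable_max_event:
  assumes "finite J" and [measurable_cong]: "sets P = sets borel"
  shows "{v \<in> space (PiM I (\<lambda>_. P)). \<forall>j\<in>J. (\<Sum>i\<in>I. a i j * v i) \<le> (t::real)} \<in> sets (PiM I (\<lambda>_. P))"
proof -
  note assms(1)[simp]
  show ?thesis by measurable
qed

lemma max_cdf_mono:
  assumes "finite J" "real_distribution P" "s \<le> t"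
  shows "max_cdf P I J a s \<le> max_cdf P I J a t"
proof -
  interpret real_distribution P by fact
  interpret PI: prob_space "PiM I (\<lambda>_. P)" by (intro prob_space_PiM) unfold_locales
  show ?thesis unfolding max_cdf_def
    using assms(3) by (intro PI.finite_measure_mono measurable_max_event assms) (auto intro:
        order_trans)
qed

lemma smooth_step_ge: "0 < \<psi> \<Longrightarrow> z \<le> t - L * \<psi> \<Longrightarrow> 1 - exp (- L) \<le> smooth_step \<psi> t z"
proof -
  assume \<psi>: "0 < \<psi>" and z: "z \<le> t - L * \<psi>"
  define E where "E = exp ((z - t) / \<psi>)"
  have E: "0 < E" "E \<le> exp (- L)" using \<psi> z by (auto simp: E_def field_simps)
  have "(1 - E) * (1 + E) \<le> 1" by (simp add: algebra_simps)
  then have "1 - E \<le> 1 / (1 + E)" using E by (simp add: pos_le_divide_eq)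
  then show ?thesis using E(2) unfolding smooth_step_def E_def[symmetric] by linarith
qed

lemma smooth_step_le: "0 < \<psi> \<Longrightarrow> t + L * \<psi> \<le> z \<Longrightarrow> smooth_step \<psi> t z \<le> exp (- L)"
proof -
  assume \<psi>: "0 < \<psi>" and z: "t + L * \<psi> \<le> z"
  have "exp L \<le> exp ((z - t) / \<psi>)" using \<psi> z by (auto simp: field_simps)
  then have "exp L \<le> 1 + exp ((z - t) / \<psi>)" by (rule add_increasing[OF zero_le_one])
  then have "1 / (1 + exp ((z - t) / \<psi>)) \<le> 1 / exp L" by (intro divide_left_mono) (auto simp:
      add_pos_pos)
  then show ?thesis by (simp add: smooth_step_def exp_minus inverse_eq_divide)
qed

text \<open>The log-sum-exp exceeds the maximum by at most \<open>ln (card J) / \<beta>\<close>, and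
  the logistic step differs from an indicator by at most \<open>exp (- L)\<close> outside a window
  of half-width \<open>L * \<psi>\<close>. The one-sided form suffices, since \<open>P\<close> and
  \<open>Q\<close> may be interchanged.\<close>

lemma max_cdf_compare:
  fixes a :: "'i \<Rightarrow> 'j \<Rightarrow> real"
  assumes J: "finite J" "J \<noteq> {}" and \<beta>: "0 < \<beta>" and \<psi>: "0 < \<psi>" "1 / \<psi> \<le> \<beta>"
    and r: "0 < r" and \<beta>b: "2 * \<beta> * b \<le> r / 2" "2 * \<beta> * b \<le> 1 / 2"
    and P: "subexp_standard r P" and Q: "subexp_standard r Q" and I: "finite I"
    and unit: "\<And>j. j \<in> J \<Longrightarrow> (\<Sum>i\<in>I. (a i j)\<^sup>2) = 1"
    and b: "\<And>i j. i \<in> I \<Longrightarrow> j \<in> J \<Longrightarrow> \<bar>a i j\<bar> \<le> b"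
  shows "max_cdf P I J a t \<le> max_cdf Q I J a (t + (ln (card J) / \<beta> + 2 * L * \<psi>)) + 2 * exp (- L)
    + (4 * \<beta>\<^sup>2 / \<psi>) * b * (tilted_moment3 (r / 2) P + tilted_moment3 (r / 2) Q) * harm (card I)"
proof -
  interpret P': real_distribution P using P by (simp add: subexp_standard_def)
  interpret Q': real_distribution Q using Q by (simp add: subexp_standard_def)
  interpret PI: prob_space "PiM I (\<lambda>_. P)" by (intro prob_space_PiM) unfold_locales
  interpret QI: prob_space "PiM I (\<lambda>_. Q)" by (intro prob_space_PiM) unfold_locales
  \<comment> \<open>The centre of the step: a maximum of at most \<open>t\<close> puts the
    log-sum-exp at least \<open>L * \<psi>\<close> below \<open>t0\<close>, and a maximum beyond the
    enlarged threshold puts it at least \<open>L * \<psi>\<close> above.\<close>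
  define t0 where "t0 = t + ln (card J) / \<beta> + L * \<psi>"
  define F where "F v = smooth_step \<psi> t0 (smooth_max \<beta> J (\<lambda>j. \<Sum>i\<in>I. a i j * v i))" for v
  define A where "A = {v \<in> space (PiM I (\<lambda>_. P)). \<forall>j\<in>J. (\<Sum>i\<in>I. a i j * v i) \<le> t}"
  define B where "B = {v \<in> space (PiM I (\<lambda>_. Q)). \<forall>j\<in>J. (\<Sum>i\<in>I. a i j * v i) \<le> t + (ln (card J) / \<beta>
      + 2 * L * \<psi>)}"
  have A: "A \<in> sets (PiM I (\<lambda>_. P))" unfolding A_def by (intro measurable_max_event J) simp
  have B: "B \<in> sets (PiM I (\<lambda>_. Q))" unfolding B_def by (intro measurable_max_event J) simp
  have mA: "max_cdf P I J a t = measure (PiM I (\<lambda>_. P)) A"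
    and mB: "max_cdf Q I J a (t + (ln (card J) / \<beta> + 2 * L * \<psi>)) = measure (PiM I (\<lambda>_. Q)) B"
    by (simp_all only: max_cdf_def A_def B_def)
  have iA: "integrable (PiM I (\<lambda>_. P)) (indicator A :: _ \<Rightarrow> real)"
    and iB: "integrable (PiM I (\<lambda>_. Q)) (indicator B :: _ \<Rightarrow> real)"
    using A B by (auto intro!: integrable_real_indicator simp: less_top[symmetric])
  have F_bd: "\<bar>F v\<bar> \<le> 1" "0 \<le> F v" for v
    using smooth_step_bounds[of \<psi> t0] by (auto simp: F_def less_imp_le)
  have F_meas: "F \<in> borel_measurable (PiM I (\<lambda>_. borel))"
    unfolding F_def smooth_step_def smooth_max_def by measurable
  have sP: "sets (PiM I (\<lambda>_. P)) = sets (PiM I (\<lambda>_. borel))" and sQ: "sets (PiM I (\<lambda>_. Q)) = sets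
      (PiM I (\<lambda>_. borel))"
    by (intro sets_PiM_cong; simp)+
  have "F \<in> borel_measurable (PiM I (\<lambda>_. P))" "F \<in> borel_measurable (PiM I (\<lambda>_. Q))"
    using F_meas unfolding measurable_cong_sets[OF sP refl] measurable_cong_sets[OF sQ refl] by
        this+
  then have F_int: "integrable (PiM I (\<lambda>_. P)) F" "integrable (PiM I (\<lambda>_. Q)) F"
    using F_bd by (auto intro!: PI.integrable_const_bound[where B = 1]
        QI.integrable_const_bound[where B = 1])
  have F_lower: "indicator A v - exp (- L) \<le> F v" for v
  proof (cases "v \<in> A")
    case True
    then have "smooth_max \<beta> J (\<lambda>j. \<Sum>i\<in>I. a i j * v i) \<le> t + ln (card J) / \<beta>"
      by (intro smooth_max_le J \<beta>) (auto simp: A_def)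
    then have "1 - exp (- L) \<le> F v" unfolding F_def t0_def by (intro smooth_step_ge \<psi>) simp
    then show ?thesis using True by simp
  next
    case False
    then have "indicator A v - exp (- L) = - exp (- L)" by simp
    then show ?thesis using F_bd(2)[of v] exp_gt_zero[of "- L"] by linarith
  qed
  have F_upper: "F v \<le> indicator B v + exp (- L)" if v: "v \<in> space (PiM I (\<lambda>_. Q))" for v
  proof (cases "v \<in> B")
    case False
    then obtain j where j: "j \<in> J" "t + (ln (card J) / \<beta> + 2 * L * \<psi>) < (\<Sum>i\<in>I. a i j * v i)"
      using v by (auto simp: B_def not_le)
    have "t0 + L * \<psi> \<le> smooth_max \<beta> J (\<lambda>j. \<Sum>i\<in>I. a i j * v i)"
      using smooth_max_ge[OF J \<beta> j(1), of "\<lambda>j. \<Sum>i\<in>I. a i j * v i"] j(2) by (simp add: t0_def)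
    then have "F v \<le> exp (- L)" unfolding F_def by (intro smooth_step_le \<psi>)
    then show ?thesis using False by simp
  next
    case True
    then have "indicator B v = (1::real)" by simp
    then show ?thesis using F_bd(1)[of v] exp_gt_zero[of "- L"] by linarith
  qed
  have "max_cdf P I J a t - exp (- L) = (LINT v|PiM I (\<lambda>_. P). indicator A v - exp (- L))"
    using A iA by (subst Bochner_Integration.integral_diff) (auto simp: PI.prob_space mA)
  also have "\<dots> \<le> (LINT v|PiM I (\<lambda>_. P). F v)"
    using iA F_int by (intro integral_mono F_lower) auto
  finally have 1: "max_cdf P I J a t - exp (- L) \<le> (LINT v|PiM I (\<lambda>_. P). F v)" .
  have "(LINT v|PiM I (\<lambda>_. Q). F v) \<le> (LINT v|PiM I (\<lambda>_. Q). indicator B v + exp (- L))"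
    using iB F_int by (intro integral_mono F_upper) auto
  also have "\<dots> = max_cdf Q I J a (t + (ln (card J) / \<beta> + 2 * L * \<psi>)) + exp (- L)"
    using B iB by (subst Bochner_Integration.integral_add) (auto simp: QI.prob_space mB)
  finally have 2: "(LINT v|PiM I (\<lambda>_. Q). F v) \<le>
      max_cdf Q I J a (t + (ln (card J) / \<beta> + 2 * L * \<psi>)) + exp (- L)" .
  have 3: "\<bar>(LINT v|PiM I (\<lambda>_. P). F v) - (LINT v|PiM I (\<lambda>_. Q). F v)\<bar>
    \<le> (4 * \<beta>\<^sup>2 / \<psi>) * b * (tilted_moment3 (r / 2) P + tilted_moment3 (r / 2) Q) * harm (card I)"
    unfolding F_def by (rule lindeberg_smooth_max[OF J \<beta> \<psi> r \<beta>b P Q I unit b])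
  from 1 2 3 show ?thesis by linarith
qed

text \<open>The shift formula yields the moment generating function without integration: the tilted
  density is that of a translated Gaussian and has total mass 1.\<close>

lemma std_normal_subexp: "subexp_standard r std_normal_distribution"
proof -
  interpret real_distribution std_normal_distribution by (rule real_dist_normal_dist)
  have exp_int: "integrable std_normal_distribution (\<lambda>z. exp (c * z))" for c
  proof (rule integrableI_nonneg)
    have "(\<integral>\<^sup>+z. ennreal (exp (c * z)) \<partial>std_normal_distribution) =
        (\<integral>\<^sup>+z. ennreal (exp (c\<^sup>2 / 2)) * ennreal (exp (c * z - c\<^sup>2 / 2)) \<partial>std_normal_distribution)"
      by (intro nn_integral_cong) (simp add: ennreal_mult[symmetric] mult_exp_exp)
    also have "\<dots> = ennreal (exp (c\<^sup>2 / 2)) *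
        emeasure (density std_normal_distribution (\<lambda>z. ennreal (exp (c * z - c\<^sup>2 / 2)))) UNIV"
      by (subst nn_integral_cmult) (auto simp: emeasure_density)
    also have "\<dots> = ennreal (exp (c\<^sup>2 / 2))"
      unfolding std_normal_shift[symmetric] using emeasure_space_1 by (subst emeasure_distr) auto
    finally show "(\<integral>\<^sup>+z. ennreal (exp (c * z)) \<partial>std_normal_distribution) < \<infinity>" by simp
  qed auto
  have "integrable std_normal_distribution (\<lambda>x. exp (r * \<bar>x\<bar>))"
  proof (rule Bochner_Integration.integrable_bound[OF Bochner_Integration.integrable_add[OF
      exp_int[of r] exp_int[of "- r"]]])
    have "exp (r * \<bar>x\<bar>) \<le> exp (r * x) + exp (- r * x)" for x :: real
      by (cases "0 \<le> x") auto
    then show "AE x in std_normal_distribution. norm (exp (r * \<bar>x\<bar>)) \<le> norm (exp (r * x) + exp (-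
        r * x))"
      by (intro AE_I2) (metis abs_exp_cancel abs_ge_self order_trans real_norm_def)
  qed simp
  moreover have "(LINT x|std_normal_distribution. x) = 0"
    using integral_std_normal_distribution_moment_odd[of 1] by simp
  moreover have "(LINT x|std_normal_distribution. x\<^sup>2) = 1"
    using std_normal_distribution_even_moments(1)[of 1] by (simp add: fact_numeral)
  ultimately show ?thesis
    by (simp add: subexp_standard_def real_dist_normal_dist)
qed

section \<open>Tail and modulus of continuity of Gaussian maxima\<close>

lemma gaussian_max_tail:
  assumes I: "finite I" and J: "finite J"
    and unit: "\<And>j. j \<in> J \<Longrightarrow> (\<Sum>i\<in>I. (a i j)\<^sup>2) = 1" and s: "0 \<le> s"
  shows "1 - real (card J) * exp (- s\<^sup>2 / 2) \<le> max_cdf std_normal_distribution I J a s"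
proof -
  interpret G: prob_space "std_gaussian I" by (rule prob_space_std_gaussian)
  define A where "A = {v \<in> space (std_gaussian I). \<forall>j\<in>J. (\<Sum>i\<in>I. a i j * v i) \<le> s}"
  define C where "C j = {v \<in> space (std_gaussian I). s < (\<Sum>i\<in>I. a i j * v i)}" for j
  have A: "A \<in> G.events" unfolding A_def by (intro measurable_max_event J) simp
  have C: "C j \<in> G.events" for j unfolding C_def by measurable
  have "1 - G.prob A = G.prob (space (std_gaussian I) - A)" by (rule G.prob_compl[OF A, symmetric])
  also have "\<dots> \<le> G.prob (\<Union>j\<in>J. C j)"
    using J C by (intro G.finite_measure_mono sets.finite_UN) (auto simp: A_def C_def not_le)
  also have "\<dots> \<le> (\<Sum>j\<in>J. G.prob (C j))" using J C by (intro measure_UNION_le) auto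
  also have "\<dots> \<le> (\<Sum>j\<in>J. exp (- s\<^sup>2 / 2))"
    unfolding C_def by (intro sum_mono std_gaussian_tail I unit s)
  finally show ?thesis by (simp add: max_cdf_def A_def)
qed

text \<open>Anti-concentration is available only below the level \<open>y\<close>. Beyond it
  \<open>x\<close> exceeds \<open>y - 1\<close>, because \<open>\<delta> \<le> 1\<close>, and the
  union bound shows that the distribution function is already close to 1. Thus the estimate becomes
  uniform in \<open>x\<close>.\<close>

lemma gaussian_max_continuity:
  fixes a :: "'i \<Rightarrow> 'j::linorder \<Rightarrow> real"
  assumes I: "finite I" and J: "finite J"
    and unit: "\<And>j. j \<in> J \<Longrightarrow> (\<Sum>i\<in>I. (a i j)\<^sup>2) = 1"
    and \<delta>: "0 < \<delta>" "\<delta> \<le> 1" and y: "1 \<le> y"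
  shows "max_cdf std_normal_distribution I J a (x + \<delta>) \<le> max_cdf std_normal_distribution I J a x
    + (exp (3 / 2) * \<delta> * y + real (card J) * exp (- (y - 1)\<^sup>2 / 2))"
proof (cases "x + \<delta> \<le> y")
  case True
  have "0 \<le> real (card J) * exp (- (y - 1)\<^sup>2 / 2)" by simp
  then show ?thesis
    using gaussian_max_anticoncentration[where x = x and a = a, OF I J unit \<delta>(1) y True]
    unfolding max_cdf_def by linarith
next
  case False
  interpret G: prob_space "std_gaussian I" by (rule prob_space_std_gaussian)
  have "max_cdf std_normal_distribution I J a (x + \<delta>) \<le> 1" unfolding max_cdf_def by (rule
      G.prob_le_1)
  moreover have "max_cdf std_normal_distribution I J a (y - 1) \<le> max_cdf std_normal_distribution I
      J a x"
    using False \<delta> by (intro max_cdf_mono J real_dist_normal_dist) simp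
  moreover have "1 - real (card J) * exp (- (y - 1)\<^sup>2 / 2) \<le> max_cdf std_normal_distribution I J a
      (y - 1)"
    using y by (intro gaussian_max_tail I J unit) auto
  moreover have "0 \<le> exp (3 / 2) * \<delta> * y" using \<delta> y by simp
  ultimately show ?thesis by linarith
qed

section \<open>Exponential families\<close>

text \<open>Dominated convergence for the difference quotients. The weight \<open>f\<close> makes
  one lemma serve two derivatives: 1 gives the mean of \<open>T\<close>, and \<open>T\<close> itself
  the second moment.\<close>

lemma DERIV_exponential_integral:
  fixes T f :: "'a \<Rightarrow> real"
  assumes [measurable]: "T \<in> borel_measurable N" "f \<in> borel_measurable N"
    and r: "0 < r" and int: "integrable N (\<lambda>y. f y * exp (r * \<bar>T y\<bar>))"
  shows "((\<lambda>h. LINT y|N. f y * exp (h * T y)) has_real_derivative (LINT y|N. f y * T y)) (at 0)"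
proof -
  let ?S = "{- (r / 2)<..<r / 2}"
  have int_h: "integrable N (\<lambda>y. f y * exp (h * T y))" if h: "\<bar>h\<bar> \<le> r" for h
  proof (rule Bochner_Integration.integrable_bound[OF int])
    have "h * T y \<le> r * \<bar>T y\<bar>" for y
    proof -
      have "h * T y \<le> \<bar>h\<bar> * \<bar>T y\<bar>" using abs_ge_self[of "h * T y"] by (simp add: abs_mult)
      also have "\<dots> \<le> r * \<bar>T y\<bar>" using h by (intro mult_right_mono) auto
      finally show ?thesis .
    qed
    then show "AE y in N. norm (f y * exp (h * T y)) \<le> norm (f y * exp (r * \<bar>T y\<bar>))"
      by (intro AE_I2) (simp add: abs_mult mult_left_mono)
  qed simp
  \<comment> \<open>Restricting \<open>h\<close> to half the rate bounds the exponential by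
    \<open>exp (r / 2 * \<bar>T y\<bar>)\<close>; the other half of the rate absorbs the factor
    \<open>\<bar>T y\<bar>\<close> of the difference quotient.\<close>
  have dom: "\<bar>f y * (exp (h * T y) - 1) / h\<bar> \<le> 2 / r * \<bar>f y * exp (r * \<bar>T y\<bar>)\<bar>"
    if h: "h \<in> ?S" "h \<noteq> 0" for h y
  proof -
    have mvt: "\<bar>exp x - 1\<bar> \<le> \<bar>x\<bar> * exp \<bar>x\<bar>" for x :: real
    proof -
      have "1 - \<bar>x\<bar> \<le> exp (- \<bar>x\<bar>)" using exp_ge_add_one_self[of "- \<bar>x\<bar>"] by simp
      then have "exp \<bar>x\<bar> * (1 - \<bar>x\<bar>) \<le> exp \<bar>x\<bar> * exp (- \<bar>x\<bar>)" by (intro mult_left_mono) auto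
      then have "exp \<bar>x\<bar> - 1 \<le> \<bar>x\<bar> * exp \<bar>x\<bar>" by (simp add: algebra_simps exp_minus_inverse)
      moreover have "\<bar>exp x - 1\<bar> \<le> exp \<bar>x\<bar> - 1"
      proof (cases "0 \<le> x")
        case False
        have "2 \<le> exp x + exp (- x)"
        proof -
          have "0 \<le> (1 - exp x)\<^sup>2 * exp (- x)" by simp
          also have "\<dots> = exp (- x) - 2 + exp x"
            by (simp add: power2_eq_square algebra_simps mult_exp_exp)
          finally show ?thesis by simp
        qed
        then show ?thesis using False by simp
      qed simp
      ultimately show ?thesis by simp
    qed
    have a: "\<bar>h\<bar> * \<bar>T y\<bar> \<le> r / 2 * \<bar>T y\<bar>" using h by (intro mult_right_mono) auto
    have "r / 2 * \<bar>T y\<bar> \<le> exp (r / 2 * \<bar>T y\<bar>)"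
      using exp_ge_add_one_self[of "r / 2 * \<bar>T y\<bar>"] by linarith
    then have b: "\<bar>T y\<bar> \<le> 2 / r * exp (r / 2 * \<bar>T y\<bar>)" using r by (simp add: field_simps)
    have "\<bar>exp (h * T y) - 1\<bar> \<le> \<bar>h\<bar> * \<bar>T y\<bar> * exp (\<bar>h\<bar> * \<bar>T y\<bar>)"
      using mvt[of "h * T y"] by (simp add: abs_mult)
    also have "\<dots> \<le> \<bar>h\<bar> * (2 / r * exp (r / 2 * \<bar>T y\<bar>)) * exp (r / 2 * \<bar>T y\<bar>)"
      using a b r by (intro mult_mono mult_left_mono) auto
    also have "\<dots> = \<bar>h\<bar> * (2 / r * exp (r * \<bar>T y\<bar>))"
      by (simp add: mult.assoc mult_exp_exp)
    finally have "\<bar>exp (h * T y) - 1\<bar> / \<bar>h\<bar> \<le> 2 / r * exp (r * \<bar>T y\<bar>)"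
      using h by (simp add: pos_divide_le_eq mult.commute)
    then have "\<bar>f y\<bar> * (\<bar>exp (h * T y) - 1\<bar> / \<bar>h\<bar>) \<le> \<bar>f y\<bar> * (2 / r * exp (r * \<bar>T y\<bar>))"
      by (intro mult_left_mono) auto
    then show ?thesis by (simp add: abs_mult mult_ac)
  qed
  have "((\<lambda>h. LINT y|N. f y * (exp (h * T y) - 1) / h) \<longlongrightarrow> (LINT y|N. f y * T y)) (at 0 within ?S)"
    unfolding tendsto_at_iff_sequentially comp_def
  proof (intro allI impI)
    fix h :: "nat \<Rightarrow> real"
    assume h: "\<forall>i. h i \<in> ?S - {0}" "h \<longlonglongrightarrow> 0"
    show "(\<lambda>n. LINT y|N. f y * (exp (h n * T y) - 1) / h n) \<longlonglongrightarrow> (LINT y|N. f y * T y)"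
    proof (rule integral_dominated_convergence)
      show "integrable N (\<lambda>y. 2 / r * \<bar>f y * exp (r * \<bar>T y\<bar>)\<bar>)" using int by simp
      show "AE y in N. (\<lambda>n. f y * (exp (h n * T y) - 1) / h n) \<longlonglongrightarrow> f y * T y"
      proof (intro AE_I2)
        fix y
        have "((\<lambda>x. exp (x * T y)) has_real_derivative T y) (at 0)"
          by (auto intro!: derivative_eq_intros)
        then have "((\<lambda>x. (exp (x * T y) - 1) / x) \<longlongrightarrow> T y) (at 0)"
          by (simp add: has_field_derivative_iff)
        then have "(\<lambda>n. (exp (h n * T y) - 1) / h n) \<longlonglongrightarrow> T y"
          using h unfolding tendsto_at_iff_sequentially comp_def by blast
        from tendsto_mult_left[OF this, of "f y"]
        show "(\<lambda>n. f y * (exp (h n * T y) - 1) / h n) \<longlonglongrightarrow> f y * T y" by simp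
      qed
      show "AE y in N. norm (f y * (exp (h n * T y) - 1) / h n) \<le> 2 / r * \<bar>f y * exp (r * \<bar>T y\<bar>)\<bar>"
          for n
        using h(1) dom[of "h n"] by (intro AE_I2) auto
    qed auto
  qed
  then have lim: "((\<lambda>h. LINT y|N. f y * (exp (h * T y) - 1) / h) \<longlongrightarrow> (LINT y|N. f y * T y)) (at 0)"
    using r by (subst (asm) at_within_open) auto
  have "\<forall>\<^sub>F h in at 0. (LINT y|N. f y * (exp (h * T y) - 1) / h) =
      ((LINT y|N. f y * exp (h * T y)) - (LINT y|N. f y)) / h"
  proof -
    have "\<forall>\<^sub>F h in at 0. h \<in> ?S" using r by (intro eventually_at_in_open') auto
    then show ?thesis
    proof eventually_elim
      case (elim h)
      have "(LINT y|N. f y * (exp (h * T y) - 1)) = (LINT y|N. f y * exp (h * T y)) - (LINT y|N. f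
          y)"
        using elim int_h[of h] int_h[of 0] r
        by (subst Bochner_Integration.integral_diff[symmetric]) (auto simp: algebra_simps)
      then show ?case by simp
    qed
  qed
  from Lim_transform_eventually[OF lim this]
  show ?thesis by (simp add: has_field_derivative_iff)
qed

locale smooth_exponential_family =
  fixes \<mu> :: "'y measure" and T b :: "'y \<Rightarrow> real" and d :: "real \<Rightarrow> real" and \<Theta> :: "real set"
  assumes family: "exponential_family \<mu> T d b \<Theta>" and d_C3: "C3_on \<Theta> d"
begin

lemma expfam_measurable [measurable]: "T \<in> borel_measurable \<mu>" "b \<in> borel_measurable \<mu>"
  using family by (auto simp: exponential_family_def)

lemma expfam_open: "open \<Theta>"
  using family by (simp add: exponential_family_def)

lemma expfam_prob: "\<theta> \<in> \<Theta> \<Longrightarrow> prob_space (expfam_law \<mu> T d b \<theta>)"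
  using family by (simp add: exponential_family_def)

lemma sets_expfam_law [measurable_cong]: "sets (expfam_law \<mu> T d b \<theta>) = sets \<mu>"
  by (simp add: expfam_law_def)

lemma expfam_density_measurable [measurable]:
  "(\<lambda>y. exp (expfam_log_density T d b \<theta> y)) \<in> borel_measurable \<mu>"
  unfolding expfam_log_density_def by measurable

lemma integrable_expfam_law:
  assumes [measurable]: "F \<in> borel_measurable \<mu>"
  shows "integrable (expfam_law \<mu> T d b \<theta>) F \<longleftrightarrow>
    integrable \<mu> (\<lambda>y. exp (expfam_log_density T d b \<theta> y) * F y)"
  unfolding expfam_law_def by (subst integrable_density) auto

lemma integral_expfam_law:
  fixes F :: "'y \<Rightarrow> real"
  assumes [measurable]: "F \<in> borel_measurable \<mu>"
  shows "(LINT y|expfam_law \<mu> T d b \<theta>. F y) = (LINT y|\<mu>. exp (expfam_log_density T d b \<theta> y) * F y)"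
  unfolding expfam_law_def by (subst integral_density) auto

text \<open>A change of parameter is an exponential change of measure. Integrals under nearby
  members therefore become moment generating functions under \<open>\<theta>\<close>, with
  \<open>d\<close> as their logarithm up to a constant.\<close>

lemma expfam_density_tilt:
  "exp (expfam_log_density T d b (\<theta> + h) y) * x =
   exp (d \<theta> - d (\<theta> + h)) * (exp (expfam_log_density T d b \<theta> y) * (x * exp (h * T y)))"
proof -
  have "expfam_log_density T d b (\<theta> + h) y =
      d \<theta> - d (\<theta> + h) + (expfam_log_density T d b \<theta> y + h * T y)"
    by (simp add: expfam_log_density_def algebra_simps)
  then show ?thesis by (simp add: exp_add mult_ac)
qed

lemma integrable_expfam_tilt:
  fixes F :: "'y \<Rightarrow> real"
  assumes [measurable]: "F \<in> borel_measurable \<mu>"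
  shows "integrable (expfam_law \<mu> T d b (\<theta> + h)) F \<longleftrightarrow>
    integrable (expfam_law \<mu> T d b \<theta>) (\<lambda>y. F y * exp (h * T y))"
  by (simp add: integrable_expfam_law expfam_density_tilt)

lemma integral_expfam_tilt:
  fixes F :: "'y \<Rightarrow> real"
  assumes [measurable]: "F \<in> borel_measurable \<mu>"
  shows "(LINT y|expfam_law \<mu> T d b (\<theta> + h). F y) * exp (d (\<theta> + h) - d \<theta>) =
    (LINT y|expfam_law \<mu> T d b \<theta>. F y * exp (h * T y))"
  by (simp add: integral_expfam_law expfam_density_tilt mult_exp_exp)

text \<open>Since \<open>\<Theta>\<close> is open, it contains \<open>\<theta> - e\<close> and
  \<open>\<theta> + e\<close> for some positive \<open>e\<close>. That these two members have finite
  mass gives both one-sided exponential moments under \<open>\<theta>\<close>.\<close>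

lemma expfam_exponential_moment:
  assumes "\<theta> \<in> \<Theta>"
  obtains r where "0 < r" "integrable (expfam_law \<mu> T d b \<theta>) (\<lambda>y. exp (r * \<bar>T y\<bar>))"
    "\<And>h. \<bar>h\<bar> \<le> r \<Longrightarrow> \<theta> + h \<in> \<Theta>"
proof -
  obtain e where e: "0 < e" "cball \<theta> e \<subseteq> \<Theta>"
    using expfam_open assms open_contains_cball by blast
  have \<Theta>: "\<theta> + h \<in> \<Theta>" if "\<bar>h\<bar> \<le> e" for h
    using e(2) that by (auto simp: dist_real_def)
  have int: "integrable (expfam_law \<mu> T d b \<theta>) (\<lambda>y. exp (h * T y))" if "\<bar>h\<bar> \<le> e" for h
  proof -
    interpret prob_space "expfam_law \<mu> T d b (\<theta> + h)" by (rule expfam_prob[OF \<Theta>[OF that]])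
    have "integrable (expfam_law \<mu> T d b (\<theta> + h)) (\<lambda>_. 1 :: real)" by simp
    then show ?thesis by (subst (asm) integrable_expfam_tilt) auto
  qed
  have "integrable (expfam_law \<mu> T d b \<theta>) (\<lambda>y. exp (e * \<bar>T y\<bar>))"
  proof (rule Bochner_Integration.integrable_bound)
    show "integrable (expfam_law \<mu> T d b \<theta>) (\<lambda>y. exp (e * T y) + exp (- e * T y))"
      using e by (intro Bochner_Integration.integrable_add int) auto
    have le: "exp (e * \<bar>t\<bar>) \<le> exp (e * t) + exp (- e * t)" for t
      by (cases "0 \<le> t") auto
    show "AE y in expfam_law \<mu> T d b \<theta>. norm (exp (e * \<bar>T y\<bar>)) \<le> norm (exp (e * T y) + exp (- e *
        T y))"
      by (intro AE_I2) (metis le abs_exp_cancel abs_ge_self order_trans real_norm_def)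
  qed simp
  then show thesis using that e(1) \<Theta> by blast
qed

lemma expfam_deriv:
  assumes "\<theta> \<in> \<Theta>"
  shows "(d has_real_derivative deriv d \<theta>) (at \<theta>)"
    "(deriv d has_real_derivative deriv (deriv d) \<theta>) (at \<theta>)"
    "(deriv (deriv d) has_real_derivative deriv (deriv (deriv d)) \<theta>) (at \<theta>)"
proof -
  have "(deriv ^^ k) d differentiable (at \<theta>)" if "k < 3" for k
    using d_C3 assms that by (simp add: C3_on_def)
  from this[of 0] this[of 1] this[of 2] show "(d has_real_derivative deriv d \<theta>) (at \<theta>)"
    "(deriv d has_real_derivative deriv (deriv d) \<theta>) (at \<theta>)"
    "(deriv (deriv d) has_real_derivative deriv (deriv (deriv d)) \<theta>) (at \<theta>)"
    by (auto simp: eval_nat_numeral real_differentiable_def DERIV_deriv_iff_real_differentiable)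
qed

text \<open>The identity between the mean of \<open>exp (h * T)\<close> and
  \<open>exp (d (\<theta> + h) - d \<theta>)\<close> is differentiated at 0 on both sides, once
  under the integral and once by the chain rule; uniqueness of derivatives gives the mean. The
  second moment arises likewise from the identity for \<open>T * exp (h * T)\<close>.\<close>

lemma expfam_moments:
  assumes \<theta>: "\<theta> \<in> \<Theta>"
  shows "integrable (expfam_law \<mu> T d b \<theta>) T" "integrable (expfam_law \<mu> T d b \<theta>) (\<lambda>y. (T y)\<^sup>2)"
    "(LINT y|expfam_law \<mu> T d b \<theta>. T y) = deriv d \<theta>"
    "(LINT y|expfam_law \<mu> T d b \<theta>. (T y)\<^sup>2) = deriv (deriv d) \<theta> + (deriv d \<theta>)\<^sup>2"
proof -
  have int: "integrable (expfam_law \<mu> T d b \<theta>) (\<lambda>y. T y ^ k * exp (s * \<bar>T y\<bar>))"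
    if r: "integrable (expfam_law \<mu> T d b \<theta>) (\<lambda>y. exp (r * \<bar>T y\<bar>))" and s: "s < r" for k r s \<theta>
  proof (rule Bochner_Integration.integrable_bound)
    let ?q = "r - s"
    show "integrable (expfam_law \<mu> T d b \<theta>) (\<lambda>y. fact k / ?q ^ k * exp (r * \<bar>T y\<bar>))" using r by simp
    show "AE y in expfam_law \<mu> T d b \<theta>. norm (T y ^ k * exp (s * \<bar>T y\<bar>)) \<le> norm (fact k / ?q ^ k *
        exp (r * \<bar>T y\<bar>))"
      using power_mult_exp_le[OF s] by (intro AE_I2) (simp add: abs_mult power_abs)
  qed simp
  \<comment> \<open>All parameters are covered, because the second differentiation uses the mean at
    every \<open>\<theta> + h\<close>.\<close>
  have mean: "(LINT y|expfam_law \<mu> T d b \<theta>. T y) = deriv d \<theta>" if \<theta>: "\<theta> \<in> \<Theta>" for \<theta>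
  proof -
    let ?P = "expfam_law \<mu> T d b \<theta>"
    obtain r where r: "0 < r" "integrable ?P (\<lambda>y. exp (r * \<bar>T y\<bar>))" "\<And>h. \<bar>h\<bar> \<le> r \<Longrightarrow> \<theta> + h \<in> \<Theta>"
      using expfam_exponential_moment[OF \<theta>] by blast
    have "((\<lambda>h. LINT y|?P. 1 * exp (h * T y)) has_real_derivative (LINT y|?P. 1 * T y)) (at 0)"
      using r by (intro DERIV_exponential_integral) auto
    moreover have "((\<lambda>h. LINT y|?P. 1 * exp (h * T y)) has_real_derivative deriv d \<theta>) (at 0)"
    proof (rule has_field_derivative_transform_within_open)
      have "(d has_real_derivative deriv d \<theta>) (at (\<theta> + 0))" using expfam_deriv[OF \<theta>] by simp
      from DERIV_shift[THEN iffD1, of d "deriv d \<theta>" 0 \<theta>] this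
      have "((\<lambda>h. d (\<theta> + h)) has_real_derivative deriv d \<theta>) (at 0)" by (simp add: add.commute)
      then show "((\<lambda>h. exp (d (\<theta> + h) - d \<theta>)) has_real_derivative deriv d \<theta>) (at 0)"
        by (auto intro!: derivative_eq_intros)
      show "open {- r<..<r}" "0 \<in> {- r<..<r}" using r by auto
      fix h assume "h \<in> {- r<..<r}"
      then interpret prob_space "expfam_law \<mu> T d b (\<theta> + h)" by (intro expfam_prob r) auto
      show "exp (d (\<theta> + h) - d \<theta>) = (LINT y|?P. 1 * exp (h * T y))"
        using integral_expfam_tilt[of "\<lambda>_. 1" \<theta> h] prob_space by simp
    qed
    ultimately show ?thesis using DERIV_unique by fastforce
  qed
  let ?P = "expfam_law \<mu> T d b \<theta>"
  obtain r where r: "0 < r" "integrable ?P (\<lambda>y. exp (r * \<bar>T y\<bar>))" "\<And>h. \<bar>h\<bar> \<le> r \<Longrightarrow> \<theta> + h \<in> \<Theta>"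
    using expfam_exponential_moment[OF \<theta>] by blast
  show "integrable ?P T" "integrable ?P (\<lambda>y. (T y)\<^sup>2)"
    using int[OF r(2), of 0 1] int[OF r(2), of 0 2] r(1) by auto
  show "(LINT y|?P. T y) = deriv d \<theta>" by (rule mean[OF \<theta>])
  have "((\<lambda>h. LINT y|?P. T y * exp (h * T y)) has_real_derivative (LINT y|?P. T y * T y)) (at 0)"
    using r int[OF r(2), of "r / 2" 1] by (intro DERIV_exponential_integral[where r = "r / 2"]) auto
  moreover have "((\<lambda>h. LINT y|?P. T y * exp (h * T y)) has_real_derivative
      deriv (deriv d) \<theta> + (deriv d \<theta>)\<^sup>2) (at 0)"
  proof (rule has_field_derivative_transform_within_open)
    have "(d has_real_derivative deriv d \<theta>) (at (\<theta> + 0))"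
      "(deriv d has_real_derivative deriv (deriv d) \<theta>) (at (\<theta> + 0))" using expfam_deriv[OF \<theta>] by
          simp_all
    with DERIV_shift[THEN iffD1, of d "deriv d \<theta>" 0 \<theta>]
      DERIV_shift[THEN iffD1, of "deriv d" "deriv (deriv d) \<theta>" 0 \<theta>]
    have "((\<lambda>h. d (\<theta> + h)) has_real_derivative deriv d \<theta>) (at 0)"
      "((\<lambda>h. deriv d (\<theta> + h)) has_real_derivative deriv (deriv d) \<theta>) (at 0)"
      by (simp_all add: add.commute)
    then show "((\<lambda>h. deriv d (\<theta> + h) * exp (d (\<theta> + h) - d \<theta>)) has_real_derivative
        deriv (deriv d) \<theta> + (deriv d \<theta>)\<^sup>2) (at 0)"
      by (auto intro!: derivative_eq_intros simp: power2_eq_square)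
    show "open {- r<..<r}" "0 \<in> {- r<..<r}" using r by auto
    fix h assume "h \<in> {- r<..<r}"
    then have "\<theta> + h \<in> \<Theta>" by (intro r) auto
    then show "deriv d (\<theta> + h) * exp (d (\<theta> + h) - d \<theta>) = (LINT y|?P. T y * exp (h * T y))"
      using integral_expfam_tilt[of T \<theta> h] mean by simp
  qed
  ultimately have "(LINT y|?P. T y * T y) = deriv (deriv d) \<theta> + (deriv d \<theta>)\<^sup>2" by (rule
      DERIV_unique)
  then show "(LINT y|?P. (T y)\<^sup>2) = deriv (deriv d) \<theta> + (deriv d \<theta>)\<^sup>2" by (simp add:
      power2_eq_square)
qed

lemma expfam_variance:
  assumes \<theta>: "\<theta> \<in> \<Theta>"
  shows "(LINT y|expfam_law \<mu> T d b \<theta>. (T y - deriv d \<theta>)\<^sup>2) = deriv (deriv d) \<theta>"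
    "integrable (expfam_law \<mu> T d b \<theta>) (\<lambda>y. (T y - deriv d \<theta>)\<^sup>2)"
proof -
  interpret prob_space "expfam_law \<mu> T d b \<theta>" by (rule expfam_prob[OF \<theta>])
  note m = expfam_moments[OF \<theta>]
  show "(LINT y|expfam_law \<mu> T d b \<theta>. (T y - deriv d \<theta>)\<^sup>2) = deriv (deriv d) \<theta>"
    "integrable (expfam_law \<mu> T d b \<theta>) (\<lambda>y. (T y - deriv d \<theta>)\<^sup>2)"
    using m by (simp_all add: power2_diff prob_space power2_eq_square algebra_simps)
qed

lemma expfam_deriv2_nonneg: "\<theta> \<in> \<Theta> \<Longrightarrow> 0 \<le> deriv (deriv d) \<theta>"
  by (subst expfam_variance(1)[symmetric]) (auto intro: integral_nonneg_AE)

text \<open>The null sets of all members of the family agree, so \<open>T\<close> is degenerate either under all of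
  them or under none.\<close>

lemma expfam_degenerate:
  assumes \<theta>: "\<theta> \<in> \<Theta>" "deriv (deriv d) \<theta> = 0" and \<theta>': "\<theta>' \<in> \<Theta>"
  shows "deriv (deriv d) \<theta>' = 0"
proof -
  have AE_\<mu>: "(AE y in expfam_law \<mu> T d b \<theta>. Q y) \<longleftrightarrow> (AE y in \<mu>. Q y)" for Q \<theta>
    unfolding expfam_law_def by (subst AE_density) auto
  have "AE y in expfam_law \<mu> T d b \<theta>. (T y - deriv d \<theta>)\<^sup>2 = 0"
    using integral_nonneg_eq_0_iff_AE[OF expfam_variance(2)[OF \<theta>(1)]] expfam_variance(1)[OF \<theta>(1)]
        \<theta>(2)
    by simp
  then have AE: "AE y in expfam_law \<mu> T d b \<theta>'. T y = deriv d \<theta>"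
    unfolding AE_\<mu> by simp
  interpret prob_space "expfam_law \<mu> T d b \<theta>'" by (rule expfam_prob[OF \<theta>'])
  have "(LINT y|expfam_law \<mu> T d b \<theta>'. T y) = (LINT y|expfam_law \<mu> T d b \<theta>'. deriv d \<theta>)"
    using AE by (intro integral_cong_AE) auto
  then have m: "deriv d \<theta>' = deriv d \<theta>" using expfam_moments[OF \<theta>'] by (simp add: prob_space)
  have "(LINT y|expfam_law \<mu> T d b \<theta>'. (T y - deriv d \<theta>')\<^sup>2) = (LINT y|expfam_law \<mu> T d b \<theta>'. 0)"
    using AE by (intro integral_cong_AE) (auto simp: m)
  then show ?thesis using expfam_variance[OF \<theta>'] by simp
qed

definition standardized_law :: "real \<Rightarrow> real measure" where
  "standardized_law \<theta> = distr (expfam_law \<mu> T d b \<theta>) borel (\<lambda>y. (T y - deriv d \<theta>) / sqrt (deriv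
      (deriv d) \<theta>))"

lemma standardized_law_subexp:
  assumes \<theta>: "\<theta> \<in> \<Theta>" and pos: "0 < deriv (deriv d) \<theta>"
  obtains r where "0 < r" "subexp_standard r (standardized_law \<theta>)"
proof -
  let ?P = "expfam_law \<mu> T d b \<theta>"
  interpret prob_space ?P by (rule expfam_prob[OF \<theta>])
  define \<sigma> where "\<sigma> = sqrt (deriv (deriv d) \<theta>)"
  have \<sigma>: "0 < \<sigma>" "\<sigma>\<^sup>2 = deriv (deriv d) \<theta>" using pos by (auto simp: \<sigma>_def)
  obtain r where r: "0 < r" "integrable ?P (\<lambda>y. exp (r * \<bar>T y\<bar>))"
    using expfam_exponential_moment[OF \<theta>] by blast
  have st: "standardized_law \<theta> = distr ?P borel (\<lambda>y. (T y - deriv d \<theta>) / \<sigma>)"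
    by (simp add: standardized_law_def \<sigma>_def)
  have "real_distribution (standardized_law \<theta>)"
    unfolding st by (intro real_distribution_distr) simp
  moreover have "integrable (standardized_law \<theta>) (\<lambda>x. exp (r * \<sigma> * \<bar>x\<bar>))"
    unfolding st
  proof (subst integrable_distr_eq)
    show "integrable ?P (\<lambda>y. exp (r * \<sigma> * \<bar>(T y - deriv d \<theta>) / \<sigma>\<bar>))"
    proof (rule Bochner_Integration.integrable_bound)
      show "integrable ?P (\<lambda>y. exp (r * \<bar>deriv d \<theta>\<bar>) * exp (r * \<bar>T y\<bar>))" using r by simp
      have "r * \<bar>T y - deriv d \<theta>\<bar> \<le> r * \<bar>deriv d \<theta>\<bar> + r * \<bar>T y\<bar>" for y
        using r abs_triangle_ineq4[of "T y" "deriv d \<theta>"] by (simp add: distrib_left[symmetric])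
      then show "AE y in ?P. norm (exp (r * \<sigma> * \<bar>(T y - deriv d \<theta>) / \<sigma>\<bar>))
          \<le> norm (exp (r * \<bar>deriv d \<theta>\<bar>) * exp (r * \<bar>T y\<bar>))"
        using \<sigma> by (intro AE_I2) (simp add: mult_exp_exp)
    qed simp
  qed auto
  moreover have "(LINT x|standardized_law \<theta>. x) = 0"
    unfolding st using expfam_moments[OF \<theta>] by (subst integral_distr) (auto simp: prob_space)
  moreover have "(LINT x|standardized_law \<theta>. x\<^sup>2) = 1"
    unfolding st using expfam_variance[OF \<theta>] \<sigma> by (subst integral_distr) (auto simp: power_divide)
  ultimately have "subexp_standard (r * \<sigma>) (standardized_law \<theta>)" by (simp add: subexp_standard_def)
  then show thesis using that[of "r * \<sigma>"] r \<sigma> by simp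
qed

end

section \<open>Rate of the maximum likelihood estimator\<close>

lemma subexp_second_moment_sum:
  assumes r: "0 < r" and P: "subexp_standard r P" and I: "finite I"
  shows "integrable (PiM I (\<lambda>_. P)) (\<lambda>v. (\<Sum>i\<in>I. v i)\<^sup>2)"
    "(LINT v|PiM I (\<lambda>_. P). (\<Sum>i\<in>I. v i)\<^sup>2) = card I"
proof -
  interpret P': real_distribution P using P by (simp add: subexp_standard_def)
  interpret PP: product_prob_space "\<lambda>_. P" by (intro product_prob_spaceI) unfold_locales
  note i = subexp_integrable[OF r P]
  \<comment> \<open>Each product \<open>v i * v j\<close>, squares included, is written as a product
    over all coordinates, so that one product formula covers the diagonal and the off-diagonal
    terms.\<close>
  define f where "f i j k = (\<lambda>x::real. (if k = i then x else 1) * (if k = j then x else 1))" for i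
      j k :: 'a
  have f_int: "integrable P (f i j k)" for i j k
    using i by (cases "k = i"; cases "k = j") (auto simp: f_def power2_eq_square)
  have f_prod: "(\<Prod>k\<in>I. f i j k (v k)) = v i * v j" if "i \<in> I" "j \<in> I" for i j v
    using that I by (simp add: f_def prod.distrib)
  have int: "integrable (PiM I (\<lambda>_. P)) (\<lambda>v. v i * v j)" if "i \<in> I" "j \<in> I" for i j
    using PP.product_integrable_prod[OF I, of "f i j"] f_int f_prod[OF that] by simp
  have val: "(LINT v|PiM I (\<lambda>_. P). v i * v j) = (if i = j then 1 else 0)" if ij: "i \<in> I" "j \<in> I"
      for i j
  proof -
    have "(LINT v|PiM I (\<lambda>_. P). v i * v j) = (\<Prod>k\<in>I. LINT x|P. f i j k x)"
      using PP.product_integral_prod[OF I, of "f i j"] f_int f_prod[OF ij] by simp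
    also have "\<dots> = (if i = j then 1 else 0)"
    proof (cases "i = j")
      case True
      have "(LINT x|P. f i j k x) = 1" for k
        using True P P'.prob_space[unfolded P'.space_eq_univ]
        by (cases "k = j") (auto simp: f_def subexp_standard_def power2_eq_square)
      then show ?thesis using True by simp
    next
      case False
      have "(LINT x|P. f i j i x) = 0" using False P by (simp add: f_def subexp_standard_def)
      then show ?thesis using False ij I by (auto simp: prod_zero_iff)
    qed
    finally show ?thesis .
  qed
  have sq: "(\<Sum>i\<in>I. v i)\<^sup>2 = (\<Sum>i\<in>I. \<Sum>j\<in>I. v i * v j)" for v :: "'a \<Rightarrow> real"
    by (simp add: power2_eq_square sum_product)
  show "integrable (PiM I (\<lambda>_. P)) (\<lambda>v. (\<Sum>i\<in>I. v i)\<^sup>2)"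
    unfolding sq by (intro Bochner_Integration.integrable_sum int)
  show "(LINT v|PiM I (\<lambda>_. P). (\<Sum>i\<in>I. v i)\<^sup>2) = card I"
    unfolding sq using int val I
    by (simp add: Bochner_Integration.integral_sum Bochner_Integration.integrable_sum)
qed

lemma subexp_chebyshev:
  assumes r: "0 < r" and P: "subexp_standard r P" and I: "finite I" and s: "0 < s"
  shows "measure (PiM I (\<lambda>_. P)) {v \<in> space (PiM I (\<lambda>_. P)). s < \<bar>\<Sum>i\<in>I. v i\<bar>} \<le> card I / s\<^sup>2"
proof -
  interpret P': real_distribution P using P by (simp add: subexp_standard_def)
  interpret PI: prob_space "PiM I (\<lambda>_. P)" by (intro prob_space_PiM) unfold_locales
  note m = subexp_second_moment_sum[OF r P I]
  let ?A = "{v \<in> space (PiM I (\<lambda>_. P)). s < \<bar>\<Sum>i\<in>I. v i\<bar>}"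
  have [measurable_cong]: "sets P = sets borel" by simp
  have A: "?A \<in> PI.events" by measurable
  have "s\<^sup>2 * PI.prob ?A = (LINT v|PiM I (\<lambda>_. P). s\<^sup>2 * indicator ?A v)"
    by simp
  also have "\<dots> \<le> (LINT v|PiM I (\<lambda>_. P). (\<Sum>i\<in>I. v i)\<^sup>2)"
  proof (rule integral_mono)
    show "integrable (PiM I (\<lambda>_. P)) (\<lambda>v. s\<^sup>2 * indicator ?A v)"
      using A by (intro integrable_mult_right integrable_real_indicator) (auto simp:
          less_top[symmetric])
    fix v
    show "s\<^sup>2 * indicator ?A v \<le> (\<Sum>i\<in>I. v i)\<^sup>2"
      using s power_mono[of s "\<bar>\<Sum>i\<in>I. v i\<bar>" 2] by (auto simp: indicator_def)
  qed (rule m)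
  also have "\<dots> = card I" by (rule m)
  finally show ?thesis using s by (simp add: pos_le_divide_eq mult.commute)
qed

lemma measure_PiM_distr:
  assumes I: "finite I" and M: "prob_space M" and f[measurable]: "f \<in> M \<rightarrow>\<^sub>M borel"
    and Q: "{v \<in> space (PiM I (\<lambda>_. borel)). Q v} \<in> sets (PiM I (\<lambda>_. borel))"
  shows "measure (PiM I (\<lambda>_. distr M borel f)) {v \<in> space (PiM I (\<lambda>_. distr M borel f)). Q v} =
    measure (PiM I (\<lambda>_. M)) {y \<in> space (PiM I (\<lambda>_. M)). Q (\<lambda>i\<in>I. f (y i))}"
proof -
  have "PiM I (\<lambda>_. distr M borel f) = distr (PiM I (\<lambda>_. M)) (PiM I (\<lambda>_. distr M borel f)) (compose
      I f)"
  proof -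
    have "distr (PiM I (\<lambda>_. M)) (PiM I (\<lambda>_. distr M borel f)) (compose I f) =
        PiM I (\<lambda>_. distr M (distr M borel f) f)"
      using M by (intro distr_PiM_finite_prob_space' I prob_space.prob_space_distr) auto
    also have "distr M (distr M borel f) f = distr M borel f" by (rule distr_cong) auto
    finally show ?thesis by simp
  qed
  also have "\<dots> = distr (PiM I (\<lambda>_. M)) (PiM I (\<lambda>_. borel)) (\<lambda>y. \<lambda>i\<in>I. f (y i))"
    by (intro distr_cong sets_PiM_cong refl) (auto simp: compose_def)
  finally have eq: "PiM I (\<lambda>_. distr M borel f) = \<dots>" .
  have meas: "(\<lambda>y. \<lambda>i\<in>I. f (y i)) \<in> PiM I (\<lambda>_. M) \<rightarrow>\<^sub>M PiM I (\<lambda>_. borel)" by measurable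
  have "measure (distr (PiM I (\<lambda>_. M)) (PiM I (\<lambda>_. borel)) (\<lambda>y. \<lambda>i\<in>I. f (y i)))
      {v \<in> space (PiM I (\<lambda>_. borel)). Q v} =
    measure (PiM I (\<lambda>_. M)) ((\<lambda>y. \<lambda>i\<in>I. f (y i)) -` {v \<in> space (PiM I (\<lambda>_. borel)). Q v} \<inter> space
        (PiM I (\<lambda>_. M)))"
    by (rule measure_distr[OF meas Q])
  also have "(\<lambda>y. \<lambda>i\<in>I. f (y i)) -` {v \<in> space (PiM I (\<lambda>_. borel)). Q v} \<inter> space (PiM I (\<lambda>_. M)) =
      {y \<in> space (PiM I (\<lambda>_. M)). Q (\<lambda>i\<in>I. f (y i))}"
    by (auto simp: space_PiM)
  finally show ?thesis unfolding eq by (simp only: space_distr)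
qed

locale nondegenerate_exponential_family = smooth_exponential_family +
  assumes deriv2_pos: "\<theta> \<in> \<Theta> \<Longrightarrow> 0 < deriv (deriv d) \<theta>"
begin

lemma expfam_interval: "s \<in> \<Theta> \<Longrightarrow> t \<in> \<Theta> \<Longrightarrow> s \<le> u \<Longrightarrow> u \<le> t \<Longrightarrow> u \<in> \<Theta>"
  using family mem_is_interval_1_I[of \<Theta> s t u] by (simp add: exponential_family_def)

lemma expfam_deriv_less:
  assumes "s \<in> \<Theta>" "t \<in> \<Theta>" "s < t"
  shows "deriv d s < deriv d t"
proof (rule DERIV_pos_imp_increasing[OF assms(3)])
  fix u assume "s \<le> u" "u \<le> t"
  then have "u \<in> \<Theta>" using assms(1,2) by (rule expfam_interval[rotated 2])
  then show "\<exists>y. DERIV (deriv d) u :> y \<and> 0 < y"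
    using expfam_deriv(2) deriv2_pos by blast
qed

lemma expfam_strictly_convex:
  assumes s: "s \<in> \<Theta>" and t: "t \<in> \<Theta>" and st: "s \<noteq> t"
  shows "d s + deriv d s * (t - s) < d t"
proof -
  consider "s < t" | "t < s" using st by linarith
  then show ?thesis
  proof cases
    case 1
    have "(d has_real_derivative deriv d u) (at u)" if "s \<le> u" "u \<le> t" for u
      using expfam_deriv(1)[OF expfam_interval[OF s t that]] .
    from MVT2[OF 1 this] obtain u where u: "s < u" "u < t" "d t - d s = (t - s) * deriv d u"
      by blast
    have "u \<in> \<Theta>" using u(1,2) by (intro expfam_interval[OF s t]) auto
    then have "(t - s) * deriv d s < (t - s) * deriv d u"
      using 1 by (intro mult_strict_left_mono expfam_deriv_less s u(1)) auto
    then show ?thesis unfolding mult.commute[of "deriv d s"] using u(3) by linarith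
  next
    case 2
    have "(d has_real_derivative deriv d u) (at u)" if "t \<le> u" "u \<le> s" for u
      using expfam_deriv(1)[OF expfam_interval[OF t s that]] .
    from MVT2[OF 2 this] obtain u where u: "t < u" "u < s" "d s - d t = (s - t) * deriv d u"
      by blast
    have "u \<in> \<Theta>" using u(1,2) by (intro expfam_interval[OF t s]) auto
    then have "(s - t) * deriv d u < (s - t) * deriv d s"
      using 2 by (intro mult_strict_left_mono expfam_deriv_less s u(2)) auto
    moreover have "deriv d s * (t - s) = - ((s - t) * deriv d s)" by (simp add: algebra_simps)
    ultimately show ?thesis using u(3) by linarith
  qed
qed

text \<open>By strict convexity of \<open>d\<close>, a root of the score equation is the only
  maximiser of the likelihood. Its existence also supplies the premise of the implication in
  \<open>is_mle\<close>, without which the estimator could be any point of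
  \<open>\<Theta>\<close>.\<close>

lemma mle_unique:
  assumes mle: "is_mle \<mu> T d b \<Theta> n est" and y: "y \<in> space (PiM {..<n} (\<lambda>_. \<mu>))"
    and s: "s \<in> \<Theta>" "(\<Sum>i<n. T (y i)) = real n * deriv d s" and n: "0 < n"
  shows "est y = s"
proof -
  define l where "l \<theta> = (\<Sum>i<n. expfam_log_density T d b \<theta> (y i))" for \<theta>
  have l: "l \<theta> = real n * (\<theta> * deriv d s - d \<theta>) + (\<Sum>i<n. b (y i))" for \<theta>
  proof -
    have "l \<theta> = \<theta> * (\<Sum>i<n. T (y i)) - real n * d \<theta> + (\<Sum>i<n. b (y i))"
      by (simp add: l_def expfam_log_density_def sum.distrib sum_subtractf sum_distrib_left)
    then show ?thesis unfolding s(2) by (simp add: right_diff_distrib mult.left_commute)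
  qed
  have less: "l \<theta> < l s" if "\<theta> \<in> \<Theta>" "\<theta> \<noteq> s" for \<theta>
  proof -
    have "d s + deriv d s * (\<theta> - s) < d \<theta>" using expfam_strictly_convex[OF s(1) that(1)] that(2)
        by simp
    then have "\<theta> * deriv d s - d \<theta> < s * deriv d s - d s" by (simp add: algebra_simps)
    then show ?thesis unfolding l using n by simp
  qed
  have "is_arg_max l (\<lambda>\<theta>. \<theta> \<in> \<Theta>) s"
    unfolding is_arg_max_def
  proof (intro conjI notI s(1), elim exE conjE)
    fix \<theta> assume "\<theta> \<in> \<Theta>" "l s < l \<theta>"
    then show False using less[of \<theta>] by (cases "\<theta> = s") auto
  qed
  then have "is_arg_max l (\<lambda>\<theta>. \<theta> \<in> \<Theta>) (est y)"
    using mle y unfolding is_mle_def Let_def l_def[abs_def] by blast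
  then have "est y \<in> \<Theta>" "\<not> l (est y) < l s" using s(1) by (simp_all add: is_arg_max_def)
  then show ?thesis using less by blast
qed

text \<open>Near \<open>\<theta>\<close> the function \<open>deriv d\<close> has slope above a
  positive \<open>m\<close>. An empirical mean within \<open>\<eta>\<close> of
  \<open>deriv d \<theta>\<close> thus forces a root of the score equation within
  \<open>\<eta> / m\<close> of \<open>\<theta>\<close>, and the ratio of standard deviations is
  differentiable there. The estimate is deterministic, with constants common to all \<open>n\<close>
  and all versions of the estimator.\<close>

lemma mle_lipschitz:
  assumes \<theta>: "\<theta> \<in> \<Theta>"
  obtains K \<eta>0 where "0 < K" "0 < \<eta>0"
    "\<And>n est y \<eta>. is_mle \<mu> T d b \<Theta> n est \<Longrightarrow> y \<in> space (PiM {..<n} (\<lambda>_. \<mu>)) \<Longrightarrow> 0 < n \<Longrightarrow> \<eta> \<le> \<eta>0 \<Longrightarrow>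
       \<bar>(\<Sum>i<n. T (y i)) - real n * deriv d \<theta>\<bar> \<le> real n * \<eta> \<Longrightarrow>
       \<bar>sqrt (deriv (deriv d) \<theta>) / sqrt (deriv (deriv d) (est y)) - 1\<bar> \<le> K * \<eta>"
proof -
  note dd = expfam_deriv
  define m where "m = deriv (deriv d) \<theta> / 2"
  have m: "0 < m" using deriv2_pos[OF \<theta>] by (simp add: m_def)
  have cont: "isCont (deriv (deriv d)) \<theta>" using dd(3)[OF \<theta>] by (rule DERIV_isCont)
  have "(deriv (deriv d) \<longlongrightarrow> deriv (deriv d) \<theta>) (nhds \<theta>)"
    using cont by (simp add: isCont_def tendsto_at_iff_tendsto_nhds)
  then have ev1: "\<forall>\<^sub>F s in nhds \<theta>. m < deriv (deriv d) s"
    by (rule order_tendstoD(1)) (use m in \<open>simp add: m_def\<close>)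
  have ev2: "\<forall>\<^sub>F s in nhds \<theta>. s \<in> \<Theta>"
    using \<theta> expfam_open by (intro eventually_nhds_in_open)
  define q where "q s = sqrt (deriv (deriv d) \<theta>) / sqrt (deriv (deriv d) s)" for s
  have q1: "q \<theta> = 1" using deriv2_pos[OF \<theta>] by (simp add: q_def)
  obtain D where "(q has_real_derivative D) (at \<theta>)"
  proof -
    have "q differentiable (at \<theta>)"
      unfolding q_def using dd(3)[OF \<theta>] deriv2_pos[OF \<theta>]
      by (auto intro!: derivative_eq_intros exI simp: real_differentiable_def)
    then show ?thesis using that by (auto simp: real_differentiable_def)
  qed
  then have "((\<lambda>s. (q s - q \<theta>) / (s - \<theta>)) \<longlongrightarrow> D) (at \<theta>)"
    by (simp add: has_field_derivative_iff)
  \<comment> \<open>Adding 1 gives strict room above the limit of the difference quotients, even if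
    \<open>D\<close> is 0.\<close>
  then have "\<forall>\<^sub>F s in at \<theta>. \<bar>(q s - q \<theta>) / (s - \<theta>)\<bar> < \<bar>D\<bar> + 1"
    by (intro order_tendstoD(2)[OF tendsto_rabs]) auto
  then have ev3: "\<forall>\<^sub>F s in nhds \<theta>. \<bar>q s - 1\<bar> \<le> (\<bar>D\<bar> + 1) * \<bar>s - \<theta>\<bar>"
    unfolding eventually_at_filter
  proof eventually_elim
    case (elim s)
    show ?case
    proof (cases "s = \<theta>")
      case False
      then show ?thesis using elim q1 by (simp add: abs_divide pos_divide_less_eq)
    qed (simp add: q1)
  qed
  from ev1 ev2 ev3 have "\<forall>\<^sub>F s in nhds \<theta>. m < deriv (deriv d) s \<and> s \<in> \<Theta> \<and> \<bar>q s - 1\<bar> \<le> (\<bar>D\<bar> + 1) *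
      \<bar>s - \<theta>\<bar>"
    by (intro eventually_conj)
  then obtain e' where e': "0 < e'" "\<And>s. dist s \<theta> < e' \<Longrightarrow> m < deriv (deriv d) s \<and> s \<in> \<Theta> \<and> \<bar>q s - 1\<bar>
      \<le> (\<bar>D\<bar> + 1) * \<bar>s - \<theta>\<bar>"
    unfolding eventually_nhds_metric by blast
  \<comment> \<open>Halving the radius makes the closed interval fit into the open ball, so that its
    endpoints can be used in the intermediate value theorem.\<close>
  define e where "e = e' / 2"
  have e: "0 < e" "\<And>s. \<bar>s - \<theta>\<bar> \<le> e \<Longrightarrow> m < deriv (deriv d) s \<and> s \<in> \<Theta> \<and> \<bar>q s - 1\<bar> \<le> (\<bar>D\<bar> + 1) * \<bar>s -
      \<theta>\<bar>"
    using e' by (auto simp: e_def dist_real_def)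
  show thesis
  proof (rule that[of "(\<bar>D\<bar> + 1) / m" "m * e"])
    show "0 < (\<bar>D\<bar> + 1) / m" "0 < m * e" using m e by (auto simp: add_nonneg_pos)
    fix n est y \<eta>
    assume mle: "is_mle \<mu> T d b \<Theta> n est" and y: "y \<in> space (PiM {..<n} (\<lambda>_. \<mu>))" and n: "0 < n"
      and \<eta>: "\<eta> \<le> m * e" and dev: "\<bar>(\<Sum>i<n. T (y i)) - real n * deriv d \<theta>\<bar> \<le> real n * \<eta>"
    define w where "w = \<eta> / m"
    define \<tau> where "\<tau> = (\<Sum>i<n. T (y i)) / real n"
    have "0 \<le> real n * \<eta>" using dev abs_ge_zero by (rule order_trans[rotated])
    then have \<eta>0: "0 \<le> \<eta>" using n by (simp add: zero_le_mult_iff)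
    have w: "0 \<le> w" "w \<le> e" "m * w = \<eta>" using \<eta> \<eta>0 m by (auto simp: w_def field_simps)
    have \<tau>: "\<bar>\<tau> - deriv d \<theta>\<bar> \<le> \<eta>"
    proof -
      have "real n * \<bar>\<tau> - deriv d \<theta>\<bar> = \<bar>real n * (\<tau> - deriv d \<theta>)\<bar>" by (simp add: abs_mult)
      also have "\<dots> \<le> real n * \<eta>" using dev n by (simp add: \<tau>_def algebra_simps)
      finally show ?thesis using n by simp
    qed
    have grow: "m * (t - s) \<le> deriv d t - deriv d s" if "\<theta> - w \<le> s" "s \<le> t" "t \<le> \<theta> + w" for s t
    proof (cases "s = t")
      case False
      then have st: "s < t" using that by simp
      have "(deriv d has_real_derivative deriv (deriv d) u) (at u)" if "s \<le> u" "u \<le> t" for u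
      proof -
        have "\<bar>u - \<theta>\<bar> \<le> e" using that \<open>\<theta> - w \<le> s\<close> \<open>t \<le> \<theta> + w\<close> w by linarith
        then show ?thesis using dd(2) e(2) by blast
      qed
      from MVT2[OF st this] obtain u where u: "s < u" "u < t" "deriv d t - deriv d s = (t - s) *
          deriv (deriv d) u" by blast
      have "m < deriv (deriv d) u" using e(2)[of u] u that w by simp
      then have "(t - s) * m \<le> (t - s) * deriv (deriv d) u" using st by (intro mult_left_mono) auto
      then show ?thesis using u(3) by (simp add: mult.commute)
    qed simp
    have "m * w \<le> deriv d \<theta> - deriv d (\<theta> - w)" using grow[of "\<theta> - w" \<theta>] w by simp
    then have lo: "deriv d (\<theta> - w) \<le> \<tau>" using \<tau> w by simp
    have "m * w \<le> deriv d (\<theta> + w) - deriv d \<theta>" using grow[of \<theta> "\<theta> + w"] w by simp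
    then have hi: "\<tau> \<le> deriv d (\<theta> + w)" using \<tau> w by simp
    have "\<forall>x. \<theta> - w \<le> x \<and> x \<le> \<theta> + w \<longrightarrow> isCont (deriv d) x"
    proof (intro allI impI)
      fix x assume "\<theta> - w \<le> x \<and> x \<le> \<theta> + w"
      then have "\<bar>x - \<theta>\<bar> \<le> e" using w by linarith
      then show "isCont (deriv d) x" using dd(2) e(2) DERIV_isCont by blast
    qed
    \<comment> \<open>The growth of \<open>deriv d\<close> over a distance \<open>w\<close> on
      either side is at least \<open>m * w = \<eta>\<close>, which brackets the empirical mean
      \<open>\<tau>\<close>.\<close>
    then obtain s where s: "\<theta> - w \<le> s" "s \<le> \<theta> + w" "deriv d s = \<tau>"
      using IVT[of "deriv d" "\<theta> - w" \<tau> "\<theta> + w", OF lo hi] w by auto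
    have sw: "\<bar>s - \<theta>\<bar> \<le> w" using s by auto
    then have s\<Theta>: "s \<in> \<Theta>" "\<bar>q s - 1\<bar> \<le> (\<bar>D\<bar> + 1) * \<bar>s - \<theta>\<bar>" using e(2)[of s] w by auto
    have "est y = s"
      using s n by (intro mle_unique[OF mle y s\<Theta>(1)]) (auto simp: \<tau>_def)
    then have "\<bar>q (est y) - 1\<bar> \<le> (\<bar>D\<bar> + 1) * \<bar>s - \<theta>\<bar>" using s\<Theta> by simp
    also have "\<dots> \<le> (\<bar>D\<bar> + 1) * w" using sw by (intro mult_left_mono) auto
    also have "\<dots> = (\<bar>D\<bar> + 1) / m * \<eta>" by (simp add: w_def)
    finally show "\<bar>sqrt (deriv (deriv d) \<theta>) / sqrt (deriv (deriv d) (est y)) - 1\<bar> \<le> (\<bar>D\<bar> + 1) / m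
        * \<eta>"
      by (simp add: q_def)
  qed
qed

end

section \<open>The zero-thresholding statistic\<close>

text \<open>Multiplication by \<open>R\<close> moves a form of size at most \<open>s\<close> by at
  most \<open>\<rho> * s\<close>. Because the family contains the negative of each form, the
  one-sided event that all forms are at most \<open>s\<close> already bounds their absolute
  values.\<close>

lemma perturbed_max:
  fixes W :: "'j \<Rightarrow> 'a \<Rightarrow> real"
  assumes M: "prob_space M" and J: "finite J"
    and W[measurable]: "\<And>j. W j \<in> borel_measurable M" and R[measurable]: "R \<in> borel_measurable M"
    and sym: "\<And>j y. j \<in> J \<Longrightarrow> y \<in> space M \<Longrightarrow> \<exists>k\<in>J. W k y = - W j y"
    and bad: "bad \<in> sets M" and \<rho>: "\<And>y. y \<in> space M - bad \<Longrightarrow> \<bar>R y - 1\<bar> \<le> \<rho>"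
  defines "F \<equiv> \<lambda>u. measure M {y \<in> space M. \<forall>j\<in>J. W j y \<le> u}"
    and "H \<equiv> \<lambda>u. measure M {y \<in> space M. \<forall>j\<in>J. R y * W j y \<le> u}"
  shows "H u \<le> F (u + \<rho> * s) + (measure M bad + (1 - F s))"
    "F (u - \<rho> * s) \<le> H u + (measure M bad + (1 - F s))"
proof -
  interpret prob_space M by fact
  note J[simp]
  define S where "S t = {y \<in> space M. \<forall>j\<in>J. W j y \<le> t}" for t
  define T where "T = {y \<in> space M. \<forall>j\<in>J. R y * W j y \<le> u}"
  have S: "S t \<in> events" for t unfolding S_def by measurable
  have T: "T \<in> events" unfolding T_def by measurable
  let ?E = "bad \<union> (space M - S s)"
  have E: "?E \<in> events" using bad S by auto
  have "prob ?E \<le> prob bad + prob (space M - S s)" using bad S by (intro measure_Un_le) auto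
  then have pE: "prob ?E \<le> prob bad + (1 - F s)"
    using prob_compl[OF S[of s]] by (simp add: F_def S_def)
  have close: "\<bar>R y * W j y - W j y\<bar> \<le> \<rho> * s" if y: "y \<in> space M" "y \<notin> ?E" and j: "j \<in> J" for y j
  proof -
    obtain k where k: "k \<in> J" "W k y = - W j y" using sym[OF j y(1)] by blast
    have "W j y \<le> s" "W k y \<le> s" using y j k(1) by (auto simp: S_def)
    then have Wb: "\<bar>W j y\<bar> \<le> s" using k by auto
    have Rb: "\<bar>R y - 1\<bar> \<le> \<rho>" using \<rho> y by auto
    have "\<bar>R y * W j y - W j y\<bar> = \<bar>R y - 1\<bar> * \<bar>W j y\<bar>"
      by (simp add: abs_mult[symmetric] algebra_simps)
    also have "\<dots> \<le> \<rho> * s" using Rb Wb by (intro mult_mono) auto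
    finally show ?thesis .
  qed
  have "prob T \<le> prob (S (u + \<rho> * s) \<union> ?E)"
  proof (rule finite_measure_mono)
    show "T \<subseteq> S (u + \<rho> * s) \<union> ?E"
    proof
      fix y assume y: "y \<in> T"
      have "W j y \<le> u + \<rho> * s" if "y \<notin> ?E" "j \<in> J" for j
        using close[OF _ that] y that(2) by (fastforce simp: T_def abs_le_iff)
      then show "y \<in> S (u + \<rho> * s) \<union> ?E" using y by (auto simp: S_def T_def)
    qed
  qed (use S E in blast)
  also have "\<dots> \<le> prob (S (u + \<rho> * s)) + prob ?E" by (rule measure_Un_le[OF S E])
  finally show "H u \<le> F (u + \<rho> * s) + (prob bad + (1 - F s))"
    using pE by (simp add: F_def H_def S_def T_def)
  have "prob (S (u - \<rho> * s)) \<le> prob (T \<union> ?E)"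
  proof (rule finite_measure_mono)
    show "S (u - \<rho> * s) \<subseteq> T \<union> ?E"
    proof
      fix y assume y: "y \<in> S (u - \<rho> * s)"
      have "R y * W j y \<le> u" if "y \<notin> ?E" "j \<in> J" for j
        using close[OF _ that] y that(2) by (fastforce simp: S_def abs_le_iff)
      then show "y \<in> T \<union> ?E" using y by (auto simp: S_def T_def)
    qed
  qed (use T E in blast)
  also have "\<dots> \<le> prob T + prob ?E" by (rule measure_Un_le[OF T E])
  finally show "F (u - \<rho> * s) \<le> H u + (prob bad + (1 - F s))"
    using pE by (simp add: F_def H_def S_def T_def)
qed

text \<open>Perturbation by \<open>R\<close>, exchange for Gaussian variables and undoing of the
  smoothing are combined. The level \<open>y\<close> serves twice: as truncation of the maximum for
  the perturbation and as cutoff in the continuity estimate. Hence the Gaussian tail and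
  \<open>\<eta>\<close> each occur twice in the bound.\<close>

lemma gaussian_approximation:
  fixes a :: "'i \<Rightarrow> 'j::linorder \<Rightarrow> real" and W :: "'j \<Rightarrow> 'a \<Rightarrow> real"
  assumes J: "finite J" "J \<noteq> {}" and \<beta>: "0 < \<beta>" and \<psi>: "0 < \<psi>" "1 / \<psi> \<le> \<beta>"
    and r: "0 < r" and \<beta>b: "2 * \<beta> * b \<le> r / 2" "2 * \<beta> * b \<le> 1 / 2"
    and P: "subexp_standard r P" and I: "finite I"
    and unit: "\<And>j. j \<in> J \<Longrightarrow> (\<Sum>i\<in>I. (a i j)\<^sup>2) = 1"
    and b: "\<And>i j. i \<in> I \<Longrightarrow> j \<in> J \<Longrightarrow> \<bar>a i j\<bar> \<le> b"
    and L: "0 < L" and y: "1 \<le> y" and \<rho>0: "0 \<le> \<rho>"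
    and \<delta>: "\<delta> = ln (card J) / \<beta> + 2 * L * \<psi>" and small: "\<rho> * y + \<delta> \<le> 1"
    and M: "prob_space M" and W: "\<And>j. W j \<in> borel_measurable M" and R: "R \<in> borel_measurable M"
    and sym: "\<And>j y. j \<in> J \<Longrightarrow> y \<in> space M \<Longrightarrow> \<exists>k\<in>J. W k y = - W j y"
    and law: "\<And>t. measure M {y \<in> space M. \<forall>j\<in>J. W j y \<le> t} = max_cdf P I J a t"
    and bad: "bad \<in> sets M" and \<rho>: "\<And>y. y \<in> space M - bad \<Longrightarrow> \<bar>R y - 1\<bar> \<le> \<rho>"
    and \<eta>: "\<eta> = 2 * exp (- L) + (4 * \<beta>\<^sup>2 / \<psi>) * b *
      (tilted_moment3 (r / 2) P + tilted_moment3 (r / 2) std_normal_distribution) * harm (card I)"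
  shows "\<bar>measure M {y \<in> space M. \<forall>j\<in>J. R y * W j y \<le> u} - max_cdf std_normal_distribution I J a u\<bar>
    \<le> exp (3 / 2) * (\<rho> * y + \<delta>) * y + 2 * (real (card J) * exp (- (y - 1)\<^sup>2 / 2)) + 2 * \<eta> +
        measure M bad"
proof -
  define F where "F = max_cdf P I J a"
  define G where "G = max_cdf std_normal_distribution I J a"
  define \<kappa> where "\<kappa> = real (card J) * exp (- (y - 1)\<^sup>2 / 2)"
  have FG: "F t \<le> G (t + \<delta>) + \<eta>" and GF: "G t \<le> F (t + \<delta>) + \<eta>" for t
    using max_cdf_compare[where t = t and L = L, OF J \<beta> \<psi> r \<beta>b P std_normal_subexp I unit b]
      max_cdf_compare[where t = t and L = L, OF J \<beta> \<psi> r \<beta>b std_normal_subexp P I unit b]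
    by (simp_all add: F_def G_def \<delta> \<eta> add_ac)
  have "1 \<le> card J" using J by (simp add: Suc_leI card_gt_0_iff)
  then have "0 \<le> ln (real (card J))" by simp
  then have \<delta>0: "0 < \<delta>" using \<beta> L \<psi> by (simp add: \<delta> add_nonneg_pos)
  have \<rho>y: "0 \<le> \<rho> * y" using \<rho>0 y by simp
  \<comment> \<open>Both displacements, \<open>\<rho> * y\<close> from \<open>R\<close> and
    \<open>\<delta>\<close> from the smoothing, are undone in a single step.\<close>
  have G_cont: "G (t + (\<rho> * y + \<delta>)) \<le> G t + (exp (3 / 2) * (\<rho> * y + \<delta>) * y + \<kappa>)" for t
    unfolding G_def \<kappa>_def using \<delta>0 \<rho>y small y
    by (intro gaussian_max_continuity I J unit) auto
  have G_mono: "G s \<le> G t" if "s \<le> t" for s t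
    unfolding G_def by (intro max_cdf_mono J real_dist_normal_dist that)
  \<comment> \<open>The tail of the original maximum is inherited from the Gaussian one;
    \<open>\<delta> \<le> 1\<close> leaves the Gaussian level at \<open>y - 1\<close> or
    above.\<close>
  have tail: "1 - F y \<le> \<kappa> + \<eta>"
  proof -
    have "1 - \<kappa> \<le> G (y - 1)" unfolding G_def \<kappa>_def using y by (intro gaussian_max_tail I J unit)
        auto
    also have "\<dots> \<le> G (y - \<delta>)" using small \<rho>y by (intro G_mono) simp
    also have "\<dots> \<le> F y + \<eta>" using GF[of "y - \<delta>"] by simp
    finally show ?thesis by simp
  qed
  define H where "H = measure M {y \<in> space M. \<forall>j\<in>J. R y * W j y \<le> u}"
  have H1: "H \<le> F (u + \<rho> * y) + (measure M bad + (1 - F y))"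
    and H2: "F (u - \<rho> * y) \<le> H + (measure M bad + (1 - F y))"
    using perturbed_max[OF M J(1) W R sym bad \<rho>, of u y] unfolding law H_def F_def by simp_all
  have "F (u + \<rho> * y) \<le> G u + (exp (3 / 2) * (\<rho> * y + \<delta>) * y + \<kappa>) + \<eta>"
    using FG[of "u + \<rho> * y"] G_cont[of u] by (simp add: add_ac)
  moreover have "G u \<le> F (u - \<rho> * y) + \<eta> + (exp (3 / 2) * (\<rho> * y + \<delta>) * y + \<kappa>)"
    using GF[of "u - \<rho> * y - \<delta>"] G_cont[of "u - \<rho> * y - \<delta>"] by simp
  ultimately show ?thesis
    using H1 H2 tail unfolding H_def[symmetric] G_def[symmetric] \<kappa>_def[symmetric] by linarith
qed

section \<open>The statistic as a maximum of signed linear forms\<close>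

lemma linpred_update: "j < p \<Longrightarrow> linpred p X s ((\<lambda>_. 0)(j := h)) i = s + X i j * h"
proof -
  assume j: "j < p"
  have "(\<Sum>k<p. X i k * ((\<lambda>_. 0)(j := h)) k) = (\<Sum>k<p. if k = j then X i j * h else 0)"
    by (intro sum.cong) auto
  then show ?thesis using j by (simp add: linpred_def)
qed

text \<open>At zero coefficients all linear predictors equal \<open>s\<close>, so one common factor
  \<open>sqrt (deriv (deriv d) s)\<close> divides the whole gradient; this division is what makes
  the statistic scale-free.\<close>

lemma deriv_pic_loss:
  assumes A: "pic_antiderivative \<mu> T d \<Theta> A" and y: "\<And>i. i < n \<Longrightarrow> y i \<in> space \<mu>"
    and s: "s \<in> \<Theta>" and j: "j < p"
  shows "deriv (\<lambda>h. composite_loss id (pic_loss A) id n p X y ((\<lambda>_. 0)(j := h)) s) 0 =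
    (1 / real n) * (\<Sum>i<n. (deriv d s - T (y i)) / sqrt (deriv (deriv d) s) * X i j)"
proof (rule DERIV_imp_deriv)
  have "((\<lambda>h. A (y i) (s + X i j * h)) has_real_derivative
      (deriv d s - T (y i)) / sqrt (deriv (deriv d) s) * X i j) (at 0)" if "i < n" for i
  proof -
    have 1: "(A (y i) has_real_derivative (deriv d s - T (y i)) / sqrt (deriv (deriv d) s))
        (at ((\<lambda>h. s + X i j * h) 0))"
      using A y[OF that] s by (simp add: pic_antiderivative_def)
    have 2: "((\<lambda>h. s + X i j * h) has_real_derivative X i j) (at 0)"
      by (auto intro!: derivative_eq_intros)
    show ?thesis by (rule DERIV_chain2[OF 1 2])
  qed
  then show "((\<lambda>h. composite_loss id (pic_loss A) id n p X y ((\<lambda>_. 0)(j := h)) s)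
      has_real_derivative
      (1 / real n) * (\<Sum>i<n. (deriv d s - T (y i)) / sqrt (deriv (deriv d) s) * X i j)) (at 0)"
    unfolding composite_loss_def pic_loss_def linpred_update[OF j] id_apply
    by (intro DERIV_cmult DERIV_sum) auto
qed

text \<open>Absolute values are avoided by listing every column together with its negative.\<close>

definition signed_design :: "nat \<Rightarrow> nat \<Rightarrow> (nat \<Rightarrow> nat \<Rightarrow> real) \<Rightarrow> nat \<Rightarrow> nat \<Rightarrow> real" where
  "signed_design n p X i j = (if j < p then X i j else - X i (j - p)) / sqrt (real n)"

lemma ball_signed_design:
  "(\<forall>j\<in>{..<2 * p}. x * (\<Sum>i<n. signed_design n p X i j * v i) \<le> t) \<longleftrightarrow>
   (\<forall>j<p. \<bar>x * (\<Sum>i<n. X i j / sqrt (real n) * v i)\<bar> \<le> t)"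
proof -
  have pos: "(\<Sum>i<n. signed_design n p X i j * v i) = (\<Sum>i<n. X i j / sqrt (real n) * v i)"
    and neg: "(\<Sum>i<n. signed_design n p X i (p + j) * v i) = - (\<Sum>i<n. X i j / sqrt (real n) * v i)"
    if "j < p" for j
    using that by (simp_all add: signed_design_def sum_negf)
  have split: "{..<2 * p} = {..<p} \<union> (+) p ` {..<p}"
  proof (intro set_eqI iffI)
    fix j assume j: "j \<in> {..<2 * p}"
    show "j \<in> {..<p} \<union> (+) p ` {..<p}"
    proof (cases "j < p")
      case False
      then have "j = p + (j - p)" "j - p < p" using j by auto
      then show ?thesis by blast
    qed simp
  qed auto
  show ?thesis unfolding split ball_Un ball_simps using pos neg by (auto simp: abs_le_iff)
qed

text \<open>Centred columns annihilate constants, so the estimated mean \<open>deriv d s\<close> can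
  be replaced by any \<open>m\<close>, in particular by the true mean. The factor
  \<open>\<sigma>\<close> cancels and only standardizes the summands.\<close>

lemma zero_threshold_le_iff:
  assumes A: "pic_antiderivative \<mu> T d \<Theta> A" and y: "\<And>i. i < n \<Longrightarrow> y i \<in> space \<mu>"
    and s: "s \<in> \<Theta>" "0 < deriv (deriv d) s" and n: "0 < n" and p: "0 < p" and \<sigma>: "0 < \<sigma>"
    and centred: "\<And>j. j < p \<Longrightarrow> (\<Sum>i<n. X i j) = 0"
  shows "zero_threshold id (pic_loss A) id n p X y s \<le> t \<longleftrightarrow>
    (\<forall>j\<in>{..<2 * p}. \<sigma> / sqrt (deriv (deriv d) s) *
      (\<Sum>i<n. signed_design n p X i j * ((T (y i) - m) / \<sigma>)) \<le> sqrt n * t)"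
proof -
  define q where "q = sqrt (deriv (deriv d) s)"
  have q: "0 < q" using s by (simp add: q_def)
  define D where "D j = deriv (\<lambda>h. composite_loss id (pic_loss A) id n p X y ((\<lambda>_. 0)(j := h)) s)
      0" for j
  have D: "sqrt n * D j = - (\<sigma> / q * (\<Sum>i<n. X i j / sqrt n * ((T (y i) - m) / \<sigma>)))" if j: "j < p"
      for j
  proof -
    have n': "sqrt n * sqrt n = real n" "0 < sqrt n" using n by auto
    have "D j = (1 / real n) * (\<Sum>i<n. (deriv d s - T (y i)) / q * X i j)"
      unfolding D_def q_def by (rule deriv_pic_loss[OF A y s(1) j])
    also have "(\<Sum>i<n. (deriv d s - T (y i)) / q * X i j) =
        (deriv d s - m) / q * (\<Sum>i<n. X i j) - (\<Sum>i<n. X i j * (T (y i) - m)) / q"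
    proof -
      have "(\<Sum>i<n. (deriv d s - T (y i)) / q * X i j) =
          (\<Sum>i<n. (deriv d s - m) / q * X i j - X i j * (T (y i) - m) / q)"
        using q by (intro sum.cong refl) (simp add: diff_divide_distrib algebra_simps)
      then show ?thesis by (simp add: sum_subtractf sum_distrib_left sum_divide_distrib)
    qed
    finally have Dj: "D j = - ((\<Sum>i<n. X i j * (T (y i) - m)) / (q * (sqrt n * sqrt n)))"
      using centred[OF j] n' by simp
    have sum: "(\<Sum>i<n. X i j / sqrt n * ((T (y i) - m) / \<sigma>)) = (\<Sum>i<n. X i j * (T (y i) - m)) /
        (sqrt n * \<sigma>)"
      by (simp add: sum_divide_distrib)
    have "w * - (S / (q * (w * w))) = - (\<sigma> / q * (S / (w * \<sigma>)))" if "0 < w" for w S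
      using \<sigma> q that by (simp add: field_simps)
    from this[OF n'(2)] show ?thesis unfolding Dj sum by simp
  qed
  have "zero_threshold id (pic_loss A) id n p X y s \<le> t \<longleftrightarrow> (\<forall>j<p. \<bar>D j\<bar> \<le> t)"
    unfolding zero_threshold_def D_def using p by (subst Max_le_iff) auto
  also have "\<dots> \<longleftrightarrow> (\<forall>j<p. \<bar>sqrt n * D j\<bar> \<le> sqrt n * t)"
    using n by (simp add: abs_mult)
  also have "\<dots> \<longleftrightarrow> (\<forall>j<p. \<bar>\<sigma> / q * (\<Sum>i<n. X i j / sqrt n * ((T (y i) - m) / \<sigma>))\<bar> \<le> sqrt n * t)"
  proof -
    have "\<bar>sqrt n * D j\<bar> = \<bar>\<sigma> / q * (\<Sum>i<n. X i j / sqrt n * ((T (y i) - m) / \<sigma>))\<bar>" if "j < p" for j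
      unfolding D[OF that] by (rule abs_minus_cancel)
    then show ?thesis by (simp only: cong: imp_cong)
  qed
  also have "\<dots> \<longleftrightarrow> (\<forall>j\<in>{..<2 * p}. \<sigma> / q * (\<Sum>i<n. signed_design n p X i j * ((T (y i) - m) / \<sigma>)) \<le>
      sqrt n * t)"
    by (rule ball_signed_design[symmetric])
  finally show ?thesis by (simp only: q_def)
qed

text \<open>Division by 0 yields 0, so the integrand prescribed for the antiderivative is 0 at
  \<open>s\<close>, and every partial derivative vanishes.\<close>

lemma zero_threshold_degenerate:
  assumes A: "pic_antiderivative \<mu> T d \<Theta> A" and y: "\<And>i. i < n \<Longrightarrow> y i \<in> space \<mu>"
    and s: "s \<in> \<Theta>" "deriv (deriv d) s = 0" and p: "0 < p"
  shows "zero_threshold id (pic_loss A) id n p X y s = 0"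
proof -
  have "deriv (\<lambda>h. composite_loss id (pic_loss A) id n p X y ((\<lambda>_. 0)(j := h)) s) 0 = 0" if "j <
      p" for j
    using deriv_pic_loss[OF A y s(1) that] s(2) by simp
  then have "(\<lambda>j. \<bar>deriv (\<lambda>h. composite_loss id (pic_loss A) id n p X y ((\<lambda>_. 0)(j := h)) s) 0\<bar>) `
      {..<p} = {0}"
    using p by force
  then show ?thesis by (simp add: zero_threshold_def)
qed

lemma SUP_abs_tendsto_0:
  fixes f :: "nat \<Rightarrow> real \<Rightarrow> real"
  assumes "\<forall>\<^sub>F n in sequentially. \<forall>t. \<bar>f n t\<bar> \<le> e n" and e: "e \<longlonglongrightarrow> 0"
  shows "(\<lambda>n. SUP t. \<bar>f n t\<bar>) \<longlonglongrightarrow> 0"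
proof (rule tendsto_sandwich[OF _ _ tendsto_const e])
  show "\<forall>\<^sub>F n in sequentially. (SUP t. \<bar>f n t\<bar>) \<le> e n"
    using assms(1) by eventually_elim (auto intro: cSUP_least)
  show "\<forall>\<^sub>F n in sequentially. 0 \<le> (SUP t. \<bar>f n t\<bar>)"
    using assms(1)
  proof eventually_elim
    case (elim n)
    \<comment> \<open>A real supremum dominates its members only for sets that are bounded above;
      the eventual bound \<open>e n\<close> provides this.\<close>
    then have "bdd_above (range (\<lambda>t. \<bar>f n t\<bar>))" by (auto intro!: bdd_aboveI)
    then have "\<bar>f n 0\<bar> \<le> (SUP t. \<bar>f n t\<bar>)" by (intro cSUP_upper) auto
    then show ?case by (rule order_trans[OF abs_ge_zero])
  qed
qed

section \<open>Choice of the smoothing parameters\<close>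

lemma harm_le_1_ln: "0 < n \<Longrightarrow> harm n \<le> (1 + ln (real n) :: real)"
proof (induction n)
  case (Suc n)
  show ?case
  proof (cases "n = 0")
    case False
    have "ln (real n / real (Suc n)) \<le> real n / real (Suc n) - 1"
      using False by (intro ln_le_minus_one) auto
    then have "inverse (real (Suc n)) \<le> ln (real (Suc n)) - ln (real n)"
      using False by (simp add: ln_div field_simps)
    then show ?thesis using Suc.IH False by (simp add: harm_Suc)
  qed (simp add: harm_def)
qed simp

text \<open>As \<open>B n\<close> is at least 1, it may be dropped before taking a seventh root, or
  its fourth power lowered to the second before taking a square root.\<close>

lemma growth_consequences:
  fixes B :: "nat \<Rightarrow> real" and p :: "nat \<Rightarrow> nat"
  assumes c: "0 < c" and p: "\<forall>\<^sub>F n in sequentially. 0 < p n" and B: "\<forall>\<^sub>F n in sequentially. 1 \<le> B n"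
    and growth: "(\<lambda>n. B n ^ 4 * ln (real (p n * n)) ^ 7) \<in> O(\<lambda>n. real n powr (1 - c))"
  obtains C where "0 < C"
    "\<forall>\<^sub>F n in sequentially. ln (real (p n * n)) \<le> C * real n powr (1 / 7)"
    "\<forall>\<^sub>F n in sequentially. B n * (ln (real (p n * n)) ^ 3 * sqrt (ln (real (p n * n)))) \<le> C *
        real n powr ((1 - c) / 2)"
proof -
  obtain C0 where C0: "\<forall>\<^sub>F n in sequentially. norm (B n ^ 4 * ln (real (p n * n)) ^ 7) \<le> C0 * norm
      (real n powr (1 - c))"
    using growth by (auto elim!: landau_o.bigE)
  \<comment> \<open>A constant of at least 1 is dominated by its own powers, so it passes through
    both roots unchanged.\<close>
  define C where "C = max 1 C0"
  have C: "1 \<le> C" "C0 \<le> C" by (auto simp: C_def)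
  have key: "\<forall>\<^sub>F n in sequentially. B n ^ 4 * ln (real (p n * n)) ^ 7 \<le> C * real n powr (1 - c)
      \<and> 1 \<le> B n \<and> 0 \<le> ln (real (p n * n)) \<and> 1 \<le> real n"
    using C0 B p eventually_ge_at_top[of 1]
  proof eventually_elim
    case (elim n)
    have "1 \<le> p n * n" using elim by (simp add: Suc_leI)
    then have "1 \<le> real (p n * n)" by (metis of_nat_1 of_nat_le_iff)
    then have ln0: "0 \<le> ln (real (p n * n))" by (rule ln_ge_zero)
    have "B n ^ 4 * ln (real (p n * n)) ^ 7 \<le> C0 * real n powr (1 - c)"
      using elim(1) by simp
    also have "\<dots> \<le> C * real n powr (1 - c)" using C by (intro mult_right_mono) auto
    finally show ?case using elim ln0 by simp
  qed
  show thesis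
  proof (rule that[of C])
    show "0 < C" using C by simp
    show "\<forall>\<^sub>F n in sequentially. ln (real (p n * n)) \<le> C * real n powr (1 / 7)"
      using key
    proof eventually_elim
      case (elim n)
      define l where "l = ln (real (p n * n))"
      have l: "0 \<le> l" "B n ^ 4 * l ^ 7 \<le> C * real n powr (1 - c)" using elim by (auto simp: l_def)
      have "1 * l ^ 7 \<le> B n ^ 4 * l ^ 7"
        using elim l by (intro mult_right_mono one_le_power) auto
      also have "\<dots> \<le> C * real n powr (1 - c)" by (rule l)
      also have "\<dots> \<le> C ^ 7 * real n powr 1"
        using C c elim self_le_power[of C 7] by (intro mult_mono powr_mono) auto
      also have "\<dots> = (C * real n powr (1 / 7)) ^ 7"
        using elim by (simp add: power_mult_distrib powr_realpow[symmetric] powr_powr)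
      finally have "l ^ 7 \<le> (C * real n powr (1 / 7)) ^ 7" by simp
      then show ?case using C l power_mono_iff[of l "C * real n powr (1 / 7)" 7]
        unfolding l_def[symmetric] by simp
    qed
    show "\<forall>\<^sub>F n in sequentially. B n * (ln (real (p n * n)) ^ 3 * sqrt (ln (real (p n * n)))) \<le> C
        * real n powr ((1 - c) / 2)"
      using key
    proof eventually_elim
      case (elim n)
      define l where "l = ln (real (p n * n))"
      have l: "0 \<le> l" "B n ^ 4 * l ^ 7 \<le> C * real n powr (1 - c)" using elim by (auto simp: l_def)
      have "(B n * (l ^ 3 * sqrt l))\<^sup>2 = B n ^ 2 * l ^ 7"
        using l by (simp add: power_mult_distrib power_mult[symmetric] flip: power_Suc2)
      also have "\<dots> \<le> B n ^ 4 * l ^ 7"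
        using elim l by (intro mult_right_mono power_increasing) auto
      also have "\<dots> \<le> C * real n powr (1 - c)" by (rule l)
      also have "\<dots> \<le> C\<^sup>2 * real n powr (1 - c)"
        using C self_le_power[of C 2] by (intro mult_right_mono) auto
      also have "real n powr (1 - c) = real n powr ((1 - c) / 2) * real n powr ((1 - c) / 2)"
        unfolding powr_add[symmetric] by simp
      also have "C\<^sup>2 * \<dots> = (C * real n powr ((1 - c) / 2))\<^sup>2"
        by (simp add: power2_eq_square)
      finally show ?case unfolding l_def[symmetric] by (rule power2_le_imp_le) (use C in simp)
    qed
  qed
qed

text \<open>
  The powers of \<open>l\<close> make the smoothing errors \<open>ln p / \<beta>\<close> and \<open>L * \<psi>\<close> of order at most \<open>1 / \<surd>l\<close>,
  which compensates the factor \<open>\<surd>l\<close> of the anti-concentration inequality; then the third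
  derivative costs \<open>\<beta>\<^sup>2 / \<psi> = l\<^sup>3 * \<surd>l * n powr (3 * \<epsilon>)\<close>, the square root of the power of \<open>l\<close> in
  the growth condition. The powers of \<open>n\<close> turn boundedness into convergence.
\<close>

lemma smoothing_parameters:
  fixes n p :: nat and B c C K :: real
  defines "l \<equiv> ln (real (p * n))" and "\<epsilon> \<equiv> c / 12"
  defines "\<psi> \<equiv> real n powr (- \<epsilon>) / sqrt l" and "\<beta> \<equiv> l * sqrt l * real n powr \<epsilon>"
    and "L \<equiv> real n powr (\<epsilon> / 2)" and "y \<equiv> 1 + 2 * sqrt l"
  assumes n: "3 \<le> n" and p: "0 < p" and B: "0 \<le> B"
    and l_le: "l \<le> C * real n powr (1 / 7)"
    and Bl: "B * (l ^ 3 * sqrt l) \<le> C * real n powr ((1 - c) / 2)" and K: "0 \<le> K"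
  shows "0 < \<beta>" "0 < \<psi>" "1 / \<psi> \<le> \<beta>" "1 \<le> y"
    "2 * \<beta> * (B / sqrt n) \<le> 2 * C * real n powr (- 5 * c / 12)"
    "(4 * \<beta>\<^sup>2 / \<psi>) * (B / sqrt n) \<le> 4 * C * real n powr (- c / 4)"
    "(ln (2 * p) / \<beta> + 2 * L * \<psi>) * y \<le> 3 * real n powr (- c / 12) + 6 * real n powr (- c / 24)"
    "K * real n powr (- 1 / 4) * y * y \<le> 9 * K * C * real n powr (- 3 / 28)"
    "2 * p * exp (- (y - 1)\<^sup>2 / 2) \<le> 2 / n"
proof -
  have pn: "real n \<le> real (p * n)" using p by (metis Suc_leI mult_le_mono1 nat_mult_1
      of_nat_le_iff One_nat_def)
  have n0: "0 < real n" using n by simp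
  \<comment> \<open>From \<open>n \<ge> 3\<close> it follows that \<open>p * n\<close> exceeds
    \<open>exp 1\<close>, so \<open>l \<ge> 1\<close> and lower powers of \<open>l\<close> may be
    replaced by higher ones.\<close>
  have "3 \<le> real n" using n by simp
  then have "exp 1 \<le> real (p * n)" using exp_le pn by (meson order_trans)
  then have l1: "1 \<le> l" unfolding l_def by (subst ln_ge_iff) (auto intro: less_le_trans[OF
      exp_gt_zero])
  have sl: "1 \<le> sqrt l" "sqrt l * sqrt l = l" using l1 by auto
  show \<beta>: "0 < \<beta>" and \<psi>: "0 < \<psi>" using l1 n0 by (auto simp: \<beta>_def \<psi>_def)
  have inv\<psi>: "1 / \<psi> = sqrt l * real n powr \<epsilon>" using n0 l1 by (simp add: \<psi>_def powr_minus
      field_simps)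
  show "1 / \<psi> \<le> \<beta>" unfolding inv\<psi> \<beta>_def using l1 n0 by (intro mult_right_mono) auto
  show y1: "1 \<le> y" using l1 by (simp add: y_def)
  have y3: "y \<le> 3 * sqrt l" using sl by (simp add: y_def)
  have sqrt_n: "sqrt n = real n powr (1 / 2)" using n0 by (simp add: powr_half_sqrt)
  have Bn: "B * (l ^ 3 * sqrt l) / sqrt n \<le> C * real n powr (- c / 2)"
  proof -
    have "B * (l ^ 3 * sqrt l) / sqrt n \<le> C * real n powr ((1 - c) / 2) / sqrt n"
      using Bl by (intro divide_right_mono) auto
    also have "\<dots> = C * real n powr ((1 - c) / 2 - 1 / 2)"
      unfolding sqrt_n powr_diff by simp
    finally show ?thesis by (simp add: diff_divide_distrib)
  qed
  have "(4 * \<beta>\<^sup>2 / \<psi>) * (B / sqrt n) = 4 * \<beta>\<^sup>2 * (1 / \<psi>) * (B / sqrt n)" by simp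
  also have "\<dots> = 4 * real n powr (\<epsilon> + \<epsilon> + \<epsilon>) * (B * (l ^ 3 * sqrt l) / sqrt n)"
  proof -
    have "\<beta>\<^sup>2 = l ^ 3 * (real n powr \<epsilon> * real n powr \<epsilon>)"
      using sl(2) unfolding \<beta>_def by (simp add: power2_eq_square power3_eq_cube mult_ac)
    then show ?thesis unfolding inv\<psi> powr_add by simp
  qed
  also have "\<dots> \<le> 4 * real n powr (\<epsilon> + \<epsilon> + \<epsilon>) * (C * real n powr (- c / 2))"
    using Bn by (intro mult_left_mono) auto
  also have "\<dots> = 4 * C * real n powr (\<epsilon> + \<epsilon> + \<epsilon> + - c / 2)" unfolding powr_add by simp
  \<comment> \<open>The smoothing costs \<open>n\<close> to the power
    \<open>3 * \<epsilon> = c / 4\<close>, half of the gain \<open>c / 2\<close> from the growth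
    condition. The rest has to absorb the harmonic number.\<close>
  also have "\<epsilon> + \<epsilon> + \<epsilon> + - c / 2 = - c / 4" by (simp add: \<epsilon>_def)
  finally show "(4 * \<beta>\<^sup>2 / \<psi>) * (B / sqrt n) \<le> 4 * C * real n powr (- c / 4)" .
  have "2 * \<beta> * (B / sqrt n) \<le> 2 * real n powr \<epsilon> * (B * (l ^ 3 * sqrt l) / sqrt n)"
  proof -
    have "l * sqrt l \<le> l ^ 3 * sqrt l"
      using l1 power_increasing[of 1 3 l] by (intro mult_right_mono) auto
    moreover have "0 \<le> 2 * real n powr \<epsilon> * (B / sqrt n)" using B by simp
    ultimately have "(l * sqrt l) * (2 * real n powr \<epsilon> * (B / sqrt n)) \<le> (l ^ 3 * sqrt l) * (2 *
        real n powr \<epsilon> * (B / sqrt n))"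
      by (rule mult_right_mono)
    then show ?thesis by (simp add: \<beta>_def mult_ac)
  qed
  also have "\<dots> \<le> 2 * real n powr \<epsilon> * (C * real n powr (- c / 2))"
    using Bn by (intro mult_left_mono) auto
  also have "\<dots> = 2 * C * real n powr (\<epsilon> + - c / 2)" unfolding powr_add by simp
  also have "\<epsilon> + - c / 2 = - 5 * c / 12" by (simp add: \<epsilon>_def)
  finally show "2 * \<beta> * (B / sqrt n) \<le> 2 * C * real n powr (- 5 * c / 12)" .
  \<comment> \<open>Doubling the columns by signs costs nothing, since \<open>2 * p\<close> is still
    at most \<open>p * n\<close>.\<close>
  have "2 * p \<le> p * n" using n by simp
  then have "real (2 * p) \<le> real (p * n)" by (rule of_nat_mono)
  then have ln2p: "ln (2 * p) \<le> l" unfolding l_def using p by (subst ln_le_cancel_iff) auto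
  have "ln (2 * p) / \<beta> * y \<le> l / \<beta> * (3 * sqrt l)"
    using ln2p \<beta> y1 y3 l1 by (intro mult_mono divide_right_mono) auto
  also have "\<dots> = 3 * real n powr (- \<epsilon>)"
    using l1 n0 by (simp add: \<beta>_def powr_minus field_simps)
  finally have d1: "ln (2 * p) / \<beta> * y \<le> 3 * real n powr (- c / 12)" by (simp add: \<epsilon>_def)
  have "2 * L * \<psi> * y \<le> 2 * L * \<psi> * (3 * sqrt l)"
    using \<psi> y3 by (intro mult_left_mono) (auto simp: L_def)
  also have "\<dots> = 6 * (L * real n powr (- \<epsilon>))" using l1 by (simp add: \<psi>_def)
  also have "L * real n powr (- \<epsilon>) = real n powr (- c / 24)"
    unfolding L_def powr_add[symmetric] by (simp add: \<epsilon>_def)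
  finally have d2: "2 * L * \<psi> * y \<le> 6 * real n powr (- c / 24)" .
  show "(ln (2 * p) / \<beta> + 2 * L * \<psi>) * y \<le> 3 * real n powr (- c / 12) + 6 * real n powr (- c / 24)"
    using d1 d2 by (simp only: distrib_right)
  have "y * y \<le> (3 * sqrt l) * (3 * sqrt l)" using y1 y3 l1 by (intro mult_mono) auto
  also have "\<dots> = 9 * l" using sl by simp
  finally have yy: "y * y \<le> 9 * l" .
  \<comment> \<open>The rate \<open>n powr (- 1 / 4)\<close> of \<open>R\<close> meets
    \<open>y * y\<close>, of order \<open>l\<close> and hence at most of order
    \<open>n powr (1 / 7)\<close>; the exponents add up to -3/28.\<close>
  have "K * real n powr (- 1 / 4) * y * y \<le> K * real n powr (- 1 / 4) * (9 * (C * real n powr (1 /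
      7)))"
    unfolding mult.assoc[of _ y y] using K yy l_le by (intro mult_left_mono) auto
  also have "\<dots> = 9 * K * C * real n powr (- 1 / 4 + 1 / 7)" unfolding powr_add by simp
  finally show "K * real n powr (- 1 / 4) * y * y \<le> 9 * K * C * real n powr (- 3 / 28)" by simp
  \<comment> \<open>The choice \<open>y = 1 + 2 * sqrt l\<close> makes the exponent equal to
    \<open>- 2 * l\<close>, so the exponential is the inverse square of \<open>p * n\<close> and
    beats the \<open>2 * p\<close> terms of the union bound.\<close>
  have "exp (- (y - 1)\<^sup>2 / 2) = exp (- (l + l))" using l1 by (simp add: y_def power_mult_distrib)
  also have "\<dots> = 1 / (real (p * n) * real (p * n))"
  proof -
    have "exp l = real (p * n)" unfolding l_def using n0 p by (subst exp_ln) auto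
    then show ?thesis by (simp only: exp_minus exp_add inverse_eq_divide)
  qed
  finally have "2 * p * exp (- (y - 1)\<^sup>2 / 2) = 2 / real n * (1 / real (p * n))"
    using p n0 by (simp add: field_simps)
  also have "\<dots> \<le> 2 / real n * 1"
  proof -
    have "1 \<le> real (p * n)" using pn n by linarith
    then show ?thesis by (intro mult_left_mono) (auto simp: divide_le_eq_1 simp del: of_nat_mult)
  qed
  finally show "2 * p * exp (- (y - 1)\<^sup>2 / 2) \<le> 2 / n" by simp
qed

text \<open>The point mass at 0 covers empty designs, so that a probability law is assigned to every
  \<open>n\<close>.\<close>

definition gaussian_threshold_law :: "nat \<Rightarrow> nat \<Rightarrow> (nat \<Rightarrow> nat \<Rightarrow> real) \<Rightarrow> real measure" where
  "gaussian_threshold_law n p X = (if 0 < n \<and> 0 < p then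
     distr (std_gaussian {..<n}) borel
       (\<lambda>v. Max {(\<Sum>i<n. signed_design n p X i j * v i) / sqrt (real n) |j. j \<in> {..<2 * p}})
   else return borel 0)"

lemma gaussian_threshold_measurable:
  "(\<lambda>v. Max {(\<Sum>i<n. signed_design n p X i j * v i) / sqrt (real n) |j. j \<in> {..<2 * p}})
    \<in> borel_measurable (std_gaussian {..<n})"
  by (rule borel_measurable_Max2) auto

lemma real_distribution_gaussian_threshold: "real_distribution (gaussian_threshold_law n p X)"
proof -
  interpret prob_space "std_gaussian {..<n}" by (rule prob_space_std_gaussian)
  have "real_distribution (return borel (0::real))"
    by (simp add: real_distribution_def real_distribution_axioms_def prob_space_return)
  then show ?thesis
    unfolding gaussian_threshold_law_def
    using real_distribution_distr[OF gaussian_threshold_measurable] by simp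
qed

lemma cdf_gaussian_threshold:
  assumes "0 < n" "0 < p"
  shows "cdf (gaussian_threshold_law n p X) t =
    max_cdf std_normal_distribution {..<n} {..<2 * p} (signed_design n p X) (sqrt n * t)"
proof -
  let ?f = "\<lambda>v. Max {(\<Sum>i<n. signed_design n p X i j * v i) / sqrt (real n) |j. j \<in> {..<2 * p}}"
  have le: "?f v \<le> t \<longleftrightarrow> (\<forall>j\<in>{..<2 * p}. (\<Sum>i<n. signed_design n p X i j * v i) \<le> sqrt n * t)" for v
  proof -
    have "{..<2 * p} \<noteq> {}" using assms by (simp add: lessThan_empty_iff)
    then show ?thesis unfolding Setcompr_eq_image using assms
      by (subst Max_le_iff) (auto simp: pos_divide_le_eq mult.commute[of t])
  qed
  have "cdf (gaussian_threshold_law n p X) t = measure (std_gaussian {..<n}) (?f -` {..t} \<inter> space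
      (std_gaussian {..<n}))"
    unfolding cdf_def gaussian_threshold_law_def if_P[OF conjI[OF assms]]
    by (rule measure_distr[OF gaussian_threshold_measurable]) simp
  also have "?f -` {..t} \<inter> space (std_gaussian {..<n}) =
      {v \<in> space (std_gaussian {..<n}). \<forall>j\<in>{..<2 * p}. (\<Sum>i<n. signed_design n p X i j * v i) \<le>
          sqrt n * t}"
    using le by auto
  finally show ?thesis by (simp add: max_cdf_def)
qed

lemma model_law_null: "model_law \<mu> T d b id n p X \<theta> (\<lambda>_. 0) = PiM {..<n} (\<lambda>_. expfam_law \<mu> T d b \<theta>)"
  by (simp add: model_law_def linpred_def)


lemma signed_design_unit:
  assumes "0 < n" and "\<And>j. j < p \<Longrightarrow> (\<Sum>i<n. (X i j)\<^sup>2) = real n" and "j \<in> {..<2 * p}"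
  shows "(\<Sum>i<n. (signed_design n p X i j)\<^sup>2) = 1"
proof -
  have "(\<Sum>i<n. (signed_design n p X i j)\<^sup>2) = (\<Sum>i<n. (X i (if j < p then j else j - p))\<^sup>2) / real n"
    by (simp add: signed_design_def power_divide sum_divide_distrib)
  also have "\<dots> = 1" using assms by (subst assms(2)) auto
  finally show ?thesis .
qed

lemma signed_design_bound:
  assumes "\<And>j. j < p \<Longrightarrow> \<bar>X i j\<bar> \<le> B" and "j \<in> {..<2 * p}"
  shows "\<bar>signed_design n p X i j\<bar> \<le> B / sqrt n"
proof -
  have "\<bar>signed_design n p X i j\<bar> = \<bar>X i (if j < p then j else j - p)\<bar> / sqrt n"
    by (simp add: signed_design_def abs_divide)
  also have "\<dots> \<le> B / sqrt n" using assms by (intro divide_right_mono assms(1)) auto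
  finally show ?thesis .
qed

lemma signed_design_symmetric:
  assumes "j \<in> {..<2 * p}"
  shows "\<exists>k\<in>{..<2 * p}. \<forall>i. signed_design n p X i k = - signed_design n p X i j"
proof (cases "j < p")
  case True
  then show ?thesis by (intro bexI[of _ "j + p"]) (auto simp: signed_design_def)
next
  case False
  then show ?thesis using assms by (intro bexI[of _ "j - p"]) (auto simp: signed_design_def)
qed

lemma design_bound_ge_1:
  assumes "0 < n" "0 < p" and "\<And>i j. i < n \<Longrightarrow> j < p \<Longrightarrow> \<bar>X i j\<bar> \<le> B"
    and "\<And>j. j < p \<Longrightarrow> (\<Sum>i<n. (X i j)\<^sup>2) = real n"
  shows "1 \<le> B"
proof -
  have B0: "0 \<le> B" using assms(1-3) abs_ge_zero order_trans by blast
  have "real n = (\<Sum>i<n. (X i 0)\<^sup>2)" using assms by simp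
  also have "\<dots> \<le> (\<Sum>i<n. B\<^sup>2)"
  proof (intro sum_mono)
    fix i assume "i \<in> {..<n}"
    then have "\<bar>X i 0\<bar> \<le> B" using assms by simp
    then show "(X i 0)\<^sup>2 \<le> B\<^sup>2" using power_mono[of "\<bar>X i 0\<bar>" B 2] by simp
  qed
  also have "\<dots> = real n * B\<^sup>2" by simp
  finally have "1\<^sup>2 \<le> B\<^sup>2" using assms(1) by simp
  then show ?thesis using B0 by (rule power2_le_imp_le)
qed

context nondegenerate_exponential_family
begin

text \<open>The bound for a single sample size: the responses are standardized under the true
  parameter, the estimator is confined to \<open>R\<close>, and the exceptional event is a large
  deviation of the empirical mean.\<close>

lemma threshold_deviation:
  assumes \<theta>: "\<theta> \<in> \<Theta>" and mle: "is_mle \<mu> T d b \<Theta> n est"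
    and A: "pic_antiderivative \<mu> T d \<Theta> A"
    and n: "0 < n" and p: "0 < p"
    and bounded: "\<And>i j. i < n \<Longrightarrow> j < p \<Longrightarrow> \<bar>X i j\<bar> \<le> B"
    and centred: "\<And>j. j < p \<Longrightarrow> (\<Sum>i<n. X i j) = 0"
    and scaled: "\<And>j. j < p \<Longrightarrow> (\<Sum>i<n. (X i j)\<^sup>2) = real n"
    and r: "0 < r" and P: "subexp_standard r (standardized_law \<theta>)"
    and K: "0 \<le> K" and Lip: "\<And>y. y \<in> space (PiM {..<n} (\<lambda>_. \<mu>)) \<Longrightarrow>
       \<bar>(\<Sum>i<n. T (y i)) - real n * deriv d \<theta>\<bar> \<le> real n * real n powr (- 1 / 4) \<Longrightarrow>
       \<bar>sqrt (deriv (deriv d) \<theta>) / sqrt (deriv (deriv d) (est y)) - 1\<bar> \<le> K * real n powr (- 1 / 4)"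
    and \<beta>: "0 < \<beta>" and \<psi>: "0 < \<psi>" "1 / \<psi> \<le> \<beta>"
    and \<beta>b: "2 * \<beta> * (B / sqrt n) \<le> r / 2" "2 * \<beta> * (B / sqrt n) \<le> 1 / 2"
    and L: "0 < L" and u: "1 \<le> u"
    and \<delta>: "\<delta> = ln (2 * p) / \<beta> + 2 * L * \<psi>" and small: "K * real n powr (- 1 / 4) * u + \<delta> \<le> 1"
    and \<eta>: "\<eta> = 2 * exp (- L) + (4 * \<beta>\<^sup>2 / \<psi>) * (B / sqrt n) *
      (tilted_moment3 (r / 2) (standardized_law \<theta>) + tilted_moment3 (r / 2)
          std_normal_distribution) * harm n"
  shows "\<bar>measure (model_law \<mu> T d b id n p X \<theta> (\<lambda>_. 0))
        {y \<in> space (model_law \<mu> T d b id n p X \<theta> (\<lambda>_. 0)). zero_threshold id (pic_loss A) id n p X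
            y (est y) \<le> t}
      - cdf (gaussian_threshold_law n p X) t\<bar>
    \<le> exp (3 / 2) * (K * real n powr (- 1 / 4) * u + \<delta>) * u + 2 * (2 * p * exp (- (u - 1)\<^sup>2 / 2))
        + 2 * \<eta>
      + deriv (deriv d) \<theta> * real n powr (- 1 / 2)"
proof -
  define M where "M = PiM {..<n} (\<lambda>_. expfam_law \<mu> T d b \<theta>)"
  define \<sigma> where "\<sigma> = sqrt (deriv (deriv d) \<theta>)"
  define f where "f z = (T z - deriv d \<theta>) / \<sigma>" for z
  define W where "W j y = (\<Sum>i<n. signed_design n p X i j * f (y i))" for j and y :: "nat \<Rightarrow> 'a"
  define R where "R y = \<sigma> / sqrt (deriv (deriv d) (est y))" for y
  \<comment> \<open>A deviation \<open>n powr (- 1 / 4)\<close> of the empirical mean, expressed for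
    the standardized sum. Chebyshev then gives \<open>n / s\<^sup>2\<close>, which equals
    \<open>\<sigma>\<^sup>2 * n powr (- 1 / 2)\<close>.\<close>
  define s where "s = real n * real n powr (- 1 / 4) / \<sigma>"
  define bad where "bad = {y \<in> space M. s < \<bar>\<Sum>i<n. f (y i)\<bar>}"
  have \<sigma>: "0 < \<sigma>" "\<sigma>\<^sup>2 = deriv (deriv d) \<theta>" using deriv2_pos[OF \<theta>] by (auto simp: \<sigma>_def)
  have s0: "0 < s" using n \<sigma> by (simp add: s_def)
  have M_prob: "prob_space M" unfolding M_def by (intro prob_space_PiM expfam_prob \<theta>)
  have f_meas [measurable]: "f \<in> borel_measurable (expfam_law \<mu> T d b \<theta>)" unfolding f_def by
      measurable
  have std: "standardized_law \<theta> = distr (expfam_law \<mu> T d b \<theta>) borel f"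
    unfolding standardized_law_def f_def \<sigma>_def ..
  have sets_M: "sets M = sets (PiM {..<n} (\<lambda>_. \<mu>))"
    unfolding M_def by (intro sets_PiM_cong refl sets_expfam_law)
  have space_M: "space M = space (PiM {..<n} (\<lambda>_. \<mu>))" by (rule sets_eq_imp_space_eq[OF sets_M])
  have y_space: "y i \<in> space \<mu>" if "y \<in> space M" "i < n" for y i
    using that by (auto simp: space_M space_PiM)
  have est: "est y \<in> \<Theta>" if "y \<in> space M" for y
    using mle that unfolding is_mle_def Let_def space_M by blast
  have W_meas: "W j \<in> borel_measurable M" for j unfolding W_def M_def by measurable
  have R_meas: "R \<in> borel_measurable M"
  proof -
    have est_meas: "est \<in> borel_measurable M"
      using mle unfolding is_mle_def measurable_cong_sets[OF sets_M refl] by blast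
    \<comment> \<open>The second derivative is known to be continuous only on
      \<open>\<Theta>\<close>. Its extension by 0 is Borel on the whole line and agrees with it at
      the estimator, which takes values in \<open>\<Theta>\<close>.\<close>
    have "continuous_on \<Theta> (deriv (deriv d))"
      using expfam_deriv(3) by (intro continuous_at_imp_continuous_on) (blast intro: DERIV_isCont)
    then have "(\<lambda>x. indicator \<Theta> x *\<^sub>R deriv (deriv d) x) \<in> borel_measurable borel"
      using expfam_open by (intro borel_measurable_continuous_on_indicator) auto
    from measurable_compose[OF est_meas this]
    have "(\<lambda>y. \<sigma> / sqrt (indicator \<Theta> (est y) *\<^sub>R deriv (deriv d) (est y))) \<in> borel_measurable M"
      by measurable
    then show ?thesis by (rule measurable_cong[THEN iffD1, rotated]) (simp add: est R_def)
  qed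
  have sym: "\<exists>k\<in>{..<2 * p}. W k y = - W j y" if j: "j \<in> {..<2 * p}" for j y
  proof -
    obtain k where "k \<in> {..<2 * p}" "\<And>i. signed_design n p X i k = - signed_design n p X i j"
      using signed_design_symmetric[OF j] by blast
    then show ?thesis by (intro bexI[of _ k]) (simp_all add: W_def sum_negf)
  qed
  have law: "measure M {y \<in> space M. \<forall>j\<in>{..<2 * p}. W j y \<le> t} =
      max_cdf (standardized_law \<theta>) {..<n} {..<2 * p} (signed_design n p X) t" for t
  proof -
    have "max_cdf (standardized_law \<theta>) {..<n} {..<2 * p} (signed_design n p X) t =
        measure M {y \<in> space M. \<forall>j\<in>{..<2 * p}. (\<Sum>i<n. signed_design n p X i j * (\<lambda>i\<in>{..<n}. f (y
            i)) i) \<le> t}"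
      unfolding max_cdf_def std M_def
      by (rule measure_PiM_distr[OF _ expfam_prob[OF \<theta>] f_meas]) (auto intro: measurable_max_event)
    moreover have "(\<Sum>i<n. signed_design n p X i j * (\<lambda>i\<in>{..<n}. f (y i)) i) = W j y" for j y
      unfolding W_def by (intro sum.cong) auto
    ultimately show ?thesis by simp
  qed
  have bad_sets: "bad \<in> sets M" unfolding bad_def M_def by measurable
  have bad_le: "measure M bad \<le> deriv (deriv d) \<theta> * real n powr (- 1 / 2)"
  proof -
    have "measure M bad = measure M {y \<in> space M. s < \<bar>\<Sum>i<n. (\<lambda>i\<in>{..<n}. f (y i)) i\<bar>}"
      unfolding bad_def by simp
    also have "\<dots> = measure (PiM {..<n} (\<lambda>_. standardized_law \<theta>))
        {v \<in> space (PiM {..<n} (\<lambda>_. standardized_law \<theta>)). s < \<bar>\<Sum>i<n. v i\<bar>}"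
      unfolding std M_def
      by (rule measure_PiM_distr[OF _ expfam_prob[OF \<theta>] f_meas, symmetric]) auto
    also have "\<dots> \<le> real (card {..<n}) / s\<^sup>2" by (rule subexp_chebyshev[OF r P _ s0]) simp
    also have "\<dots> = \<sigma>\<^sup>2 * (real n / (real n powr (3 / 4))\<^sup>2)"
    proof -
      have "real n * real n powr (- 1 / 4) = real n powr (3 / 4)"
        using n powr_add[of "real n" 1 "- 1 / 4"] by simp
      then show ?thesis using \<sigma> by (simp add: s_def power_divide)
    qed
    also have "real n / (real n powr (3 / 4))\<^sup>2 = real n powr (- 1 / 2)"
    proof -
      have "(real n powr (3 / 4))\<^sup>2 = real n powr (3 / 2)"
        unfolding power2_eq_square powr_add[symmetric] by simp
      then show ?thesis using n powr_diff[of "real n" 1 "3 / 2"] by simp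
    qed
    finally show ?thesis by (simp add: \<sigma>)
  qed
  have R_close: "\<bar>R y - 1\<bar> \<le> K * real n powr (- 1 / 4)" if y: "y \<in> space M - bad" for y
  proof -
    have "(\<Sum>i<n. T (y i)) - real n * deriv d \<theta> = \<sigma> * (\<Sum>i<n. f (y i))"
      using \<sigma> by (simp add: f_def sum_divide_distrib[symmetric] sum_subtractf)
    moreover have "\<sigma> * \<bar>\<Sum>i<n. f (y i)\<bar> \<le> \<sigma> * s"
      using y \<sigma> by (intro mult_left_mono) (auto simp: bad_def)
    ultimately have "\<bar>(\<Sum>i<n. T (y i)) - real n * deriv d \<theta>\<bar> \<le> real n * real n powr (- 1 / 4)"
      using \<sigma> by (simp add: abs_mult s_def)
    then show ?thesis using Lip[of y] y unfolding R_def \<sigma>_def space_M by blast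
  qed
  have card: "card {..<2 * p} = 2 * p" by simp
  have event: "{y \<in> space M. zero_threshold id (pic_loss A) id n p X y (est y) \<le> t} =
      {y \<in> space M. \<forall>j\<in>{..<2 * p}. R y * W j y \<le> sqrt n * t}"
  proof -
    have "zero_threshold id (pic_loss A) id n p X y (est y) \<le> t \<longleftrightarrow> (\<forall>j\<in>{..<2 * p}. R y * W j y \<le>
        sqrt n * t)"
      if y: "y \<in> space M" for y
      unfolding R_def W_def f_def
      by (rule zero_threshold_le_iff[OF A y_space[OF y] est[OF y] deriv2_pos[OF est[OF y]] n p
          \<sigma>(1) centred])
    then show ?thesis by blast
  qed
  have ne: "{..<2 * p} \<noteq> {}" using p by (simp add: lessThan_empty_iff)
  have "\<bar>measure M {y \<in> space M. \<forall>j\<in>{..<2 * p}. R y * W j y \<le> sqrt n * t}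
      - max_cdf std_normal_distribution {..<n} {..<2 * p} (signed_design n p X) (sqrt n * t)\<bar>
    \<le> exp (3 / 2) * (K * real n powr (- 1 / 4) * u + \<delta>) * u
      + 2 * (real (card {..<2 * p}) * exp (- (u - 1)\<^sup>2 / 2)) + 2 * \<eta> + measure M bad"
    by (rule gaussian_approximation[where b = "B / sqrt n", OF _ ne \<beta> \<psi> r \<beta>b P _
          signed_design_unit[OF n scaled] signed_design_bound[OF bounded] L u _ _ small M_prob
              W_meas R_meas sym law bad_sets R_close])
       (use K \<delta> \<eta> in auto)
  then show ?thesis
    unfolding model_law_null M_def[symmetric] event cdf_gaussian_threshold[OF n p] card
    using bad_le by simp
qed

end

section \<open>Asymptotic pivotality\<close>

context nondegenerate_exponential_family
begin

lemma threshold_convergence: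
  fixes X :: "nat \<Rightarrow> nat \<Rightarrow> nat \<Rightarrow> real" and p :: "nat \<Rightarrow> nat" and B :: "nat \<Rightarrow> real" and c :: real
  assumes \<theta>: "\<theta> \<in> \<Theta>" and mle: "\<And>n. is_mle \<mu> T d b \<Theta> n (est n)"
    and A: "pic_antiderivative \<mu> T d \<Theta> A"
    and p_pos: "\<forall>\<^sub>F n in sequentially. 0 < p n"
    and bounded: "\<forall>\<^sub>F n in sequentially. \<forall>i<n. \<forall>j<p n. \<bar>X n i j\<bar> \<le> B n"
    and centred: "\<forall>\<^sub>F n in sequentially. \<forall>j<p n. (\<Sum>i<n. X n i j) = 0"
    and scaled: "\<forall>\<^sub>F n in sequentially. \<forall>j<p n. (\<Sum>i<n. (X n i j)\<^sup>2) = real n"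
    and c: "0 < c"
    and growth: "(\<lambda>n. B n ^ 4 * ln (real (p n * n)) ^ 7) \<in> O(\<lambda>n. real n powr (1 - c))"
  shows "(\<lambda>n. SUP t. \<bar>measure (model_law \<mu> T d b id n (p n) (X n) \<theta> (\<lambda>_. 0))
        {y \<in> space (model_law \<mu> T d b id n (p n) (X n) \<theta> (\<lambda>_. 0)).
           zero_threshold id (pic_loss A) id n (p n) (X n) y (est n y) \<le> t}
      - cdf (gaussian_threshold_law n (p n) (X n)) t\<bar>) \<longlonglongrightarrow> 0"
proof -
  obtain r where r: "0 < r" and P: "subexp_standard r (standardized_law \<theta>)"
    using standardized_law_subexp[OF \<theta> deriv2_pos[OF \<theta>]] by blast
  obtain K \<eta>0 where K: "0 < K" and \<eta>0: "0 < \<eta>0"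
    and Lip: "\<And>n est y \<eta>. is_mle \<mu> T d b \<Theta> n est \<Longrightarrow> y \<in> space (PiM {..<n} (\<lambda>_. \<mu>)) \<Longrightarrow> 0 < n \<Longrightarrow> \<eta> \<le> \<eta>0 \<Longrightarrow>
       \<bar>(\<Sum>i<n. T (y i)) - real n * deriv d \<theta>\<bar> \<le> real n * \<eta> \<Longrightarrow>
       \<bar>sqrt (deriv (deriv d) \<theta>) / sqrt (deriv (deriv d) (est y)) - 1\<bar> \<le> K * \<eta>"
    using mle_lipschitz[OF \<theta>] by blast
  have B_ge_1: "\<forall>\<^sub>F n in sequentially. 1 \<le> B n"
    using p_pos bounded scaled eventually_gt_at_top[of 0]
  proof eventually_elim
    case (elim n)
    then show ?case by (intro design_bound_ge_1[of n "p n" "X n"]) auto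
  qed
  obtain C where C: "0 < C"
    and lC: "\<forall>\<^sub>F n in sequentially. ln (real (p n * n)) \<le> C * real n powr (1 / 7)"
    and BC: "\<forall>\<^sub>F n in sequentially. B n * (ln (real (p n * n)) ^ 3 * sqrt (ln (real (p n * n)))) \<le>
        C * real n powr ((1 - c) / 2)"
    using growth_consequences[OF c p_pos B_ge_1 growth] by blast
  define M3 where "M3 = tilted_moment3 (r / 2) (standardized_law \<theta>) + tilted_moment3 (r / 2)
      std_normal_distribution"
  have M3: "0 \<le> M3" unfolding M3_def by (intro add_nonneg_nonneg tilted_moment3_nonneg)
  \<comment> \<open>This dominates the total displacement times \<open>u\<close>, which is the
    anti-concentration error up to the constant \<open>exp (3 / 2)\<close>.\<close>
  define D where "D n = 9 * K * C * real n powr (- 3 / 28) + (3 * real n powr (- c / 12) + 6 *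
      real n powr (- c / 24))" for n :: nat
  define e where "e n = exp (3 / 2) * D n + 2 * (2 / real n)
      + 2 * (2 * exp (- (real n powr (c / 24))) + 4 * C * M3 * (real n powr (- c / 4) * (1 + ln
          (real n))))
      + deriv (deriv d) \<theta> * real n powr (- 1 / 2)" for n :: nat
  have powr_0: "(\<lambda>n. real n powr s) \<longlonglongrightarrow> 0" if "s < 0" for s
    using that by (intro tendsto_neg_powr filterlim_real_sequentially)
  have exp_0: "(\<lambda>n. exp (- (real n powr (c / 24)))) \<longlonglongrightarrow> 0"
    using c by real_asymp
  have ln_0: "(\<lambda>n. real n powr (- c / 4) * (1 + ln (real n))) \<longlonglongrightarrow> 0"
    using c by real_asymp
  have inv_0: "(\<lambda>n. 2 / real n) \<longlonglongrightarrow> 0" by real_asymp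
  have "D \<longlonglongrightarrow> 9 * K * C * 0 + (3 * 0 + 6 * 0)"
    unfolding D_def using c by (intro tendsto_intros powr_0) auto
  then have D_0: "D \<longlonglongrightarrow> 0" by simp
  have "e \<longlonglongrightarrow> exp (3 / 2) * 0 + 2 * 0 + 2 * (2 * 0 + 4 * C * M3 * 0) + deriv (deriv d) \<theta> * 0"
    unfolding e_def by (intro tendsto_intros powr_0 exp_0 ln_0 D_0 inv_0) auto
  then have e_0: "e \<longlonglongrightarrow> 0" by simp
  have ev1: "\<forall>\<^sub>F n in sequentially. D n < 1" by (rule order_tendstoD(2)[OF D_0]) simp
  have ev2: "\<forall>\<^sub>F n in sequentially. real n powr (- 1 / 4) < \<eta>0"
    by (rule order_tendstoD(2)[OF powr_0]) (use \<eta>0 in auto)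
  have "(\<lambda>n. 2 * C * real n powr (- 5 * c / 12)) \<longlonglongrightarrow> 2 * C * 0"
    using c by (intro tendsto_intros powr_0) auto
  then have "(\<lambda>n. 2 * C * real n powr (- 5 * c / 12)) \<longlonglongrightarrow> 0" by simp
  then have ev3: "\<forall>\<^sub>F n in sequentially. 2 * C * real n powr (- 5 * c / 12) < min (r / 2) (1 / 2)"
    by (rule order_tendstoD(2)) (use r in auto)
  show ?thesis
  proof (rule SUP_abs_tendsto_0[OF _ e_0])
    show "\<forall>\<^sub>F n in sequentially. \<forall>t. \<bar>measure (model_law \<mu> T d b id n (p n) (X n) \<theta> (\<lambda>_. 0))
        {y \<in> space (model_law \<mu> T d b id n (p n) (X n) \<theta> (\<lambda>_. 0)).
           zero_threshold id (pic_loss A) id n (p n) (X n) y (est n y) \<le> t}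
      - cdf (gaussian_threshold_law n (p n) (X n)) t\<bar> \<le> e n"
      using p_pos bounded centred scaled B_ge_1 lC BC ev1 ev2 ev3 eventually_ge_at_top[of 3]
    proof (eventually_elim, intro allI)
      fix n t
      assume pn: "0 < p n" and bd: "\<forall>i<n. \<forall>j<p n. \<bar>X n i j\<bar> \<le> B n"
        and ct: "\<forall>j<p n. (\<Sum>i<n. X n i j) = 0" and sc: "\<forall>j<p n. (\<Sum>i<n. (X n i j)\<^sup>2) = real n"
        and B1: "1 \<le> B n" and l: "ln (real (p n * n)) \<le> C * real n powr (1 / 7)"
        and Bl: "B n * (ln (real (p n * n)) ^ 3 * sqrt (ln (real (p n * n)))) \<le> C * real n powr
            ((1 - c) / 2)"
        and D1: "D n < 1" and e2: "real n powr (- 1 / 4) < \<eta>0"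
        and e3: "2 * C * real n powr (- 5 * c / 12) < min (r / 2) (1 / 2)" and n3: "3 \<le> n"
      define \<psi> where "\<psi> = real n powr (- (c / 12)) / sqrt (ln (real (p n * n)))"
      define \<beta> where "\<beta> = ln (real (p n * n)) * sqrt (ln (real (p n * n))) * real n powr (c / 12)"
      define L where "L = real n powr (c / 12 / 2)"
      define u where "u = 1 + 2 * sqrt (ln (real (p n * n)))"
      define \<delta> where "\<delta> = ln (2 * p n) / \<beta> + 2 * L * \<psi>"
      define \<eta> where "\<eta> = 2 * exp (- L) + (4 * \<beta>\<^sup>2 / \<psi>) * (B n / sqrt n) * M3 * harm n"
      have B0: "0 \<le> B n" using B1 by simp
      note par = smoothing_parameters[OF n3 pn B0 l Bl less_imp_le[OF K],
          folded \<psi>_def \<beta>_def L_def u_def, folded \<delta>_def]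
      have n0: "0 < n" using n3 by simp
      have L0: "0 < L" using n0 by (simp add: L_def)
      have \<delta>0: "0 \<le> \<delta>" unfolding \<delta>_def using par(1,2) L0 pn by (intro add_nonneg_nonneg) auto
      have D_ge: "(K * real n powr (- 1 / 4) * u + \<delta>) * u \<le> D n"
        using par(7,8) unfolding D_def by (simp add: distrib_right)
      have "0 \<le> K * real n powr (- 1 / 4) * u + \<delta>" using K par(4) \<delta>0 by simp
      \<comment> \<open>Since \<open>u \<ge> 1\<close>, the displacement without the last factor
        \<open>u\<close> is also below \<open>D n\<close>, hence eventually below 1, as the
        continuity estimate requires.\<close>
      then have "(K * real n powr (- 1 / 4) * u + \<delta>) * 1 \<le> (K * real n powr (- 1 / 4) * u + \<delta>) * u"
        using par(4) by (intro mult_left_mono)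
      then have "K * real n powr (- 1 / 4) * u + \<delta> \<le> (K * real n powr (- 1 / 4) * u + \<delta>) * u"
        by (simp only: mult_1_right)
      from order_trans[OF this D_ge] have small: "K * real n powr (- 1 / 4) * u + \<delta> \<le> 1"
        using D1 by (rule order_trans[OF _ less_imp_le])
      have \<eta>_le: "\<eta> \<le> 2 * exp (- (real n powr (c / 24))) + 4 * C * M3 * (real n powr (- c / 4) *
          (1 + ln (real n)))"
      proof -
        have "(4 * \<beta>\<^sup>2 / \<psi>) * (B n / sqrt n) * (M3 * harm n)
            \<le> 4 * C * real n powr (- c / 4) * (M3 * (1 + ln (real n)))"
          using par(2) B0 M3 C n0
          by (intro mult_mono par(6) mult_left_mono harm_le_1_ln) (auto simp: harm_nonneg)
        then show ?thesis by (simp add: \<eta>_def L_def mult_ac)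
      qed
      have "\<bar>measure (model_law \<mu> T d b id n (p n) (X n) \<theta> (\<lambda>_. 0))
          {y \<in> space (model_law \<mu> T d b id n (p n) (X n) \<theta> (\<lambda>_. 0)).
             zero_threshold id (pic_loss A) id n (p n) (X n) y (est n y) \<le> t}
          - cdf (gaussian_threshold_law n (p n) (X n)) t\<bar>
        \<le> exp (3 / 2) * (K * real n powr (- 1 / 4) * u + \<delta>) * u
          + 2 * (2 * real (p n) * exp (- (u - 1)\<^sup>2 / 2)) + 2 * \<eta> + deriv (deriv d) \<theta> * real n powr
              (- 1 / 2)"
      proof (rule threshold_deviation[OF \<theta> mle A n0 pn, where B = "B n" and r = r and \<beta> = \<beta> and \<psi>
          = \<psi> and L = L])
        show "\<And>i j. i < n \<Longrightarrow> j < p n \<Longrightarrow> \<bar>X n i j\<bar> \<le> B n" using bd by blast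
        show "\<And>j. j < p n \<Longrightarrow> (\<Sum>i<n. X n i j) = 0" using ct by blast
        show "\<And>j. j < p n \<Longrightarrow> (\<Sum>i<n. (X n i j)\<^sup>2) = real n" using sc by blast
        show "\<bar>sqrt (deriv (deriv d) \<theta>) / sqrt (deriv (deriv d) (est n y)) - 1\<bar> \<le> K * real n powr
            (- 1 / 4)"
          if "y \<in> space (PiM {..<n} (\<lambda>_. \<mu>))"
            "\<bar>(\<Sum>i<n. T (y i)) - real n * deriv d \<theta>\<bar> \<le> real n * real n powr (- 1 / 4)" for y
          by (rule Lip[OF mle that(1) n0 less_imp_le[OF e2] that(2)])
        show "2 * \<beta> * (B n / sqrt n) \<le> r / 2" "2 * \<beta> * (B n / sqrt n) \<le> 1 / 2"
          using par(5) e3 by auto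
        show "\<eta> = 2 * exp (- L) + (4 * \<beta>\<^sup>2 / \<psi>) * (B n / sqrt n) *
            (tilted_moment3 (r / 2) (standardized_law \<theta>) + tilted_moment3 (r / 2)
                std_normal_distribution) * harm n"
          by (simp only: \<eta>_def M3_def)
      qed (use r P K par L0 \<delta>_def small in auto)
      also have "\<dots> \<le> e n"
      proof -
        have "exp (3 / 2) * (K * real n powr (- 1 / 4) * u + \<delta>) * u \<le> exp (3 / 2) * D n"
          unfolding mult.assoc[of "exp (3 / 2)"] using D_ge by (intro mult_left_mono) auto
        moreover have "2 * real (p n) * exp (- (u - 1)\<^sup>2 / 2) \<le> 2 / n"
          using par(9) by (simp only: of_nat_mult of_nat_numeral)
        ultimately show ?thesis unfolding e_def
          by (intro add_mono mult_left_mono \<eta>_le order_refl) auto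
      qed
      finally show "\<bar>measure (model_law \<mu> T d b id n (p n) (X n) \<theta> (\<lambda>_. 0))
          {y \<in> space (model_law \<mu> T d b id n (p n) (X n) \<theta> (\<lambda>_. 0)).
             zero_threshold id (pic_loss A) id n (p n) (X n) y (est n y) \<le> t}
          - cdf (gaussian_threshold_law n (p n) (X n)) t\<bar> \<le> e n" .
    qed
  qed
qed

end

lemma (in smooth_exponential_family) degenerate_pivotal:
  assumes deg: "\<And>\<theta>. \<theta> \<in> \<Theta> \<Longrightarrow> deriv (deriv d) \<theta> = 0" and mle: "\<And>n. is_mle \<mu> T d b \<Theta> n (est n)"
    and A: "pic_antiderivative \<mu> T d \<Theta> A" and p_pos: "\<forall>\<^sub>F n in sequentially. 0 < p n" and \<theta>: "\<theta> \<in> \<Theta>"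
  shows "(\<lambda>n. SUP t. \<bar>measure (model_law \<mu> T d b id n (p n) (X n) \<theta> (\<lambda>_. 0))
        {y \<in> space (model_law \<mu> T d b id n (p n) (X n) \<theta> (\<lambda>_. 0)).
           zero_threshold id (pic_loss A) id n (p n) (X n) y (est n y) \<le> t}
      - cdf (return borel 0) t\<bar>) \<longlonglongrightarrow> 0"
proof (rule SUP_abs_tendsto_0[where e = "\<lambda>_. 0"])
  show "\<forall>\<^sub>F n in sequentially. \<forall>t. \<bar>measure (model_law \<mu> T d b id n (p n) (X n) \<theta> (\<lambda>_. 0))
      {y \<in> space (model_law \<mu> T d b id n (p n) (X n) \<theta> (\<lambda>_. 0)).
         zero_threshold id (pic_loss A) id n (p n) (X n) y (est n y) \<le> t}
      - cdf (return borel 0) t\<bar> \<le> 0"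
    using p_pos
  proof (eventually_elim, intro allI)
    fix n t assume p: "0 < p n"
    define M where "M = PiM {..<n} (\<lambda>_. expfam_law \<mu> T d b \<theta>)"
    interpret M: prob_space M unfolding M_def by (intro prob_space_PiM expfam_prob \<theta>)
    have space_M: "space M = space (PiM {..<n} (\<lambda>_. \<mu>))"
      unfolding M_def by (intro sets_eq_imp_space_eq sets_PiM_cong refl sets_expfam_law)
    have "zero_threshold id (pic_loss A) id n (p n) (X n) y (est n y) = 0" if y: "y \<in> space M" for y
    proof -
      have "est n y \<in> \<Theta>" using mle[of n] y unfolding is_mle_def Let_def space_M by blast
      moreover have "y i \<in> space \<mu>" if "i < n" for i using y that by (auto simp: space_M space_PiM)
      ultimately show ?thesis using deg p by (intro zero_threshold_degenerate[OF A]) auto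
    qed
    then have "{y \<in> space M. zero_threshold id (pic_loss A) id n (p n) (X n) y (est n y) \<le> t} =
        (if 0 \<le> t then space M else {})" by auto
    then show "\<bar>measure (model_law \<mu> T d b id n (p n) (X n) \<theta> (\<lambda>_. 0))
      {y \<in> space (model_law \<mu> T d b id n (p n) (X n) \<theta> (\<lambda>_. 0)).
         zero_threshold id (pic_loss A) id n (p n) (X n) y (est n y) \<le> t}
      - cdf (return borel 0) t\<bar> \<le> 0"
      unfolding model_law_null M_def[symmetric]
      by (simp add: M.prob_space cdf_def measure_return indicator_def)
  qed
qed simp

theorem theorem9:
  fixes \<mu> :: "'y measure" and T b :: "'y \<Rightarrow> real" and d :: "real \<Rightarrow> real" and \<Theta> :: "real set"
    and X :: "nat \<Rightarrow> nat \<Rightarrow> nat \<Rightarrow> real" and p :: "nat \<Rightarrow> nat" and B :: "nat \<Rightarrow> real" and c :: real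
    and \<beta>0_hat :: "nat \<Rightarrow> (nat \<Rightarrow> 'y) \<Rightarrow> real" and A :: "'y \<Rightarrow> real \<Rightarrow> real"
  assumes family: "exponential_family \<mu> T d b \<Theta>"
    and d_C3: "C3_on \<Theta> d"
    and fourth_moment: "\<forall>\<theta>\<in>\<Theta>. integrable (expfam_law \<mu> T d b \<theta>) (\<lambda>y. T y ^ 4)"
    and mle: "\<forall>n. is_mle \<mu> T d b \<Theta> n (\<beta>0_hat n)"
    and consistent: "\<forall>\<beta>0\<in>\<Theta>. \<forall>\<epsilon>>0.
      (\<lambda>n. measure (model_law \<mu> T d b id n (p n) (X n) \<beta>0 (\<lambda>_. 0))
             {y \<in> space (model_law \<mu> T d b id n (p n) (X n) \<beta>0 (\<lambda>_. 0)).
                \<bar>\<beta>0_hat n y - \<beta>0\<bar> > \<epsilon>}) \<longlonglongrightarrow> 0"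
    and p_pos: "\<forall>\<^sub>F n in sequentially. 0 < p n"
    and bounded: "\<forall>\<^sub>F n in sequentially. \<forall>i<n. \<forall>j<p n. \<bar>X n i j\<bar> \<le> B n"
    and centred: "\<forall>\<^sub>F n in sequentially. \<forall>j<p n. (\<Sum>i<n. X n i j) = 0"
    and scaled: "\<forall>\<^sub>F n in sequentially. \<forall>j<p n. (\<Sum>i<n. (X n i j)\<^sup>2) = real n"
    and c_pos: "0 < c"
    and growth: "(\<lambda>n. B n ^ 4 * ln (real (p n * n)) ^ 7) \<in> O(\<lambda>n. real n powr (1 - c))"
    and antiderivative: "pic_antiderivative \<mu> T d \<Theta> A"
  shows "pic_asymptotically_pivotal
           (\<lambda>n \<beta>0. model_law \<mu> T d b id n (p n) (X n) \<beta>0 (\<lambda>_. 0)) \<Theta>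
           id (pic_loss A) id p X \<beta>0_hat"
proof -
  interpret smooth_exponential_family \<mu> T b d \<Theta>
    by unfold_locales (fact family d_C3)+
  show ?thesis
  \<comment> \<open>The approximating laws must be chosen before the intercept. This is possible
    because degeneracy is a property of the whole family, by
    \<open>expfam_degenerate\<close>.\<close>
  proof (cases "\<exists>\<theta>\<in>\<Theta>. deriv (deriv d) \<theta> = 0")
    case True
    then have deg: "deriv (deriv d) \<theta> = 0" if "\<theta> \<in> \<Theta>" for \<theta>
      using expfam_degenerate that by blast
    have "real_distribution (return borel (0::real))"
      by (simp add: real_distribution_def real_distribution_axioms_def prob_space_return)
    then show ?thesis
      unfolding pic_asymptotically_pivotal_def using mle
      by (intro exI[of _ "\<lambda>_. return borel 0"] conjI ballI allI degenerate_pivotal deg antiderivative p_pos) auto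
  next
    case False
    interpret nondegenerate_exponential_family \<mu> T b d \<Theta>
      using False expfam_deriv2_nonneg by unfold_locales (metis order_le_less)
    show ?thesis
      unfolding pic_asymptotically_pivotal_def using mle
      by (intro exI[of _ "\<lambda>n. gaussian_threshold_law n (p n) (X n)"] conjI ballI allI
          real_distribution_gaussian_threshold
          threshold_convergence[OF _ _ antiderivative p_pos bounded centred scaled c_pos growth]) auto
  qed
qed

end
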